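(* Let $p,q,t\in\mathbb{C}$ be such that $M:=\max\{|p|,|q|\}$ satisfies $M<|t|^2<1$. Let $$\mathbb{A}=\{z\in\mathbb{C}\mid |t|-\epsilon<|z|<|t|^{-1}+\epsilon\}$$ for infinitesimally small but positive $\epsilon$. For fixed $w\in\mathbb{T}$ let $C_w$ denote a contour inside the annulus $\mathbb{A}$ such that $C_w$ has the points $t^{-1}w$ and $t^{-1}w^{-1}$ in its interior. Let $f(z)=f(z;t)$ be a function such that $f(z)=f(z^{-1})$ and such that $f$ is holomorphic on $\mathbb{A}$. Then for all $x\in\mathbb{C}$ with $|t|<|x|<|t|^{-1}$, $$\kappa^2\int_{\mathbb{T}}\biggl(\int_{C_w}\Delta(z,w,x;t)\,f(z)\,\frac{\mathrm{d}z}{z}\biggr)\frac{\mathrm{d}w}{w}=f(x),$$ where $$\kappa=\frac{(p;p)_\infty(q;q)_\infty}{4\pi \mathrm{i}},\qquad \Delta(z,w,x;t)=\frac{\Gamma(tw^{\pm}x^{\pm},\,t^{-1}w^{\pm}z^{\pm})}{\Gamma(t^{\pm2},z^{\pm2},w^{\pm2})}.$$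
   Context: $\mathbb{T}$ is the positively oriented unit circle in $\mathbb{C}$. $(a;q)_\infty=\prod_{k\ge0}(1-aq^k)$. The elliptic gamma function is $$\Gamma(z)=\Gamma(z;p,q)=\prod_{\mu,\nu=0}^\infty\frac{1-z^{-1}p^{\mu+1}q^{\nu+1}}{1-zp^\mu q^\nu}\quad (z\neq0),$$ and $\Gamma(z_1,\dots,z_k)=\Gamma(z_1)\cdots\Gamma(z_k)$. The symbol $\pm$ in an argument means the product over all independent choices of signs: $\Gamma(z^{\pm2})=\Gamma(z^2)\Gamma(z^{-2})$ and $\Gamma(aw^{\pm}x^{\pm})=\Gamma(awx)\Gamma(awx^{-1})\Gamma(aw^{-1}x)\Gamma(aw^{-1}x^{-1})$. A (one-dimensional) contour $C$ always means a positively oriented Jordan curve with $C=C^{-1}$ (if $z\in C$ then $z^{-1}\in C$), so that if a point $z$ lies in the interior of $C$ then $z^{-1}$ lies in its exterior. "Infinitesimally small but positive $\epsilon$" means that $\epsilon>0$ is taken sufficiently small. *)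

theory Defs
  imports "HOL-Complex_Analysis.Complex_Analysis"
begin

definition qpoch_inf :: "complex \<Rightarrow> complex \<Rightarrow> complex" where
  "qpoch_inf a q = (\<Prod>k. 1 - a * q ^ k)"

text \<open>
  The double product is rendered as an iterated product, to which it is equal by absolute
  convergence for \<open>norm p < 1\<close>, \<open>norm q < 1\<close> and \<open>z\<close> not a pole.
  At a pole a factor has denominator \<open>0\<close>, so the value is \<open>0\<close> by the convention \<open>x / 0 = 0\<close>;
  hence \<open>1 / egamma p q z\<close> takes the correct value \<open>0\<close> there.
\<close>
definition egamma :: "complex \<Rightarrow> complex \<Rightarrow> complex \<Rightarrow> complex" where
  "egamma p q z =
     (\<Prod>\<mu>. \<Prod>\<nu>. (1 - inverse z * p ^ (\<mu> + 1) * q ^ (\<nu> + 1)) / (1 - z * p ^ \<mu> * q ^ \<nu>))"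

text \<open>A list, not a set, because coinciding arguments count with multiplicity.\<close>
definition egammas :: "complex \<Rightarrow> complex \<Rightarrow> complex list \<Rightarrow> complex" where
  "egammas p q zs = (\<Prod>z\<leftarrow>zs. egamma p q z)"

definition kappa :: "complex \<Rightarrow> complex \<Rightarrow> complex" where
  "kappa p q = qpoch_inf p p * qpoch_inf q q / (4 * of_real pi * \<i>)"

definition Delta :: "complex \<Rightarrow> complex \<Rightarrow> complex \<Rightarrow> complex \<Rightarrow> complex \<Rightarrow> complex \<Rightarrow> complex" where
  "Delta p q t z w x =
     egammas p q
       [t * w * x, t * w * inverse x, t * inverse w * x, t * inverse w * inverse x,
        inverse t * w * z, inverse t * w * inverse z,
        inverse t * inverse w * z, inverse t * inverse w * inverse z] /
     egammas p q
       [t ^ 2, inverse t ^ 2, z ^ 2, inverse z ^ 2, w ^ 2, inverse w ^ 2]"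

definition annulus :: "complex \<Rightarrow> real \<Rightarrow> complex set" where
  "annulus t \<epsilon> = {z. norm t - \<epsilon> < norm z \<and> norm z < inverse (norm t) + \<epsilon>}"

text \<open>
  Positively oriented (piecewise continuously differentiable) Jordan curves \<open>C\<close> with
  \<open>C = C\<^sup>-\<^sup>1\<close> for which inversion maps the interior to the exterior.
  The last condition is not a consequence of the others: it excludes symmetric curves that do not
  separate \<open>0\<close> from infinity. The point \<open>0\<close> has to be exempted from it, as its inverse in the
  extended plane is infinity, whereas \<open>inverse 0 = 0\<close> here.
\<close>
definition symmetric_contour :: "(real \<Rightarrow> complex) \<Rightarrow> bool" where
  "symmetric_contour \<gamma> \<longleftrightarrow>
     valid_path \<gamma> \<and> simple_path \<gamma> \<and> pathfinish \<gamma> = pathstart \<gamma> \<and>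
     (\<forall>z \<in> inside (path_image \<gamma>). winding_number \<gamma> z = 1) \<and>
     0 \<notin> path_image \<gamma> \<and>
     (\<forall>z \<in> path_image \<gamma>. inverse z \<in> path_image \<gamma>) \<and>
     (\<forall>z \<in> inside (path_image \<gamma>). z \<noteq> 0 \<longrightarrow> inverse z \<in> outside (path_image \<gamma>))"

end

theory Submission
  imports Defs
begin

text \<open>
  Fix \<open>w\<close> on the unit circle with \<open>w\<^sup>2 \<noteq> 1\<close>; if \<open>w\<^sup>2 = 1\<close>, then the kernel vanishes
  identically. In the annulus, the kernel \<open>\<Delta>(z, w, x; t)\<close> has only the simple poles
  \<open>w / t\<close>, \<open>1 / (t w)\<close> and their inverses, and the contour \<open>C\<^sub>w\<close> encloses the first two but not the
  last two. Replacing \<open>C\<^sub>w\<close> by a circle \<open>\<bar>z\<bar> = s\<close> with \<open>s\<close> slightly larger than \<open>1\<close> therefore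
  produces residues (\<open>contour_to_circle\<close>). They are values of a function \<open>kern\<close> of one variable, and
  after the substitution \<open>w = t z\<close> their contribution is the integral of \<open>8 \<pi> \<i> kern(z) f(z) dz / z\<close>
  over the circle \<open>\<bar>z\<bar> = 1 / \<bar>t\<bar>\<close>.

  In the remaining double integral over \<open>\<bar>w\<bar> = 1\<close> and \<open>\<bar>z\<bar> = s\<close> the integral over \<open>w\<close> is done first.
  It is an elliptic beta integral with the four parameters \<open>t x\<close>, \<open>t / x\<close>, \<open>z / t\<close>, \<open>1 / (t z)\<close> of
  product \<open>1\<close>, a degenerate case that would vanish for a contour separating the poles. By the
  addition formula for theta functions (\<open>theta_weierstrass\<close>) a constant multiple of the integrand is
  \<open>g(w) + g(1 / w)\<close> for a function with \<open>g(q / w) = - g(w)\<close>. The integral of \<open>g(w) dw / w\<close> over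
  \<open>\<bar>w\<bar>\<^sup>2 = \<bar>q\<bar>\<close> is then equal to its negative (for \<open>q = 0\<close>, the form is holomorphic near \<open>0\<close> and its
  integral over a small circle vanishes for that reason), and the integral over the unit
  circle is a sum of two residues (\<open>beta_primitive_circle_integral\<close>). The result is
  \<open>- 4 \<pi> \<i> (kern(z) + kern(1 / z))\<close>, with the same function \<open>kern\<close> as before (\<open>Delta_circle_integral\<close>).

  By the symmetry of \<open>f\<close>, the total is \<open>4 \<pi> \<i>\<close> times twice the integral of \<open>kern(z) f(z) dz / z\<close> over
  \<open>\<bar>z\<bar> = 1 / \<bar>t\<bar>\<close> minus the integrals over \<open>\<bar>z\<bar> = s\<close> and \<open>\<bar>z\<bar> = 1 / s\<close>. The only poles that can lie
  between these circles are \<open>x\<close> and \<open>1 / x\<close>, each with the residue \<open>f(x) / ((p;p)\<^sub>\<infinity> (q;q)\<^sub>\<infinity>)\<^sup>2\<close>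
  (or a single pole with twice this residue if \<open>x = 1 / x\<close>). Wherever \<open>x\<close> lies, the differences to
  the two smaller circles together pick up this residue twice (\<open>kern_integral_difference\<close>). This gives \<open>f(x) / \<kappa>\<^sup>2\<close>.
\<close>

section \<open>Products of an entire function along a geometric progression\<close>

definition geo_prod :: "(complex \<Rightarrow> complex) \<Rightarrow> complex \<Rightarrow> complex \<Rightarrow> complex" where
  "geo_prod h r a = (\<Prod>k. h (a * r ^ k))"

locale geometric_product =
  fixes h :: "complex \<Rightarrow> complex" and r :: complex
  assumes entire: "h holomorphic_on UNIV" and at_zero: "h 0 = 1" and norm_ratio: "norm r < 1"
begin

text \<open>Since \<open>h 0 = 1\<close>, the factors \<open>h (a * r ^ k)\<close> tend to \<open>1\<close> at a geometric rate, locally uniformly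
  in \<open>a\<close>.\<close>

lemma linear_bound: "\<exists>B\<ge>0. \<forall>b\<in>cball 0 R. norm (h b - 1) \<le> B * norm b"
proof -
  define S where "S = cball (0::complex) (max R 1)"
  have S: "compact S" "convex S" "0 \<in> S" "cball 0 R \<subseteq> S"
    by (auto simp: S_def)
  have d: "continuous_on S (deriv h)"
    using holomorphic_on_subset[OF holomorphic_deriv[OF entire open_UNIV]]
    by (intro holomorphic_on_imp_continuous_on) blast
  then have "bounded (deriv h ` S)"
    using S compact_continuous_image compact_imp_bounded by blast
  then obtain B where B: "\<And>x. x \<in> S \<Longrightarrow> norm (deriv h x) \<le> B"
    by (auto simp: bounded_iff)
  have "norm (h b - h 0) \<le> B * norm (b - 0)" if "b \<in> S" for b
  proof (rule field_differentiable_bound[OF \<open>convex S\<close>])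
    show "(h has_field_derivative deriv h z) (at z within S)" for z
      using entire by (meson DERIV_subset UNIV_I holomorphic_derivI open_UNIV subset_UNIV)
  qed (use B that S in auto)
  moreover have "B \<ge> 0" using B[OF S(3)] norm_ge_zero order_trans by blast
  ultimately show ?thesis using S(4) at_zero by (intro exI[of _ B]) auto
qed

lemma norm_power_le: "norm (a * r ^ k) \<le> norm a"
  using norm_ratio by (simp add: norm_mult norm_power mult_left_le power_le_one)

lemma summable_terms:
  assumes "\<forall>b\<in>cball 0 R. norm (h b - 1) \<le> B * norm b" "B \<ge> 0" "norm a \<le> R"
  shows "norm (h (a * r ^ k) - 1) \<le> B * R * norm r ^ k"
proof -
  have "norm (h (a * r ^ k) - 1) \<le> B * norm (a * r ^ k)"
    using assms norm_power_le[of a k] by auto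
  also have "\<dots> = B * (norm a * norm r ^ k)" by (simp add: norm_mult norm_power)
  also have "\<dots> \<le> B * (R * norm r ^ k)"
    by (intro mult_left_mono mult_right_mono) (use assms in auto)
  finally show ?thesis by simp
qed

lemma convergent: "convergent_prod (\<lambda>k. h (a * r ^ k))"
proof -
  obtain B where B: "B \<ge> 0" "\<forall>b\<in>cball 0 (norm a). norm (h b - 1) \<le> B * norm b"
    using linear_bound by blast
  have "summable (\<lambda>k. norm (h (a * r ^ k) - 1))"
  proof (rule summable_comparison_test')
    show "summable (\<lambda>k. B * norm a * norm r ^ k)"
      using norm_ratio by (intro summable_mult summable_geometric) auto
    show "norm (norm (h (a * r ^ k) - 1)) \<le> B * norm a * norm r ^ k" if "k \<ge> 0" for k
      using summable_terms[OF B(2,1)] by simp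
  qed
  then show ?thesis
    using abs_convergent_prod_imp_convergent_prod abs_convergent_prod_conv_summable by blast
qed

lemma has_prod: "(\<lambda>k. h (a * r ^ k)) has_prod geo_prod h r a"
  unfolding geo_prod_def using convergent by (rule convergent_prod_has_prod)

lemma split_first: "geo_prod h r a = h a * geo_prod h r (r * a)"
proof -
  have "(\<lambda>k. h (a * r ^ k)) has_prod ((\<Prod>k<1. h (a * r ^ k)) * (\<Prod>k. h (a * r ^ (k + 1))))"
    by (rule has_prod_ignore_initial_segment'[OF convergent])
  also have "(\<Prod>k<1. h (a * r ^ k)) * (\<Prod>k. h (a * r ^ (k + 1))) = h a * geo_prod h r (r * a)"
    by (simp add: geo_prod_def mult_ac)
  finally show ?thesis
    using has_prod[of a] by (rule has_prod_unique2[symmetric])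
qed

lemma nonzero:
  assumes "\<And>b. norm b \<le> norm a \<Longrightarrow> h b \<noteq> 0"
  shows "geo_prod h r a \<noteq> 0"
  unfolding geo_prod_def using assms norm_power_le by (intro prodinf_nonzero convergent) auto

lemma geo_prod_at_zero: "geo_prod h r 0 = 1"
  by (simp add: geo_prod_def at_zero)

lemma holomorphic_UNIV: "geo_prod h r holomorphic_on UNIV"
proof (rule holomorphic_uniform_sequence)
  fix z :: complex
  define R where "R = norm z + 1"
  obtain B where B: "B \<ge> 0" "\<forall>b\<in>cball 0 R. norm (h b - 1) \<le> B * norm b"
    using linear_bound by blast
  have hc: "continuous_on UNIV h" using entire holomorphic_on_imp_continuous_on by blast
  have "uniformly_convergent_on (cball 0 R) (\<lambda>N a. \<Prod>k<N. h (a * r ^ k))"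
  proof (rule uniformly_convergent_on_prod')
    show "continuous_on (cball 0 R) (\<lambda>a. h (a * r ^ k))" for k
      by (intro continuous_on_compose2[OF hc] continuous_intros) auto
    show "uniformly_convergent_on (cball 0 R) (\<lambda>N a. \<Sum>n<N. norm (h (a * r ^ n) - 1))"
    proof (rule Weierstrass_m_test')
      show "norm (norm (h (a * r ^ n) - 1)) \<le> B * R * norm r ^ n" if "a \<in> cball 0 R" for n a
        using summable_terms[OF B(2,1)] that by simp
      show "summable (\<lambda>n. B * R * norm r ^ n)"
        using norm_ratio by (intro summable_mult summable_geometric) auto
    qed
  qed simp
  then obtain g where g: "uniform_limit (cball 0 R) (\<lambda>N a. \<Prod>k<N. h (a * r ^ k)) g sequentially"
    by (auto simp: uniformly_convergent_on_def)
  have "g a = geo_prod h r a" if "a \<in> cball 0 R" for a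
  proof -
    have "(\<lambda>N. \<Prod>k<N. h (a * r ^ k)) \<longlonglongrightarrow> g a"
      using g that by (rule tendsto_uniform_limitI)
    moreover have "(\<lambda>N. \<Prod>k<N. h (a * r ^ k)) \<longlonglongrightarrow> geo_prod h r a"
      using has_prod has_prod_imp_tendsto' by blast
    ultimately show ?thesis using LIMSEQ_unique by blast
  qed
  have "uniform_limit (cball 0 R) (\<lambda>N a. \<Prod>k<N. h (a * r ^ k)) (geo_prod h r) sequentially"
    by (rule iffD1[OF uniform_limit_cong' g]) (use \<open>\<And>a. a \<in> cball 0 R \<Longrightarrow> g a = geo_prod h r a\<close> in auto)
  then have "uniform_limit (cball z 1) (\<lambda>N a. \<Prod>k<N. h (a * r ^ k)) (geo_prod h r) sequentially"
    by (rule uniform_limit_on_subset) (simp add: cball_subset_cball_iff R_def)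
  then show "\<exists>d>0. cball z d \<subseteq> UNIV \<and> uniform_limit (cball z d) (\<lambda>N a. \<Prod>k<N. h (a * r ^ k)) (geo_prod h r) sequentially"
    by (intro exI[of _ 1]) auto
next
  show "(\<lambda>a. \<Prod>k<n. h (a * r ^ k)) holomorphic_on UNIV" for n
  proof (rule holomorphic_on_prod)
    show "(\<lambda>a. h (a * r ^ k)) holomorphic_on UNIV" for k
      using holomorphic_on_compose_gen[of "\<lambda>a. a * r ^ k" UNIV h UNIV] entire
      by (simp add: o_def holomorphic_intros)
  qed
qed (rule open_UNIV)

lemma holomorphic [holomorphic_intros]:
  assumes "f holomorphic_on A"
  shows "(\<lambda>z. geo_prod h r (f z)) holomorphic_on A"
  using holomorphic_on_compose_gen[OF assms holomorphic_UNIV subset_UNIV] unfolding o_def .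

end

section \<open>The double product underlying the elliptic gamma function\<close>

text \<open>The product of \<open>1 - a p\<^sup>\<mu> q\<^sup>\<nu>\<close> over all \<open>\<mu>, \<nu>\<close>. It is entire in \<open>a\<close>, and the elliptic gamma
  function is the quotient \<open>dpoch p q (p q / z) / dpoch p q z\<close>, so that all analytic properties
  of the latter reduce to zeros and functional equations of this function.\<close>

definition dpoch :: "complex \<Rightarrow> complex \<Rightarrow> complex \<Rightarrow> complex" where
  "dpoch p q = geo_prod (geo_prod (\<lambda>a. 1 - a) q) p"

lemma qpoch_inf_eq_geo_prod: "qpoch_inf a q = geo_prod (\<lambda>a. 1 - a) q a"
  by (simp add: qpoch_inf_def geo_prod_def)

lemma geometric_product_linear: "norm q < 1 \<Longrightarrow> geometric_product (\<lambda>a. 1 - a) q"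
  by standard (auto intro!: holomorphic_intros)

locale elliptic_bases =
  fixes p q :: complex
  assumes norm_p: "norm p < 1" and norm_q: "norm q < 1"
begin

abbreviation poch_p :: "complex \<Rightarrow> complex" where "poch_p a \<equiv> qpoch_inf a p"
abbreviation poch_q :: "complex \<Rightarrow> complex" where "poch_q a \<equiv> qpoch_inf a q"
abbreviation F :: "complex \<Rightarrow> complex" where "F \<equiv> dpoch p q"

sublocale P: geometric_product "\<lambda>a. 1 - a" p
  using norm_p by (rule geometric_product_linear)
sublocale Q: geometric_product "\<lambda>a. 1 - a" q
  using norm_q by (rule geometric_product_linear)
sublocale D: geometric_product "geo_prod (\<lambda>a. 1 - a) q" p
  by standard (use Q.holomorphic_UNIV Q.geo_prod_at_zero norm_p in auto)

lemma poch_p_split: "poch_p a = (1 - a) * poch_p (p * a)"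
  using P.split_first[of a] by (simp add: qpoch_inf_eq_geo_prod)

lemma poch_nonzero:
  assumes "norm a < 1"
  shows "poch_p a \<noteq> 0" "poch_q a \<noteq> 0"
proof -
  have "1 - b \<noteq> 0" if "norm b \<le> norm a" for b :: complex
    using that assms by auto
  then show "poch_p a \<noteq> 0" "poch_q a \<noteq> 0"
    using P.nonzero[of a] Q.nonzero[of a] unfolding qpoch_inf_eq_geo_prod by blast+
qed

lemma F_split_q: "F a = poch_q a * F (p * a)"
  using D.split_first[of a] by (simp add: qpoch_inf_eq_geo_prod dpoch_def)

text \<open>The shift in \<open>p\<close> is built into the definition, whereas the shift in \<open>q\<close> has to be done in each
  factor of the outer product.\<close>

lemma F_split_p: "F a = poch_p a * F (q * a)"
proof -
  have "(\<lambda>k. (1 - a * p ^ k) * geo_prod (\<lambda>a. 1 - a) q (q * a * p ^ k)) has_prod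
          (geo_prod (\<lambda>a. 1 - a) p a * F (q * a))"
    unfolding dpoch_def by (rule has_prod_mult[OF P.has_prod D.has_prod])
  moreover have "(1 - a * p ^ k) * geo_prod (\<lambda>a. 1 - a) q (q * a * p ^ k) =
      geo_prod (\<lambda>a. 1 - a) q (a * p ^ k)" for k
    using Q.split_first[of "a * p ^ k"] by (simp only: mult_ac)
  ultimately show ?thesis
    using D.has_prod[of a] has_prod_unique2 by (simp add: qpoch_inf_eq_geo_prod dpoch_def)
qed

lemma F_nonzero:
  assumes "norm a < 1"
  shows "F a \<noteq> 0"
  unfolding dpoch_def
proof (rule D.nonzero)
  fix b :: complex
  assume "norm b \<le> norm a"
  then show "geo_prod (\<lambda>a. 1 - a) q b \<noteq> 0"
    using poch_nonzero(2)[of b] assms by (simp add: qpoch_inf_eq_geo_prod)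
qed

lemma poch_p_holomorphic [holomorphic_intros]:
  "f holomorphic_on A \<Longrightarrow> (\<lambda>z. poch_p (f z)) holomorphic_on A"
  unfolding qpoch_inf_eq_geo_prod by (rule P.holomorphic)

lemma F_holomorphic [holomorphic_intros]:
  "f holomorphic_on A \<Longrightarrow> (\<lambda>z. F (f z)) holomorphic_on A"
  unfolding dpoch_def by (rule D.holomorphic)

text \<open>At a pole, a factor of the left-hand side vanishes by the convention for division by \<open>0\<close>, and so
  does the right-hand side.\<close>

lemma egamma_eq: "egamma p q z = F (p * q / z) / F z"
proof -
  let ?L = "geo_prod (\<lambda>a. 1 - a) q"
  have inner: "(\<Prod>\<nu>. (1 - inverse z * p ^ (\<mu> + 1) * q ^ (\<nu> + 1)) / (1 - z * p ^ \<mu> * q ^ \<nu>)) =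
      ?L (p * q / z * p ^ \<mu>) / ?L (z * p ^ \<mu>)" for \<mu>
  proof -
    have "(\<lambda>\<nu>. (1 - p * q / z * p ^ \<mu> * q ^ \<nu>) / (1 - z * p ^ \<mu> * q ^ \<nu>)) has_prod
        (?L (p * q / z * p ^ \<mu>) / ?L (z * p ^ \<mu>))"
      by (rule has_prod_divide[OF Q.has_prod Q.has_prod])
    then show ?thesis
      by (intro has_prod_unique[symmetric]) (simp add: field_simps)
  qed
  have "(\<lambda>\<mu>. ?L (p * q / z * p ^ \<mu>) / ?L (z * p ^ \<mu>)) has_prod (F (p * q / z) / F z)"
    unfolding dpoch_def by (rule has_prod_divide[OF D.has_prod D.has_prod])
  then show ?thesis
    unfolding egamma_def inner by (rule has_prod_unique[symmetric])
qed

end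

section \<open>Contour integrals over pairs of homologous loops\<close>

text \<open>Both loops are joined by a path that avoids the singularities; running through the first loop,
  the connecting path, and the second loop backwards gives one loop that does not wind around any
  point outside \<open>S\<close>. This is what allows \<open>S\<close> to be an annulus.\<close>

lemma Residue_theorem_two_loops:
  assumes S: "open S" "connected S" and pts: "finite pts"
    and holo: "f holomorphic_on S - pts"
    and g: "valid_path g" "pathfinish g = pathstart g" "path_image g \<subseteq> S - pts"
    and h: "valid_path h" "pathfinish h = pathstart h" "path_image h \<subseteq> S - pts"
    and homologous: "\<And>z. z \<notin> S \<Longrightarrow> winding_number g z = winding_number h z"
  shows "contour_integral g f - contour_integral h f =
    2 * pi * \<i> * (\<Sum>p\<in>pts. (winding_number g p - winding_number h p) * residue f p)"
proof -
  have op: "open (S - pts)" using S pts by (simp add: finite_imp_closed open_Diff)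
  have "connected (S - pts)" using S pts by (intro connected_open_delete_finite) auto
  moreover have "pathstart g \<in> S - pts" "pathstart h \<in> S - pts"
    using g(3) h(3) pathstart_in_path_image by blast+
  ultimately obtain l where l: "polynomial_function l" "path_image l \<subseteq> S - pts"
      "pathstart l = pathstart g" "pathfinish l = pathstart h"
    using connected_open_polynomial_connected[OF op] by blast
  then have vl: "valid_path l" by (simp add: valid_path_polynomial_function)
  define k where "k = g +++ l +++ reversepath h +++ reversepath l"
  have vk: "valid_path k" "pathfinish k = pathstart k"
    and ik: "path_image k \<subseteq> S - pts"
    unfolding k_def using g h l vl
    by (auto intro!: valid_path_join simp: path_image_join)
  have wk: "winding_number k z = winding_number g z - winding_number h z" if "z \<notin> S - pts" for z
  proof -
    have "z \<notin> path_image g" "z \<notin> path_image h" "z \<notin> path_image l" using that g h l by auto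
    moreover have "path g" "path h" "path l" using g h vl valid_path_imp_path by auto
    ultimately show ?thesis unfolding k_def
      using g h l
      by (simp add: winding_number_join winding_number_reversepath path_image_join)
  qed
  have "contour_integral k f = 2 * pi * \<i> * (\<Sum>p\<in>pts. winding_number k p * residue f p)"
    by (rule Residue_theorem[OF S pts holo vk ik]) (use wk homologous in auto)
  moreover have "contour_integral k f = contour_integral g f - contour_integral h f"
  proof -
    have ci: "f contour_integrable_on c" if "valid_path c" "path_image c \<subseteq> S - pts" for c
      using contour_integrable_holomorphic_simple[OF holo op] that by blast
    have "f contour_integrable_on g" "f contour_integrable_on l" "f contour_integrable_on h"
      using ci g h l vl by auto
    then show ?thesis
      unfolding k_def using g h l vl
      by (simp add: contour_integrable_reversepath contour_integral_reversepath)
  qed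
  ultimately show ?thesis using wk by simp
qed

lemma winding_number_circlepath_0:
  assumes "norm z \<noteq> r" "r > 0"
  shows "winding_number (circlepath 0 r) z = (if norm z < r then 1 else 0)"
proof (cases "norm z < r")
  case True
  then show ?thesis using winding_number_circlepath[of z 0 r] by simp
next
  case False
  then have "winding_number (circlepath 0 r) z = 0"
    using assms by (intro winding_number_zero_outside[of _ "cball 0 r"]) auto
  then show ?thesis using False by simp
qed

definition open_annulus :: "real \<Rightarrow> real \<Rightarrow> complex set" where
  "open_annulus a b = {z. a < norm z \<and> norm z < b}"

lemma open_annulus [simp]: "open (open_annulus a b)"
  unfolding open_annulus_def by (intro open_Collect_conj open_Collect_less continuous_intros)

lemma connected_open_annulus [simp]: "connected (open_annulus a b)"
  using connected_annulus(1)[of a "0::complex" b] by (simp add: open_annulus_def)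

lemma circle_integral_residues:
  assumes r: "0 \<le> a" "a < r" "r < b" "a < r'" "r' < b" and pts: "finite pts"
    and holo: "f holomorphic_on open_annulus a b - pts"
    and off: "\<And>z. z \<in> pts \<Longrightarrow> norm z \<noteq> r \<and> norm z \<noteq> r'"
  shows "contour_integral (circlepath 0 r) f - contour_integral (circlepath 0 r') f =
    2 * pi * \<i> * (\<Sum>z\<in>pts. ((if norm z < r then 1 else 0) - (if norm z < r' then 1 else 0)) * residue f z)"
proof -
  have *: "winding_number (circlepath 0 r) z = winding_number (circlepath 0 r') z"
    if "z \<notin> open_annulus a b" for z
  proof -
    have "norm z \<le> a \<or> norm z \<ge> b" using that by (auto simp: open_annulus_def)
    then show ?thesis using r by (subst (1 2) winding_number_circlepath_0) auto
  qed
  have **: "path_image (circlepath 0 \<rho>) \<subseteq> open_annulus a b - pts"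
    if "a < \<rho>" "\<rho> < b" "\<And>z. z \<in> pts \<Longrightarrow> norm z \<noteq> \<rho>" for \<rho>
    using that r by (auto simp: open_annulus_def)
  have "contour_integral (circlepath 0 r) f - contour_integral (circlepath 0 r') f =
    2 * pi * \<i> * (\<Sum>z\<in>pts. (winding_number (circlepath 0 r) z - winding_number (circlepath 0 r') z) * residue f z)"
    by (rule Residue_theorem_two_loops[OF _ _ pts holo _ _ ** _ _ ** *]) (use r off in auto)
  also have "(\<Sum>z\<in>pts. (winding_number (circlepath 0 r) z - winding_number (circlepath 0 r') z) * residue f z) =
    (\<Sum>z\<in>pts. ((if norm z < r then 1 else 0) - (if norm z < r' then 1 else 0)) * residue f z)"
    using r off by (intro sum.cong) (auto simp: winding_number_circlepath_0)
  finally show ?thesis .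
qed

section \<open>Substitutions in circle integrals with respect to \<open>dz / z\<close>\<close>

lemma contour_integral_path_cong:
  assumes "\<And>x. x \<in> {0..1} \<Longrightarrow> g x = h x"
  shows "contour_integral g f = contour_integral h f"
proof -
  have "vector_derivative g (at x within {0..1}) = vector_derivative h (at x within {0..1})"
    if "x \<in> {0..1}" for x
    using that assms by (intro vector_derivative_cong_eq always_eventually) auto
  then have "(f has_contour_integral i) g \<longleftrightarrow> (f has_contour_integral i) h" for i
    unfolding has_contour_integral_def using assms by (intro has_integral_cong) auto
  then show ?thesis by (simp add: contour_integral_def contour_integrable_on_def)
qed

text \<open>Multiplication by \<open>c\<close> maps the standard parametrisation of the circle to one with a different
  starting point, which does not matter for an integral over a loop.\<close>

lemma circle_integral_scale:
  assumes "c \<noteq> 0" "r > 0"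
  shows "contour_integral (circlepath 0 r) (\<lambda>w. f (c * w) / w) =
         contour_integral (circlepath 0 (norm c * r)) (\<lambda>w. f w / w)"
proof -
  define a where "a = Arg2pi c / (2 * pi)"
  have a: "a \<in> {0..1}" using Arg2pi_lt_2pi[of c] Arg2pi_ge_0[of c] by (auto simp: a_def)
  have c: "c = of_real (norm c) * exp (2 * of_real pi * \<i> * of_real a)"
    by (rule trans[OF Arg2pi_eq[of c]]) (simp add: a_def mult_ac)
  have sh: "shiftpath a (circlepath 0 (norm c * r)) x = c * circlepath 0 r x" if "x \<in> {0..1}" for x
  proof -
    have "shiftpath a (circlepath 0 (norm c * r)) x =
        of_real (norm c * r) * exp (2 * of_real pi * \<i> * of_real (a + x))"
    proof (cases "a + x \<le> 1")
      case False
      have "exp (2 * of_real pi * \<i> * of_real (a + x - 1)) =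
          exp (2 * of_real pi * \<i> * of_real (a + x)) / exp (2 * of_real pi * \<i>)"
        by (rule trans[OF _ exp_diff]) (simp add: algebra_simps)
      then show ?thesis using False by (simp add: shiftpath_def circlepath)
    qed (simp add: shiftpath_def circlepath)
    then show ?thesis
      using arg_cong[OF c, of "\<lambda>u. u * circlepath 0 r x"]
      unfolding circlepath by (simp only: exp_add ring_distribs of_real_add of_real_mult mult_ac add_0)
  qed
  have "contour_integral (circlepath 0 (norm c * r)) (\<lambda>w. f w / w) =
        contour_integral (shiftpath a (circlepath 0 (norm c * r))) (\<lambda>w. f w / w)"
    using a by (simp add: contour_integral_shiftpath)
  also have "\<dots> = contour_integral ((\<lambda>w. c * w) \<circ> circlepath 0 r) (\<lambda>w. f w / w)"
    by (rule contour_integral_path_cong) (simp add: sh)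
  also have "\<dots> = contour_integral (circlepath 0 r) (\<lambda>w. deriv (\<lambda>w. c * w) w * (f (c * w) / (c * w)))"
    by (rule contour_integral_comp_analyticW[of _ UNIV]) (auto intro!: analytic_intros)
  also have "\<dots> = contour_integral (circlepath 0 r) (\<lambda>w. f (c * w) / w)"
    using assms by (intro contour_integral_eq) auto
  finally show ?thesis by simp
qed

lemma circle_integral_invert:
  assumes "r > 0"
  shows "contour_integral (circlepath 0 r) (\<lambda>w. f (inverse w) / w) =
         contour_integral (circlepath 0 (1 / r)) (\<lambda>w. f w / w)"
proof -
  have inv: "inverse (circlepath 0 r x) = reversepath (circlepath 0 (1 / r)) x" for x
  proof -
    have "exp (2 * of_real pi * \<i> * of_real (1 - x)) =
        exp (2 * of_real pi * \<i>) * exp (- (2 * of_real pi * \<i> * of_real x))"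
      by (rule trans[OF _ exp_add]) (simp add: algebra_simps)
    then show ?thesis by (simp add: circlepath reversepath_def exp_minus inverse_eq_divide)
  qed
  have "contour_integral (inverse \<circ> circlepath 0 r) (\<lambda>w. f w / w) =
      contour_integral (circlepath 0 r) (\<lambda>w. deriv inverse w * (f (inverse w) / inverse w))"
    using assms by (intro contour_integral_comp_analyticW[of _ "-{0}"]) (auto intro!: analytic_intros)
  also have "\<dots> = contour_integral (circlepath 0 r) (\<lambda>w. - (f (inverse w) / w))"
  proof (rule contour_integral_eq)
    fix w assume "w \<in> path_image (circlepath 0 r)"
    then have "w \<noteq> 0" using assms by auto
    then show "deriv inverse w * (f (inverse w) / inverse w) = - (f (inverse w) / w)"
      by (simp add: deriv_inverse power2_eq_square field_simps)
  qed
  finally have "contour_integral (inverse \<circ> circlepath 0 r) (\<lambda>w. f w / w) =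
      - contour_integral (circlepath 0 r) (\<lambda>w. f (inverse w) / w)"
    by (simp add: contour_integral_neg)
  moreover have "inverse \<circ> circlepath 0 r = reversepath (circlepath 0 (1 / r))"
    using inv by auto
  ultimately show ?thesis by (simp add: contour_integral_reversepath)
qed

lemma continuous_on_vector_derivative_circlepath:
  "continuous_on A (\<lambda>x. vector_derivative (circlepath z r) (at x))"
  by (simp add: vector_derivative_circlepath) (intro continuous_intros)

lemma circle_integral_swap:
  assumes "continuous_on (sphere 0 r \<times> sphere 0 r') (\<lambda>(w, z). f w z)" "r \<ge> 0" "r' \<ge> 0"
  shows "contour_integral (circlepath 0 r) (\<lambda>w. contour_integral (circlepath 0 r') (f w)) =
         contour_integral (circlepath 0 r') (\<lambda>z. contour_integral (circlepath 0 r) (\<lambda>w. f w z))"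
  using assms
  by (intro contour_integral_swap continuous_on_vector_derivative_circlepath) auto

lemma continuous_on_circle_integral:
  assumes "continuous_on (sphere 0 r \<times> sphere 0 r') (\<lambda>(w, z). f w z)" "r' \<ge> 0"
  shows "continuous_on (sphere 0 r) (\<lambda>w. contour_integral (circlepath 0 r') (f w))"
proof -
  have "continuous_on (sphere 0 r \<times> {0..1})
      (\<lambda>u. (\<lambda>(w, z). f w z) (fst u, circlepath 0 r' (snd u)) * vector_derivative (circlepath 0 r') (at (snd u)))"
  proof (intro continuous_on_mult continuous_on_compose2[OF assms(1)])
    show "continuous_on (sphere 0 r \<times> {0..1}) (\<lambda>u. vector_derivative (circlepath 0 r') (at (snd u)))"
      by (simp add: vector_derivative_circlepath) (intro continuous_intros)
    show "continuous_on (sphere 0 r \<times> {0..1}) (\<lambda>u. (fst u, circlepath 0 r' (snd u)))"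
      unfolding circlepath by (intro continuous_intros)
    show "(\<lambda>u. (fst u, circlepath 0 r' (snd u))) ` (sphere 0 r \<times> {0..1}) \<subseteq> sphere 0 r \<times> sphere 0 r'"
      using assms(2) by (auto simp: circlepath norm_mult)
  qed
  then have "continuous_on (sphere 0 r \<times> cbox 0 1)
      (\<lambda>(w, x). f w (circlepath 0 r' x) * vector_derivative (circlepath 0 r') (at x))"
    by (simp add: case_prod_unfold)
  then have "continuous_on (sphere 0 r)
      (\<lambda>w. integral (cbox 0 1) (\<lambda>x. f w (circlepath 0 r' x) * vector_derivative (circlepath 0 r') (at x)))"
    by (rule integral_continuous_on_param)
  then show ?thesis by (simp add: contour_integral_integral)
qed

lemma contour_integrable_on_circlepath_continuous:
  assumes "continuous_on (sphere 0 r) f" "r \<ge> 0"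
  shows "f contour_integrable_on circlepath 0 r"
proof -
  have "continuous_on {0..1} (\<lambda>x. f (circlepath 0 r x) * vector_derivative (circlepath 0 r) (at x))"
    using assms
    by (intro continuous_on_mult continuous_on_compose2[OF assms(1)]
         continuous_on_vector_derivative_circlepath)
       (auto simp: circlepath norm_mult intro!: continuous_intros)
  then show ?thesis
    unfolding contour_integrable_on by (rule integrable_continuous_interval)
qed

section \<open>Symmetric contours wind once around the origin\<close>

text \<open>If \<open>0\<close> were in the exterior, then inversion would map the punctured exterior to itself, because
  this is a connected set and inversion does so near infinity. But inversion also maps interior
  points to exterior ones, and doing both is impossible for an involution.\<close>

lemma symmetric_contour_winding_number_0:
  assumes C: "symmetric_contour C" and z: "z \<in> inside (path_image C)" "z \<noteq> 0"
  shows "winding_number C 0 = 1"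
proof -
  let ?I = "path_image C"
  have path: "path C" using C by (simp add: symmetric_contour_def valid_path_imp_path)
  have "0 \<in> inside ?I"
  proof (rule ccontr)
    assume "0 \<notin> inside ?I"
    then have out0: "0 \<in> outside ?I"
      using C by (auto simp: symmetric_contour_def outside_inside)
    have bdd: "bounded ?I" using path by (rule bounded_path_image)
    have op: "open (outside ?I)" using path by (simp add: closed_path_image open_outside)
    have "connected (outside ?I)" using bdd by (intro connected_outside) auto
    then have con: "connected (outside ?I - {0})"
      using op by (intro connected_open_delete) auto
    then have coni: "connected (inverse ` (outside ?I - {0}))"
      by (intro connected_continuous_image continuous_intros) auto
    have disj: "inverse ` (outside ?I - {0}) \<inter> ?I = {}"
    proof -
      have False if "u \<in> outside ?I" "inverse u \<in> ?I" for u
        using that C by (metis symmetric_contour_def inverse_inverse_eq outside_no_overlap IntI empty_iff)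
      then show ?thesis by blast
    qed
    obtain B where B: "B > 0" "\<And>u. u \<in> ?I \<Longrightarrow> norm u < B"
      using bounded_pos_less bdd by (metis)
    obtain e where e: "e > 0" "ball 0 e \<subseteq> outside ?I"
      using op out0 open_contains_ball by blast
    define v where "v = complex_of_real (min (e / 2) (1 / B))"
    have "min (e/2) (1/B) > 0" using e B by auto
    then have nv: "norm v = min (e/2) (1/B)" "norm v > 0" by (simp_all add: v_def)
    have v: "v \<noteq> 0" "v \<in> outside ?I" "norm (inverse v) \<ge> B"
    proof -
      show "v \<noteq> 0" using nv(2) by auto
      show "v \<in> outside ?I" using nv e by (intro subsetD[OF e(2)]) auto
      have "norm v \<le> 1 / B" "norm v > 0" using nv by linarith+
      then show "norm (inverse v) \<ge> B" using B by (simp add: norm_inverse inverse_eq_divide norm_divide pos_le_divide_eq mult.commute)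
    qed
    have "?I \<subseteq> ball 0 B" using B(2) by auto
    then have "- ball 0 B \<subseteq> outside ?I" by (intro outside_subset_convex) auto
    then have out_v: "inverse v \<in> outside ?I" using v(3) by auto
    \<comment> \<open>inversion preserves the connected punctured exterior, since it does so near infinity\<close>
    have sub: "inverse ` (outside ?I - {0}) \<subseteq> outside ?I"
    proof -
      have "open (inside ?I)" using path by (simp add: closed_path_image open_inside)
      moreover have "inverse ` (outside ?I - {0}) \<subseteq> inside ?I \<union> outside ?I"
        using disj by (auto simp: inside_Un_outside)
      ultimately have "inside ?I \<inter> inverse ` (outside ?I - {0}) = {} \<or>
          outside ?I \<inter> inverse ` (outside ?I - {0}) = {}"
        using op by (intro connectedD[OF coni]) (auto simp: inside_Int_outside)
      moreover have "inverse v \<in> inverse ` (outside ?I - {0})" using v by blast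
      ultimately show ?thesis
        using out_v \<open>_ \<subseteq> inside ?I \<union> outside ?I\<close> by blast
    qed
    have "inverse z \<in> outside ?I" using C z by (auto simp: symmetric_contour_def)
    then have "inverse (inverse z) \<in> outside ?I" using z(2) sub by (metis DiffI image_eqI inverse_zero_imp_zero singletonD subsetD)
    then show False using z(1) by (metis IntI empty_iff inside_Int_outside inverse_inverse_eq)
  qed
  then show ?thesis using C by (auto simp: symmetric_contour_def)
qed

section \<open>Theta functions\<close>

definition theta :: "complex \<Rightarrow> complex \<Rightarrow> complex" where
  "theta r u = qpoch_inf u r * qpoch_inf (r / u) r"

lemma holomorphic_remove_zero:
  assumes "f holomorphic_on S" "open S" "a \<in> S" "f a = 0"
  obtains g where "g holomorphic_on S" "\<And>x. x \<in> S \<Longrightarrow> f x = (x - a) * g x"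
proof
  show "(\<lambda>z. if z = a then deriv f a else f z / (z - a)) holomorphic_on S"
    using pole_theorem_open[OF assms(1,2), of a] assms(4)
    by (simp add: if_distrib cong: if_cong)
qed (use assms in auto)

context
  fixes r :: complex
  assumes r: "norm r < 1"
begin

interpretation B: elliptic_bases r r
  by standard (use r in auto)

lemma theta_holomorphic [holomorphic_intros]:
  assumes "f holomorphic_on A" "\<And>z. z \<in> A \<Longrightarrow> f z \<noteq> 0"
  shows "(\<lambda>z. theta r (f z)) holomorphic_on A"
  unfolding theta_def using assms by (intro holomorphic_intros B.poch_p_holomorphic) auto

lemma theta_inverse:
  assumes "u \<noteq> 0"
  shows "theta r (1 / u) = - theta r u / u"
proof -
  have 1: "theta r (1 / u) = (1 - 1 / u) * qpoch_inf (r / u) r * qpoch_inf (r * u) r"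
    unfolding theta_def by (subst B.poch_p_split[of "1 / u"]) simp
  have 2: "theta r u = (1 - u) * qpoch_inf (r * u) r * qpoch_inf (r / u) r"
    unfolding theta_def by (subst B.poch_p_split[of u]) simp
  show ?thesis unfolding 1 2 using assms by (simp add: field_simps)
qed

lemma theta_mult_base: "u \<noteq> 0 \<Longrightarrow> r \<noteq> 0 \<Longrightarrow> theta r (r * u) = - theta r u / u"
  using theta_inverse[of u] by (simp add: theta_def mult_ac)

lemma theta_nonzero:
  assumes "norm r < norm u" "norm r * norm u < 1" "u \<noteq> 1"
  shows "theta r u \<noteq> 0"
proof -
  have "norm (r / u) < 1" using assms by (auto simp: norm_divide divide_less_eq)
  moreover have "norm (r * u) < 1" using assms by (simp add: norm_mult)
  ultimately show ?thesis
    using assms B.poch_p_split[of u] by (simp add: theta_def B.poch_nonzero)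
qed

lemma theta_pair_mult_base:
  assumes "r \<noteq> 0" "a \<noteq> 0" "x \<noteq> 0"
  shows "theta r (a * (r * x)) * theta r (a / (r * x)) = theta r (a * x) * theta r (a / x) / (r * x\<^sup>2)"
proof -
  have 1: "theta r (a * (r * x)) = - theta r (a * x) / (a * x)"
    using theta_mult_base[of "a * x"] assms by (simp add: mult_ac)
  have "theta r (a / x) = - theta r (a / (r * x)) / (a / (r * x))"
    using theta_mult_base[of "a / (r * x)"] assms by simp
  then have 2: "theta r (a / (r * x)) = - (a / (r * x)) * theta r (a / x)"
    using assms by simp
  show ?thesis unfolding 1 2 using assms by (simp add: field_simps power2_eq_square)
qed

text \<open>The zeros of \<open>N\<close> at \<open>z\<close> and \<open>1 / z\<close> cancel those of the theta product in the annulus \<open>U\<close>, and both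
  functions have the same multiplier under \<open>x \<mapsto> r x\<close>. So their quotient extends to a holomorphic
  function on \<open>U\<close> that is invariant under this map. Since \<open>U\<close> contains a compact fundamental
  annulus, the modulus of the quotient attains its maximum, and the quotient is constant.\<close>

lemma theta_degree_two_unique:
  assumes r0: "r \<noteq> 0" and z: "1 < norm z" "norm r * norm z ^ 2 < 1"
    and N: "N holomorphic_on -{0}" "N z = 0" "N (1 / z) = 0"
    and quasi: "\<And>x. x \<noteq> 0 \<Longrightarrow> N (r * x) = N x / (r * x\<^sup>2)"
  defines "U \<equiv> open_annulus (norm r * norm z) (1 / (norm r * norm z))"
  obtains c where "\<And>x. x \<in> U \<Longrightarrow> N x = c * (theta r (z * x) * theta r (z / x))"
proof -
  have z0: "z \<noteq> 0" using z(1) by auto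
  have zz: "z \<noteq> 1 / z"
  proof
    assume "z = 1 / z"
    then have "z * z = 1" using z0 by (simp add: field_simps)
    then have "norm z * norm z = 1" by (metis norm_mult norm_one)
    then show False using less_1_mult[OF z(1) z(1)] by simp
  qed
  define D where "D x = theta r (z * x) * theta r (z / x)" for x
  obtain N1 where N1: "N1 holomorphic_on -{0}" "\<And>x. x \<in> -{0} \<Longrightarrow> N x = (x - z) * N1 x"
    using holomorphic_remove_zero[OF N(1) _ _ N(2)] z0 by auto
  have "N1 (1 / z) = 0" using N(3) N1(2)[of "1 / z"] z0 zz by auto
  then obtain N2 where N2: "N2 holomorphic_on -{0}" "\<And>x. x \<in> -{0} \<Longrightarrow> N1 x = (x - 1 / z) * N2 x"
    using holomorphic_remove_zero[OF N1(1), of "1 / z"] z0 by auto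
  define E where "E x = qpoch_inf (r * (z * x)) r * qpoch_inf (r / (z * x)) r *
      (qpoch_inf (r * (z / x)) r * qpoch_inf (r / (z / x)) r)" for x
  have U0: "x \<noteq> 0" if "x \<in> U" for x
    using that mult_nonneg_nonneg[of "norm r" "norm z"]
    by (auto simp: U_def open_annulus_def simp del: mult_nonneg_nonneg zero_le_mult_iff)
  have le: "norm r \<le> norm r * norm z ^ 2"
    using z(1) by (intro mult_left_mono[of 1 _ "norm r", simplified mult_1_right]) (auto simp: one_le_power)
  have E_nz: "E x \<noteq> 0" if x: "x \<in> U" for x
  proof -
    have nx: "norm r * norm z < norm x" "norm x * (norm r * norm z) < 1"
      using x r0 z0 by (auto simp: U_def open_annulus_def field_simps)
    have "norm (r * (z * x)) < 1" using nx by (simp add: norm_mult mult_ac)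
    moreover have "norm (r * (z / x)) < 1" using nx U0[OF x] by (simp add: norm_mult norm_divide field_simps)
    moreover have "norm (r / (z * x)) < 1"
    proof -
      note le
      also have "norm r * norm z ^ 2 < norm z * norm x"
        using mult_strict_left_mono[OF nx(1), of "norm z"] z0 by (simp add: power2_eq_square mult_ac)
      finally show ?thesis using U0[OF x] z0 by (simp add: norm_mult norm_divide field_simps)
    qed
    moreover have "norm (r / (z / x)) < 1"
    proof -
      have "norm x * norm r * 1 \<le> norm x * norm r * norm z" using z by (intro mult_left_mono) auto
      then have "norm r * norm x \<le> norm x * (norm r * norm z)" by (simp add: mult_ac)
      also have "\<dots> < norm z" using nx(2) z(1) by linarith
      finally show ?thesis using U0[OF x] z0 by (simp add: norm_mult norm_divide field_simps)
    qed
    ultimately show ?thesis by (simp add: E_def B.poch_nonzero)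
  qed
  have D_eq: "D x = (1 - z * x) * (1 - z / x) * E x" if "x \<in> U" for x
    using B.poch_p_split[of "z * x"] B.poch_p_split[of "z / x"] by (simp add: D_def E_def theta_def)
  \<comment> \<open>the quotient of \<open>N\<close> by the theta product, with the common zeros cancelled\<close>
  define \<phi> where "\<phi> x = - x / z * N2 x / E x" for x
  have N_eq: "N x = \<phi> x * D x" if x: "x \<in> U" for x
  proof -
    have n: "N x = (x - z) * ((x - 1 / z) * N2 x)" using N1(2)[of x] N2(2)[of x] U0[OF x] by simp
    show ?thesis unfolding n \<phi>_def D_eq[OF x]
      using U0[OF x] z0 E_nz[OF x] by (simp add: field_simps)
  qed
  have hol: "\<phi> holomorphic_on U"
    unfolding \<phi>_def E_def using E_nz z0 U0
    by (intro holomorphic_intros B.poch_p_holomorphic holomorphic_on_subset[OF N2(1)]) (auto simp: E_def)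
  define \<rho> where "\<rho> = sqrt (norm r)"
  have \<rho>: "\<rho> > 0" "\<rho> * \<rho> = norm r" "\<rho> < 1" using r0 r by (auto simp: \<rho>_def)
  have z\<rho>: "\<rho> * norm z < 1"
  proof (rule power_less_imp_less_base[of _ 2])
    have "(\<rho> * norm z) ^ 2 = (\<rho> * \<rho>) * norm z ^ 2" by (simp add: power2_eq_square mult_ac)
    then show "(\<rho> * norm z) ^ 2 < 1 ^ 2" using z(2) \<rho>(2) by simp
  qed simp
  \<comment> \<open>the fundamental annulus for \<open>x \<mapsto> r x\<close> that is symmetric under inversion\<close>
  define K where "K = {x::complex. \<rho> \<le> norm x \<and> norm x \<le> 1 / \<rho>}"
  have KU: "K \<subseteq> U"
  proof
    fix x assume "x \<in> K"
    then have x: "\<rho> \<le> norm x" "norm x \<le> 1 / \<rho>" by (auto simp: K_def)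
    have lt: "norm r * norm z < \<rho>" using z\<rho> \<rho> mult_strict_left_mono[OF z\<rho>, of \<rho>] by (simp add: mult.assoc[symmetric])
    moreover have "1 / \<rho> < 1 / (norm r * norm z)"
      using lt r0 z0 \<rho> by (intro divide_strict_left_mono) auto
    ultimately show "x \<in> U" using x by (auto simp: U_def open_annulus_def)
  qed
  have periodic: "\<phi> (r * x) = \<phi> x" if x: "x \<in> U" "r * x \<in> U" "norm z < norm x" for x
  proof -
    have "1 * 1 < norm z * norm x" using z x(3) by (intro mult_strict_mono) auto
    then have "x \<noteq> z" "z * x \<noteq> 1" using x(3) by (auto simp flip: norm_mult)
    then have Dx: "D x \<noteq> 0" unfolding D_eq[OF x(1)]
      using E_nz[OF x(1)] U0[OF x(1)] by simp
    have Drx: "D (r * x) = D x / (r * x\<^sup>2)"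
      unfolding D_def using theta_pair_mult_base[OF r0 z0(1) U0[OF x(1)]] by simp
    have "\<phi> (r * x) * D (r * x) = \<phi> x * D x / (r * x\<^sup>2)"
      using quasi[OF U0[OF x(1)]] N_eq[OF x(1)] N_eq[OF x(2)] by simp
    then show ?thesis using Dx r0 U0[OF x(1)] by (simp add: Drx)
  qed
  have "compact K"
  proof -
    have "closed K" unfolding K_def by (intro closed_Collect_conj closed_Collect_le continuous_intros)
    moreover have "bounded K" by (rule bounded_subset[of "cball 0 (1 / \<rho>)"]) (auto simp: K_def)
    ultimately show ?thesis by (simp add: compact_eq_bounded_closed)
  qed
  moreover have "1 \<in> K" using \<rho> by (auto simp: K_def field_simps)
  moreover have "continuous_on K (\<lambda>x. norm (\<phi> x))"
    using holomorphic_on_imp_continuous_on[OF holomorphic_on_subset[OF hol KU]] by (intro continuous_intros)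
  ultimately obtain \<xi> where \<xi>: "\<xi> \<in> K" "\<And>x. x \<in> K \<Longrightarrow> norm (\<phi> x) \<le> norm (\<phi> \<xi>)"
    using continuous_attains_sup[of K "\<lambda>x. norm (\<phi> x)"] by blast
  have max: "norm (\<phi> x) \<le> norm (\<phi> \<xi>)" if x: "x \<in> U" for x
  proof -
    have nx: "norm r * norm z < norm x" "norm x * (norm r * norm z) < 1"
      using x r0 z0 by (auto simp: U_def open_annulus_def field_simps)
    consider "x \<in> K" | "norm x < \<rho>" | "norm x > 1 / \<rho>" by (force simp: K_def)
    then show ?thesis
    proof cases
      case 3
      have "norm z < 1 / \<rho>" using z\<rho> \<rho> by (simp add: field_simps)
      then have zx: "norm z < norm x" using 3 by simp
      have "r * x \<in> K"
      proof -
        have "\<rho> * \<rho> * (1 / \<rho>) \<le> norm r * norm x" using 3 \<rho> by (intro mult_mono) auto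
        moreover have "\<rho> * \<rho> * (1 / \<rho>) = \<rho>" using \<rho>(1) by simp
        moreover have "norm x * norm r * 1 \<le> norm x * norm r * norm z" using z by (intro mult_left_mono) auto
        then have "norm r * norm x < 1" using nx(2) by (simp add: mult_ac)
        moreover have "1 < 1 / \<rho>" using \<rho> by simp
        ultimately have "\<rho> \<le> norm (r * x)" "norm (r * x) \<le> 1 / \<rho>" unfolding norm_mult by linarith+
        then show ?thesis by (simp add: K_def)
      qed
      then show ?thesis using periodic[OF x _ zx] KU \<xi>(2) by (metis subsetD)
    next
      case 2
      define y where "y = x / r"
      have xy: "x = r * y" using r0 by (simp add: y_def)
      have zy: "norm z < norm y" using nx(1) r0 unfolding xy norm_mult by simp
      have "\<rho> * (\<rho> * norm y) < \<rho> * 1" using 2 \<rho> unfolding xy norm_mult by (simp add: mult.assoc[symmetric])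
      then have "\<rho> * norm y < 1" using \<rho> by simp
      then have "norm y \<le> 1 / \<rho>" using \<rho> by (simp add: field_simps)
      then have yK: "y \<in> K" using zy z \<rho> by (auto simp: K_def)
      have "\<phi> x = \<phi> y" using periodic[of y] yK KU x zy unfolding xy by auto
      then show ?thesis using yK \<xi> by simp
    qed (use \<xi> in auto)
  qed
  have "\<phi> constant_on U"
  proof (rule maximum_modulus_principle[OF hol])
    show "\<xi> \<in> U" using \<xi> KU by auto
  qed (use max in \<open>auto simp: U_def\<close>)
  then obtain c where "\<And>x. x \<in> U \<Longrightarrow> \<phi> x = c" by (auto simp: constant_on_def)
  then show ?thesis using that[of c] N_eq by (simp add: D_def)
qed

end

lemma theta_base_0: "theta 0 u = 1 - u"
proof -
  interpret elliptic_bases 0 0 by standard auto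
  have "qpoch_inf 0 0 = 1" by (simp add: qpoch_inf_eq_geo_prod P.geo_prod_at_zero)
  then show ?thesis using poch_p_split[of u] by (simp add: theta_def)
qed

lemma theta_1: "norm r < 1 \<Longrightarrow> theta r 1 = 0"
  using theta_inverse[of r 1] by simp

text \<open>Weierstrass's addition formula. As a function of \<open>x\<close> the left-hand side has degree two, and it
  vanishes at \<open>x = z\<close> and \<open>x = 1 / z\<close>; so it is a multiple of the theta product on the right, and
  setting \<open>x = A\<close> gives the factor. For \<open>r = 0\<close> the identity is elementary,
  as \<open>theta 0 u = 1 - u\<close>.\<close>

lemma theta_weierstrass:
  assumes r: "norm r < 1" and z: "1 < norm z" "norm r * norm z ^ 2 < 1"
    and nz: "A \<noteq> 0" "B \<noteq> 0" "x \<noteq> 0"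
    and A: "norm r * norm z < norm A" "norm A * (norm r * norm z) < 1"
    and x: "norm r * norm z < norm x" "norm x * (norm r * norm z) < 1"
    and zA: "theta r (z * A) \<noteq> 0" "theta r (z / A) \<noteq> 0"
  shows "theta r (B * z) * theta r (B / z) * (theta r (A * x) * theta r (A / x)) -
      theta r (A * z) * theta r (A / z) * (theta r (B * x) * theta r (B / x)) =
      A / z * (theta r (A * B) * theta r (B / A)) * (theta r (z * x) * theta r (z / x))"
proof (cases "r = 0")
  case True
  have "z \<noteq> 0" using z by auto
  then show ?thesis unfolding True theta_base_0 using nz by (simp add: field_simps)
next
  case False
  have z0: "z \<noteq> 0" using z by auto
  define N where "N x = theta r (B * z) * theta r (B / z) * (theta r (A * x) * theta r (A / x)) -
      theta r (A * z) * theta r (A / z) * (theta r (B * x) * theta r (B / x))" for x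
  have hol: "N holomorphic_on -{0}"
    unfolding N_def
    by (intro holomorphic_on_diff holomorphic_on_mult holomorphic_on_const theta_holomorphic[OF r]
         holomorphic_on_divide holomorphic_on_ident) (use nz in auto)
  have zeros: "N z = 0" "N (1 / z) = 0" by (simp_all add: N_def mult_ac)
  have quasi: "N (r * x) = N x / (r * x\<^sup>2)" if "x \<noteq> 0" for x
    unfolding N_def theta_pair_mult_base[OF r False nz(1) that] theta_pair_mult_base[OF r False nz(2) that]
    by (simp add: diff_divide_distrib)
  obtain c where c: "\<And>x. x \<in> open_annulus (norm r * norm z) (1 / (norm r * norm z)) \<Longrightarrow>
      N x = c * (theta r (z * x) * theta r (z / x))"
    using theta_degree_two_unique[OF r False z hol zeros quasi] by blast
  have rz: "norm r * norm z > 0" using False z0 by simp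
  have "A \<in> open_annulus (norm r * norm z) (1 / (norm r * norm z))"
    using A rz by (simp add: open_annulus_def pos_less_divide_eq)
  then have "N A = c * (theta r (z * A) * theta r (z / A))" by (rule c)
  moreover have "theta r (A / z) = - (A / z) * theta r (z / A)"
    using theta_inverse[OF r, of "z / A"] z0 nz by simp
  then have "N A = A / z * (theta r (A * B) * theta r (B / A)) * (theta r (z * A) * theta r (z / A))"
    using theta_1[OF r] nz by (simp add: N_def mult_ac)
  ultimately have "c * (theta r (z * A) * theta r (z / A)) =
      A / z * (theta r (A * B) * theta r (B / A)) * (theta r (z * A) * theta r (z / A))"
    by simp
  then have "c = A / z * (theta r (A * B) * theta r (B / A))"
    using zA by (subst (asm) mult_right_cancel) auto
  moreover have "x \<in> open_annulus (norm r * norm z) (1 / (norm r * norm z))"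
    using x rz by (simp add: open_annulus_def pos_less_divide_eq)
  ultimately show ?thesis using c[of x] by (simp add: N_def)
qed

text \<open>The addition formula at \<open>A = t w\<close> and \<open>B = t / w\<close>, written in terms of the four parameters
  \<open>t x\<close>, \<open>t / x\<close>, \<open>z / t\<close>, \<open>1 / (t z)\<close> of product \<open>1\<close>. It decomposes the integrand of the beta
  integral below.\<close>

lemma theta_four_parameters:
  assumes r: "norm r < 1" and z: "1 < norm z" "norm r * norm z ^ 2 < 1" and w: "norm w = 1"
    and t: "norm r * norm z < norm t" "norm t < 1" "norm z * norm t < 1"
    and x: "norm t < norm x" "norm x * norm t < 1"
  shows "theta r (t * x * w) * theta r (t / x * w) * theta r (z / t * w) * theta r (1 / (t * z) * w) / w\<^sup>2 -
      theta r (t * x / w) * theta r (t / x / w) * theta r (z / t / w) * theta r (1 / (t * z) / w) * w\<^sup>2 =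
      - (theta r (t\<^sup>2) * theta r (z * x) * theta r (z / x)) / (t * z) * (theta r (w\<^sup>2) / w)"
proof -
  have rz0: "norm r * norm z \<ge> 0" by simp
  have nz: "t \<noteq> 0" "z \<noteq> 0" "x \<noteq> 0" "w \<noteq> 0" using t z x w rz0 by (auto simp del: mult_nonneg_nonneg)
  define A B where "A = t * w" and "B = t / w"
  have AB: "A \<noteq> 0" "B \<noteq> 0" "norm A = norm t" using nz w by (auto simp: A_def B_def norm_mult)
  have rz1: "norm r * norm z < 1" using t by linarith
  have zA: "norm z * norm A > norm r" "norm z / norm A > norm r" "norm r * (norm z * norm A) < 1"
      "norm r * (norm z / norm A) < 1" "norm z * norm A \<noteq> 1" "norm z / norm A \<noteq> 1"
  proof -
    have "norm r * 1 \<le> norm r * norm z" using z by (intro mult_left_mono) auto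
    moreover have "norm t * 1 \<le> norm t * norm z" using z by (intro mult_left_mono) auto
    ultimately show "norm z * norm A > norm r" using t AB by (simp add: mult.commute)
    have tz: "norm t < norm z" using t z by linarith
    then have gt1: "1 < norm z / norm A" using AB nz by simp
    then show "norm z / norm A > norm r" "norm z / norm A \<noteq> 1" using r by linarith+
    show "norm z * norm A \<noteq> 1" using t AB by simp
    have "norm r * (norm z * norm A) \<le> 1 * (norm z * norm A)" using r by (intro mult_right_mono) auto
    then show "norm r * (norm z * norm A) < 1" using t AB by simp
    show "norm r * (norm z / norm A) < 1" using t AB nz by simp
  qed
  have ne1: "z * A \<noteq> 1" "z / A \<noteq> 1"
    using zA(5,6) by (auto simp flip: norm_mult norm_divide)
  have tzA1: "theta r (z * A) \<noteq> 0"
    by (rule theta_nonzero[OF r]) (use zA ne1 in \<open>simp_all add: norm_mult\<close>)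
  have tzA2: "theta r (z / A) \<noteq> 0"
    by (rule theta_nonzero[OF r]) (use zA ne1 in \<open>simp_all add: norm_divide\<close>)
  have A2: "norm A * (norm r * norm z) < 1"
  proof -
    have "norm A * (norm r * norm z) \<le> 1 * (norm r * norm z)" using t AB by (intro mult_right_mono) auto
    then show ?thesis using rz1 by simp
  qed
  have x2: "norm x * (norm r * norm z) < 1"
  proof -
    have "norm x * (norm r * norm z) \<le> norm x * norm t" using t by (intro mult_left_mono) auto
    then show ?thesis using x by simp
  qed
  have W: "theta r (B * z) * theta r (B / z) * (theta r (A * x) * theta r (A / x)) -
      theta r (A * z) * theta r (A / z) * (theta r (B * x) * theta r (B / x)) =
      A / z * (theta r (A * B) * theta r (B / A)) * (theta r (z * x) * theta r (z / x))"
    using t x AB by (intro theta_weierstrass[OF r z AB(1,2) nz(3) _ A2 _ x2 tzA1 tzA2]) auto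
  have inv: "theta r (z / B) = - (z / B) * theta r (B / z)" "theta r (1 / (B * z)) = - theta r (B * z) / (B * z)"
     "theta r (z / A) = - (z / A) * theta r (A / z)" "theta r (1 / (A * z)) = - theta r (A * z) / (A * z)"
    using theta_inverse[OF r, of "B / z"] theta_inverse[OF r, of "B * z"]
      theta_inverse[OF r, of "A / z"] theta_inverse[OF r, of "A * z"] AB nz by simp_all
  have args: "z / t * w = z / B" "1 / (t * z) * w = 1 / (B * z)" "z / t / w = z / A" "1 / (t * z) / w = 1 / (A * z)"
      "t * x * w = A * x" "t / x * w = A / x" "t * x / w = B * x" "t / x / w = B / x"
    using nz by (auto simp: A_def B_def field_simps)
  have AB2: "A * B = t\<^sup>2" "B / A = 1 / w\<^sup>2"
    using nz by (auto simp: A_def B_def power2_eq_square field_simps)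
  have w2: "theta r (1 / w\<^sup>2) = - theta r (w\<^sup>2) / w\<^sup>2"
    using theta_inverse[OF r, of "w\<^sup>2"] nz by simp
  have "theta r (A * x) * theta r (A / x) * theta r (z / B) * theta r (1 / (B * z)) / w\<^sup>2 -
      theta r (B * x) * theta r (B / x) * theta r (z / A) * theta r (1 / (A * z)) * w\<^sup>2 =
      1 / t\<^sup>2 * (theta r (B * z) * theta r (B / z) * (theta r (A * x) * theta r (A / x)) -
      theta r (A * z) * theta r (A / z) * (theta r (B * x) * theta r (B / x)))"
    unfolding inv using nz by (simp add: A_def B_def field_simps power2_eq_square)
  also have "\<dots> = - (theta r (t\<^sup>2) * theta r (z * x) * theta r (z / x)) / (t * z) * (theta r (w\<^sup>2) / w)"
    unfolding W AB2 w2 using nz by (simp add: A_def field_simps power2_eq_square)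
  finally show ?thesis unfolding args .
qed

section \<open>The elliptic gamma function near the unit circle\<close>

text \<open>This is \<open>(1 - u) \<Gamma>(u)\<close>, holomorphic across the simple pole of \<open>\<Gamma>\<close> at \<open>u = 1\<close>.\<close>

definition egamma_reg :: "complex \<Rightarrow> complex \<Rightarrow> complex \<Rightarrow> complex" where
  "egamma_reg p q u = dpoch p q (p * q / u) / (qpoch_inf (p * u) p * dpoch p q (q * u))"

text \<open>This is \<open>\<Gamma>(q u)\<close>, in a form that has the right meaning (namely \<open>theta p u * \<Gamma>(u)\<close>) for \<open>q = 0\<close> as
  well.\<close>

definition egamma_shift :: "complex \<Rightarrow> complex \<Rightarrow> complex \<Rightarrow> complex" where
  "egamma_shift p q u = dpoch p q (p / u) / dpoch p q (q * u)"

context elliptic_bases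
begin

abbreviation G :: "complex \<Rightarrow> complex" where "G \<equiv> egamma p q"
abbreviation Greg :: "complex \<Rightarrow> complex" where "Greg \<equiv> egamma_reg p q"
abbreviation Gs :: "complex \<Rightarrow> complex" where "Gs \<equiv> egamma_shift p q"

lemma F_factor: "F u = (1 - u) * (poch_p (p * u) * F (q * u))"
  using F_split_p[of u] poch_p_split[of u] by simp

lemma reg_factor_nonzero:
  assumes "norm p * norm u < 1" "norm q * norm u < 1"
  shows "poch_p (p * u) \<noteq> 0" "F (q * u) \<noteq> 0"
  using assms by (auto simp: norm_mult intro!: poch_nonzero F_nonzero)

lemma F_nonzero':
  assumes "norm p * norm u < 1" "norm q * norm u < 1" "u \<noteq> 1"
  shows "F u \<noteq> 0"
  using F_factor[of u] reg_factor_nonzero[OF assms(1,2)] assms(3) by simp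

lemma F_reflected_nonzero: "norm p * norm q < norm u \<Longrightarrow> F (p * q / u) \<noteq> 0"
  by (intro F_nonzero) (auto simp: norm_divide norm_mult divide_less_eq)

lemma egamma_eq_reg: "G u = Greg u / (1 - u)"
  unfolding egamma_eq egamma_reg_def F_factor[of u] by simp

lemma egamma_nonzero:
  assumes "norm p * norm q < norm u" "norm p * norm u < 1" "norm q * norm u < 1" "u \<noteq> 1"
  shows "G u \<noteq> 0"
  using assms by (simp add: egamma_eq F_nonzero' F_reflected_nonzero)

lemma egamma_reg_nonzero:
  assumes "norm p * norm q < norm u" "norm p * norm u < 1" "norm q * norm u < 1"
  shows "Greg u \<noteq> 0"
  using assms by (simp add: egamma_reg_def reg_factor_nonzero F_reflected_nonzero)

lemma norm_pq: "norm p * norm q < 1"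
  using norm_p norm_q mult_left_mono[of "norm q" 1 "norm p"] by simp

lemma egamma_reg_1: "Greg 1 = 1 / (poch_p p * poch_q q)"
proof -
  have "F (p * q) \<noteq> 0" using norm_pq by (intro F_nonzero) (simp add: norm_mult)
  then show ?thesis using F_split_q[of q] by (simp add: egamma_reg_def)
qed

lemma egamma_shift_eq_theta:
  assumes "F u \<noteq> 0"
  shows "Gs u = theta p u * G u"
proof (cases "u = 0")
  case False
  have "poch_p u \<noteq> 0" using assms F_split_p[of u] by auto
  moreover have "F (p / u) = poch_p (p / u) * F (p * q / u)"
    using F_split_p[of "p / u"] by (simp add: mult_ac)
  ultimately show ?thesis
    unfolding egamma_shift_def egamma_eq theta_def F_split_p[of u] by simp
qed (auto simp: egamma_shift_def egamma_eq theta_def dpoch_def D.geo_prod_at_zero qpoch_inf_eq_geo_prod P.geo_prod_at_zero)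

lemma egamma_shift_eq: "q \<noteq> 0 \<Longrightarrow> Gs u = G (q * u)"
  by (simp add: egamma_shift_def egamma_eq)

lemma egamma_shift_div: "q \<noteq> 0 \<Longrightarrow> Gs (u / q) = G u"
  by (simp add: egamma_shift_def egamma_eq mult_ac)

text \<open>The weight factors of the integrand are holomorphic away from \<open>0\<close>: they are products of two theta
  functions, one for each base.\<close>

lemma egamma_pair:
  assumes "u \<noteq> 0" "norm p * norm q * norm u < 1" "norm p * norm q < norm u"
  shows "inverse (G u * G (1 / u)) = theta p u * theta q (1 / u)"
proof -
  have "F u = poch_p u * (poch_q (q * u) * F (p * q * u))"
    using F_split_p[of u] F_split_q[of "q * u"] by (simp add: mult_ac)
  moreover have "F (1 / u) = poch_q (1 / u) * (poch_p (p / u) * F (p * q / u))"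
    using F_split_q[of "1 / u"] F_split_p[of "p / u"] by (simp add: mult_ac)
  moreover have "F (p * q * u) \<noteq> 0" using assms by (intro F_nonzero) (simp add: norm_mult)
  ultimately show ?thesis
    using assms(1) F_reflected_nonzero[OF assms(3)] by (simp add: egamma_eq theta_def divide_simps)
qed

lemma egamma_holomorphic:
  assumes "f holomorphic_on A" "\<And>z. z \<in> A \<Longrightarrow> f z \<noteq> 0" "\<And>z. z \<in> A \<Longrightarrow> F (f z) \<noteq> 0"
  shows "(\<lambda>z. G (f z)) holomorphic_on A"
  unfolding egamma_eq using assms by (intro holomorphic_intros) auto

lemma egamma_reg_holomorphic:
  assumes "f holomorphic_on A" "\<And>z. z \<in> A \<Longrightarrow> f z \<noteq> 0"
    "\<And>z. z \<in> A \<Longrightarrow> norm p * norm (f z) < 1" "\<And>z. z \<in> A \<Longrightarrow> norm q * norm (f z) < 1"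
  shows "(\<lambda>z. Greg (f z)) holomorphic_on A"
  unfolding egamma_reg_def using assms
  by (intro holomorphic_intros) (auto simp: reg_factor_nonzero)

lemma inverse_egamma_holomorphic:
  assumes "f holomorphic_on A" "\<And>z. z \<in> A \<Longrightarrow> f z \<noteq> 0" "\<And>z. z \<in> A \<Longrightarrow> norm p * norm q < norm (f z)"
  shows "(\<lambda>z. inverse (G (f z))) holomorphic_on A"
  unfolding egamma_eq inverse_divide using assms
  by (intro holomorphic_intros) (auto simp: F_reflected_nonzero)

lemma egamma_shift_holomorphic:
  assumes "f holomorphic_on A" "\<And>z. z \<in> A \<Longrightarrow> f z \<noteq> 0" "\<And>z. z \<in> A \<Longrightarrow> norm q * norm (f z) < 1"
  shows "(\<lambda>z. Gs (f z)) holomorphic_on A"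
  unfolding egamma_shift_def using assms
  by (intro holomorphic_intros) (auto simp: norm_mult intro!: F_nonzero)

end

section \<open>A degenerate elliptic beta integral\<close>

lemma exists_radius_gt_1:
  assumes "(K::real) < 1"
  obtains r where "r > 1" "K * r < 1"
proof (cases "K \<le> 0")
  case True
  then show ?thesis using that[of 2] by simp
next
  case False
  have "K * (2 / (1 + K)) < 1" using assms False by (simp add: field_simps)
  moreover have "2 / (1 + K) > 1" using assms False by (simp add: field_simps)
  ultimately show ?thesis using that by blast
qed

context elliptic_bases
begin

definition beta_integrand :: "complex \<Rightarrow> complex \<Rightarrow> complex \<Rightarrow> complex \<Rightarrow> complex \<Rightarrow> complex" where
  "beta_integrand a b c d w =
     G (a * w) * G (b * w) * G (c * w) * G (d * w) *
     (G (a / w) * G (b / w) * G (c / w) * G (d / w)) * inverse (G (w\<^sup>2) * G (1 / w\<^sup>2))"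

text \<open>Call this function \<open>g\<close>. Up to a constant factor \<open>C\<close>, the integrand is \<open>g(w) + g(1 / w)\<close> when
  \<open>a b c d = 1\<close>, and \<open>g(q / w) = - g(w)\<close>; hence for \<open>q \<noteq> 0\<close> the integrand is the difference
  \<open>(g(w) - g(q w)) / C\<close>, which is why its integral reduces to residues.\<close>

definition beta_primitive :: "complex \<Rightarrow> complex \<Rightarrow> complex \<Rightarrow> complex \<Rightarrow> complex \<Rightarrow> complex" where
  "beta_primitive a b c d w =
     - (w ^ 3) * theta q (1 / w\<^sup>2) * (G (a * w) * G (b * w) * G (c * w) * G (d * w)) *
     (Gs (a / w) * Gs (b / w) * Gs (c / w) * Gs (d / w))"

lemma beta_primitive_commute: "beta_primitive a b c d w = beta_primitive a b d c w"
  by (simp add: beta_primitive_def mult_ac)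

lemma beta_primitive_reflect:
  assumes "q \<noteq> 0" "w \<noteq> 0"
  shows "beta_primitive a b c d (q / w) = - beta_primitive a b c d w"
proof -
  define u where "u = w\<^sup>2"
  have u: "u \<noteq> 0" using assms by (simp add: u_def)
  have t1: "theta q (u / q) = - (u / q) * theta q u"
    using theta_mult_base[OF norm_q, of "u / q"] assms u by (simp add: field_simps)
  have t2: "theta q (u / q\<^sup>2) = - (u / q\<^sup>2) * theta q (u / q)"
    using theta_mult_base[OF norm_q, of "u / q\<^sup>2"] assms u by (simp add: power2_eq_square)
  have t3: "theta q (1 / u) = - theta q u / u"
    using theta_inverse[OF norm_q u] .
  have G1: "G (e * (q / w)) = Gs (e / w)" for e
    using egamma_shift_eq[of "e / w"] assms by (simp add: mult_ac)
  have G2: "Gs (e / (q / w)) = G (e * w)" for e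
    using egamma_shift_div[of "e * w"] assms by simp
  have sq: "1 / (q / w)\<^sup>2 = u / q\<^sup>2" by (simp add: u_def power_divide)
  have w3: "w ^ 3 = w * u" "(q / w) ^ 3 = q * q\<^sup>2 / (w * u)"
    using assms by (simp_all add: u_def power3_eq_cube power2_eq_square mult_ac)
  show ?thesis
    unfolding beta_primitive_def G1 G2 sq t2 t1 w3 u_def[symmetric] t3
    using assms u by (simp add: field_simps power2_eq_square) (simp add: u_def power2_eq_square)
qed

text \<open>For each parameter \<open>e\<close>, the summand \<open>g(w)\<close> contains the gamma factors of the integrand times
  \<open>theta p (e / w)\<close>, and \<open>g(1 / w)\<close> the same factors times \<open>theta p (e * w)\<close>. So the claim is the
  four-term identity multiplied by these gamma factors.\<close>

lemma beta_integrand_eq: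
  assumes w: "norm w = 1"
    and F: "\<And>e. e \<in> {a, b, c, d} \<Longrightarrow> F (e * w) \<noteq> 0 \<and> F (e / w) \<noteq> 0"
    and four_term: "theta p (a * w) * theta p (b * w) * theta p (c * w) * theta p (d * w) / w\<^sup>2 -
      theta p (a / w) * theta p (b / w) * theta p (c / w) * theta p (d / w) * w\<^sup>2 =
      C * (theta p (w\<^sup>2) / w)"
  shows "C * beta_integrand a b c d w = beta_primitive a b c d w + beta_primitive a b c d (1 / w)"
proof -
  have w0: "w \<noteq> 0" using w by auto
  have V: "inverse (G (w\<^sup>2) * G (1 / w\<^sup>2)) = theta p (w\<^sup>2) * theta q (1 / w\<^sup>2)"
    using w0 w norm_pq by (intro egamma_pair) (auto simp: norm_power)
  have tq: "theta q (w\<^sup>2) = - w\<^sup>2 * theta q (1 / w\<^sup>2)"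
    using theta_inverse[OF norm_q, of "w\<^sup>2"] w0 by simp
  have Gs: "Gs (e * w) = theta p (e * w) * G (e * w)" "Gs (e / w) = theta p (e / w) * G (e / w)"
    if "e \<in> {a, b, c, d}" for e
    using F[OF that] egamma_shift_eq_theta by auto
  define T where "T = theta q (1 / w\<^sup>2) *
     (G (a * w) * G (b * w) * G (c * w) * G (d * w) * (G (a / w) * G (b / w) * G (c / w) * G (d / w)))"
  have 1: "beta_primitive a b c d w =
      - w * T * (theta p (a / w) * theta p (b / w) * theta p (c / w) * theta p (d / w) * w\<^sup>2)"
    unfolding beta_primitive_def T_def by (simp add: Gs power3_eq_cube power2_eq_square mult_ac)
  have 2: "beta_primitive a b c d (1 / w) =
      w * T * (theta p (a * w) * theta p (b * w) * theta p (c * w) * theta p (d * w) / w\<^sup>2)"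
    unfolding beta_primitive_def T_def using w0
    by (simp add: Gs tq power_one_over) (simp add: field_simps power3_eq_cube power2_eq_square)
  have "beta_primitive a b c d w + beta_primitive a b c d (1 / w) = w * T * (C * (theta p (w\<^sup>2) / w))"
    unfolding 1 2 four_term[symmetric] by (simp add: algebra_simps)
  also have "\<dots> = C * beta_integrand a b c d w"
    unfolding beta_integrand_def V T_def using w0 by simp
  finally show ?thesis ..
qed

text \<open>The residue of \<open>beta_primitive a b c d w / w\<close> at \<open>w = 1 / d\<close>.\<close>

definition beta_residue :: "complex \<Rightarrow> complex \<Rightarrow> complex \<Rightarrow> complex \<Rightarrow> complex" where
  "beta_residue a b c d = theta q (d\<^sup>2) / d ^ 3 * (Greg 1 * G (a / d) * G (b / d) * G (c / d)) *
      (Gs (a * d) * Gs (b * d) * Gs (c * d) * Gs (d\<^sup>2))"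

text \<open>On the circle of radius \<open>sqrt (norm q)\<close> the substitution \<open>w \<mapsto> q / w\<close> maps the integral to its
  negative, so the integral vanishes there. Between this circle and the unit circle the only poles
  are \<open>1 / c\<close> and \<open>1 / d\<close>: the conditions on \<open>norm q * norm c ^ 2\<close> and \<open>norm q * norm d ^ 2\<close> say
  that these lie outside the small circle and that the poles \<open>q c\<close> and \<open>q d\<close> lie inside. For \<open>q = 0\<close>
  a small disc around \<open>0\<close>, on which the integrand is holomorphic, takes the place of the circle.\<close>

lemma beta_primitive_circle_integral:
  assumes nz: "a \<noteq> 0" "b \<noteq> 0"
    and ab: "norm a < 1" "norm b < 1" and cd: "1 < norm c" "1 < norm d" "norm c \<noteq> norm d"
    and pc: "norm p * norm c < 1" and pd: "norm p * norm d < 1"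
    and qc: "norm q * norm c ^ 2 < 1" and qd: "norm q * norm d ^ 2 < 1"
  shows "continuous_on (sphere 0 1) (beta_primitive a b c d)"
    and "contour_integral (circlepath 0 1) (\<lambda>w. beta_primitive a b c d w / w) =
    2 * pi * \<i> * (beta_residue a b d c + beta_residue a b c d)"
proof -
  let ?g = "beta_primitive a b c d"
  have le_sq: "norm q * norm e \<le> norm q * norm e ^ 2" if "1 < norm e" for e :: complex
    using that by (intro mult_left_mono) (auto simp: self_le_power)
  define K where "K = Max {norm a, norm b, norm p * norm c, norm p * norm d, norm q * norm c, norm q * norm d}"
  have "K < 1" using ab pc pd qc qd le_sq[OF cd(1)] le_sq[OF cd(2)] by (auto simp: K_def)
  then obtain r1 where r1: "1 < r1" "K * r1 < 1" by (rule exists_radius_gt_1)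
  have Kr: "k * norm w < 1" if "k \<le> K" "norm w < r1" "0 \<le> k" for k and w :: complex
  proof -
    have "k * norm w \<le> K * r1" using that r1 by (intro mult_mono) auto
    then show ?thesis using r1 by simp
  qed
  have leK: "norm a \<le> K" "norm b \<le> K" "norm p * norm c \<le> K" "norm p * norm d \<le> K"
      "norm q * norm c \<le> K" "norm q * norm d \<le> K"
    by (auto simp: K_def)
  define r0 where "r0 = norm q * max (norm c) (norm d)"
  have r0: "0 \<le> r0" "norm q * norm c \<le> r0" "norm q * norm d \<le> r0" "norm q * norm a \<le> r0" "norm q * norm b \<le> r0"
    using ab cd by (auto simp: r0_def intro!: mult_left_mono)
  define S where "S = open_annulus r0 r1"
  have S0: "w \<noteq> 0" if "w \<in> S" for w using that r0(1) by (auto simp: S_def open_annulus_def)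
  have Fab: "F (a * w) \<noteq> 0" "F (b * w) \<noteq> 0" if "norm w < r1" for w
    using Kr[OF leK(1) that] Kr[OF leK(2) that] by (auto intro!: F_nonzero simp: norm_mult)
  have Fcd: "norm p * norm (c * w) < 1" "norm q * norm (c * w) < 1"
     "norm p * norm (d * w) < 1" "norm q * norm (d * w) < 1" if "norm w < r1" for w
    using Kr[OF leK(3) that] Kr[OF leK(4) that] Kr[OF leK(5) that] Kr[OF leK(6) that]
    by (auto simp: norm_mult mult_ac)
  have Sle: "norm q * norm (e / w) < 1" if "w \<in> S" "norm q * norm e \<le> r0" for e w
    using that S0[OF that(1)] by (auto simp: S_def open_annulus_def norm_divide divide_less_eq)
  have cd0: "c \<noteq> 0" "d \<noteq> 0" "c \<noteq> d" using cd by auto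
  define Hs where "Hs w = Gs (a / w) * Gs (b / w) * Gs (c / w) * Gs (d / w)" for w
  define Pre where "Pre w = - (w\<^sup>2) * theta q (1 / w\<^sup>2)" for w
  define Gab where "Gab w = G (a * w) * G (b * w)" for w
  have Hs_hol: "Hs holomorphic_on S"
    unfolding Hs_def
    by (intro holomorphic_on_mult egamma_shift_holomorphic Sle holomorphic_on_divide holomorphic_on_const holomorphic_on_ident)
       (use nz cd0 S0 r0 in auto)
  have pre_hol: "Pre holomorphic_on S"
    unfolding Pre_def
    by (intro holomorphic_intros theta_holomorphic[OF norm_q]) (use S0 in auto)
  have Gab_hol: "Gab holomorphic_on S"
    unfolding Gab_def
    by (intro holomorphic_on_mult egamma_holomorphic holomorphic_on_const holomorphic_on_ident Fab)
       (use nz S0 in \<open>auto simp: S_def open_annulus_def\<close>)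
  have S_r1: "norm w < r1" if "w \<in> S" for w using that by (auto simp: S_def open_annulus_def)
  have Gc_hol: "(\<lambda>w. G (e * w)) holomorphic_on S - {1 / e}" if "e \<in> {c, d}" for e
  proof (intro egamma_holomorphic holomorphic_intros)
    fix w assume w: "w \<in> S - {1 / e}"
    then have "e * w \<noteq> 1" using that cd0 by (auto simp: field_simps)
    then show "F (e * w) \<noteq> 0" using w that Fcd[of w] S_r1[of w] by (intro F_nonzero') auto
  qed (use that cd0 S0 in auto)
  have Greg_hol: "(\<lambda>w. Greg (e * w)) holomorphic_on S" if "e \<in> {c, d}" for e
    by (intro egamma_reg_holomorphic holomorphic_intros) (use that cd0 S0 Fcd S_r1 in auto)
  have hol: "(\<lambda>w. ?g w / w) holomorphic_on S - {1 / c, 1 / d}"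
  proof -
    have "(\<lambda>w. Pre w * (Gab w * (G (c * w) * G (d * w))) * Hs w) holomorphic_on S - {1 / c, 1 / d}"
      by (intro holomorphic_on_mult holomorphic_on_subset[OF Hs_hol] holomorphic_on_subset[OF pre_hol]
        holomorphic_on_subset[OF Gab_hol] holomorphic_on_subset[OF Gc_hol[of c]] holomorphic_on_subset[OF Gc_hol[of d]]) auto
    then show ?thesis
      by (rule holomorphic_transform)
         (use S0 in \<open>auto simp: beta_primitive_def Pre_def Gab_def Hs_def power3_eq_cube power2_eq_square\<close>)
  qed
  have residue: "residue (\<lambda>w. beta_primitive a b e e' w / w) (1 / e') = beta_residue a b e e'"
    if e: "e \<in> {c, d}" "e' \<in> {c, d}" "e \<noteq> e'" "norm q * norm e' ^ 2 < 1" for e e'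
  proof -
    define h where "h w = Pre w * (Gab w * (G (e * w) * Greg (e' * w))) * Hs w * (- 1 / e')" for w
    have Hs_eq: "Hs w = Gs (a / w) * Gs (b / w) * Gs (e / w) * Gs (e' / w)" for w
      using e by (auto simp: Hs_def)
    have e0: "e' \<noteq> 0" "1 < norm e'" using e cd cd0 by auto
    have "(\<lambda>w. beta_primitive a b e e' w / w) = (\<lambda>w. h w / (w - 1 / e'))"
    proof
      fix w
      have f: "G (e' * w) = Greg (e' * w) * (- 1 / e') / (w - 1 / e')"
        unfolding egamma_eq_reg using e0 by (simp add: divide_simps) (simp add: algebra_simps)
      show "beta_primitive a b e e' w / w = h w / (w - 1 / e')"
        unfolding beta_primitive_def f h_def Hs_eq Pre_def Gab_def
        by (cases "w = 0") (simp_all add: power3_eq_cube power2_eq_square)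
    qed
    moreover have "residue (\<lambda>w. h w / (w - 1 / e')) (1 / e') = h (1 / e')"
    proof (rule residue_simple)
      show "open (S - {1 / e})" by (simp add: S_def open_Diff)
      have "r0 * norm e' \<le> norm q * max (norm c) (norm d) * max (norm c) (norm d)"
        unfolding r0_def using e by (intro mult_left_mono) (auto simp: le_max_iff_disj)
      also have "\<dots> < 1" using qc qd by (auto simp: max_def power2_eq_square mult.assoc)
      finally have "r0 < norm (1 / e')" using e0 by (simp add: norm_divide less_divide_eq)
      moreover have "norm (1 / e') < r1" using e0 r1 by (auto simp: norm_divide intro: less_trans[of _ 1])
      moreover have "1 / e' \<noteq> 1 / e" using e by auto
      ultimately show "1 / e' \<in> S - {1 / e}"
        unfolding S_def open_annulus_def by blast
      show "h holomorphic_on S - {1 / e}"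
        unfolding h_def
        by (intro holomorphic_on_mult holomorphic_on_const holomorphic_on_subset[OF Hs_hol]
           holomorphic_on_subset[OF pre_hol] holomorphic_on_subset[OF Gab_hol] Gc_hol[OF e(1)]
           holomorphic_on_subset[OF Greg_hol[OF e(2)]]) auto
    qed
    moreover have "h (1 / e') = beta_residue a b e e'"
      using e0 by (simp add: h_def beta_residue_def Hs_eq Pre_def Gab_def field_simps power2_eq_square power3_eq_cube)
    ultimately show ?thesis by simp
  qed
  define I where "I \<rho> = contour_integral (circlepath 0 \<rho>) (\<lambda>w. ?g w / w)" for \<rho>
  have small: "\<exists>\<rho>. r0 < \<rho> \<and> \<rho> < norm (1 / c) \<and> \<rho> < norm (1 / d) \<and> I \<rho> = 0"
  proof (cases "q = 0")
    case False
    define \<rho> where "\<rho> = sqrt (norm q)"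
    have \<rho>: "\<rho> > 0" "\<rho> * \<rho> = norm q" using False by (auto simp: \<rho>_def)
    have lt: "\<rho> * norm e < 1" if "norm q * norm e ^ 2 < 1" for e :: complex
    proof (rule power_less_imp_less_base[of _ 2])
      have "(\<rho> * norm e) ^ 2 = (\<rho> * \<rho>) * norm e ^ 2" by (simp add: power2_eq_square mult_ac)
      then show "(\<rho> * norm e) ^ 2 < 1 ^ 2" using that \<rho>(2) by simp
    qed simp
    have "r0 < \<rho>"
    proof -
      have "\<rho> * (\<rho> * max (norm c) (norm d)) < \<rho> * 1"
        using lt[OF qc] lt[OF qd] \<rho> by (intro mult_strict_left_mono) (auto simp: max_def)
      then show ?thesis using \<rho> by (simp add: r0_def mult.assoc[symmetric])
    qed
    moreover have "\<rho> < norm (1 / c)" "\<rho> < norm (1 / d)"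
      using lt[OF qc] lt[OF qd] cd0 by (auto simp: norm_divide less_divide_eq)
    moreover have "I \<rho> = 0"
    proof -
      have "I \<rho> = contour_integral (circlepath 0 \<rho>) (\<lambda>w. - (?g (q * inverse w) / w))"
        unfolding I_def using beta_primitive_reflect[OF False] \<rho>
        by (intro contour_integral_eq) (auto simp: divide_inverse)
      also have "\<dots> = - contour_integral (circlepath 0 \<rho>) (\<lambda>w. ?g (q * inverse w) / w)"
        by (rule contour_integral_neg)
      also have "contour_integral (circlepath 0 \<rho>) (\<lambda>w. ?g (q * inverse w) / w) =
          contour_integral (circlepath 0 (1 / \<rho>)) (\<lambda>w. ?g (q * w) / w)"
        by (rule circle_integral_invert[OF \<rho>(1)])
      also have "\<dots> = I (norm q * (1 / \<rho>))"
        unfolding I_def using \<rho> False by (intro circle_integral_scale) auto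
      also have "norm q * (1 / \<rho>) = \<rho>" using \<rho> by (simp add: field_simps)
      finally show ?thesis by simp
    qed
    ultimately show ?thesis by blast
  next
    case True
    define \<rho> where "\<rho> = min (norm (1 / c)) (norm (1 / d)) / 2"
    have "min (norm (1 / c)) (norm (1 / d)) > 0" using cd0 by simp
    then have \<rho>: "0 < \<rho>" "2 * \<rho> \<le> norm (1 / c)" "2 * \<rho> \<le> norm (1 / d)"
      by (auto simp: \<rho>_def)
    define h where "h w = - (w\<^sup>2 - 1) / (F (a * w) * F (b * w) * F (c * w) * F (d * w)) *
        (F (p * w / a) * F (p * w / b) * F (p * w / c) * F (p * w / d))" for w
    have F0: "F 0 = 1" by (simp add: dpoch_def D.geo_prod_at_zero)
    have G0: "G u = 1 / F u" and Gs0: "Gs u = F (p / u)" for u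
      unfolding egamma_eq egamma_shift_def using F0 True by simp_all
    have th0: "theta q u = 1 - u" for u unfolding True by (rule theta_base_0)
    have h_eq: "?g w / w = h w" if "w \<noteq> 0" for w
      unfolding beta_primitive_def h_def G0 Gs0 th0 using that
      by (simp add: divide_simps) (simp add: field_simps power2_eq_square power3_eq_cube)
    have "h holomorphic_on ball 0 (2 * \<rho>)"
    proof -
      have nzF: "F (e * w) \<noteq> 0" if "norm w < 2 * \<rho>" "e \<in> {a, b, c, d}" for w e
      proof (rule F_nonzero)
        have 1: "norm w < 1 / norm c" "norm w < 1 / norm d" using that \<rho> by (auto simp: norm_divide)
        then have "norm c * norm w < 1" "norm d * norm w < 1" using cd0 by (auto simp: field_simps)
        moreover have "norm a * norm w \<le> norm c * norm w" "norm b * norm w \<le> norm c * norm w"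
          using ab cd by (auto intro!: mult_right_mono)
        ultimately show "norm (e * w) < 1" using that by (auto simp: norm_mult)
      qed
      show ?thesis unfolding h_def by (intro holomorphic_intros) (use nzF nz cd0 in auto)
    qed
    then have "contour_integral (circlepath 0 \<rho>) h = 0"
      using \<rho> by (intro contour_integral_unique Cauchy_theorem_disc_simple) auto
    moreover have "I \<rho> = contour_integral (circlepath 0 \<rho>) h"
      unfolding I_def using h_eq \<rho> by (intro contour_integral_eq) auto
    ultimately show ?thesis using \<rho> True by (intro exI[of _ \<rho>]) (auto simp: r0_def)
  qed
  then obtain \<rho> where \<rho>: "r0 < \<rho>" "\<rho> < norm (1 / c)" "\<rho> < norm (1 / d)" "I \<rho> = 0" by blast
  have n1: "norm (1 / c) < 1" "norm (1 / d) < 1" using cd cd0 by (auto simp: norm_divide)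
  have "I 1 - I \<rho> = 2 * pi * \<i> * (\<Sum>z\<in>{1 / c, 1 / d}. ((if norm z < 1 then 1 else 0) - (if norm z < \<rho> then 1 else 0)) * residue (\<lambda>w. ?g w / w) z)"
    unfolding I_def using hol r0 r1 \<rho> n1
    by (intro circle_integral_residues[where a = r0 and b = r1]) (auto simp: S_def)
  also have "\<dots> = 2 * pi * \<i> * (residue (\<lambda>w. ?g w / w) (1 / c) + residue (\<lambda>w. ?g w / w) (1 / d))"
    using n1 \<rho> cd0 by auto
  also have "residue (\<lambda>w. ?g w / w) (1 / d) = beta_residue a b c d"
    using residue[of c d] cd0 qd by auto
  also have "residue (\<lambda>w. ?g w / w) (1 / c) = beta_residue a b d c"
    using residue[of d c] cd0 qc by (auto simp: beta_primitive_commute[of a b c d])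
  finally show "contour_integral (circlepath 0 1) (\<lambda>w. ?g w / w) =
    2 * pi * \<i> * (beta_residue a b d c + beta_residue a b c d)" using \<rho>(4) by (simp add: I_def)
  have "sphere 0 1 \<subseteq> S - {1 / c, 1 / d}"
    using n1 \<rho> r1 by (auto simp: S_def open_annulus_def)
  then have "continuous_on (sphere 0 1) (\<lambda>w. ?g w / w)"
    using hol holomorphic_on_imp_continuous_on holomorphic_on_subset by blast
  then have "continuous_on (sphere 0 1) (\<lambda>w. ?g w / w * w)"
    by (rule continuous_on_mult) (rule continuous_on_id)
  then show "continuous_on (sphere 0 1) ?g"
    by (rule continuous_on_eq) auto
qed

end

section \<open>Integrating out the variable on the unit circle\<close>

locale elliptic_inversion =
  fixes p q t x :: complex
  assumes p_less: "norm p < norm t ^ 2" and q_less: "norm q < norm t ^ 2" and t_less: "norm t ^ 2 < 1"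
    and x_gt: "norm t < norm x" and x_lt: "norm x * norm t < 1"
begin

lemma t_norm: "norm t < 1"
  by (rule power_less_imp_less_base[of _ 2]) (use t_less in auto)

lemma nz: "t \<noteq> 0" "x \<noteq> 0"
  using p_less x_gt by auto

sublocale elliptic_bases p q
  using p_less q_less t_less by unfold_locales auto

text \<open>For \<open>w\<close> on the unit circle with \<open>w\<^sup>2 \<noteq> 1\<close>, the residue of \<open>\<Delta>(z, w, x) / z\<close> at \<open>z = w / t\<close> is
  \<open>kern (w / t)\<close>. The same function describes the integral of \<open>\<Delta>(z, w, x) / w\<close> over \<open>w\<close>, which is the
  reason for the final cancellation.\<close>

definition kern :: "complex \<Rightarrow> complex" where
  "kern z = Greg 1 * inverse (G (t\<^sup>2)) *
     (G (t\<^sup>2 * z * x) * G (t\<^sup>2 * z / x) * G (x / z) * G (1 / (x * z))) *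
     inverse (G (1 / z\<^sup>2)) * inverse (G (t\<^sup>2 * z\<^sup>2))"

definition weight :: "complex \<Rightarrow> complex" where
  "weight z = inverse (G (t\<^sup>2) * G (1 / t\<^sup>2)) * inverse (G (z\<^sup>2) * G (1 / z\<^sup>2))"

lemma Delta_eq:
  "Delta p q t z w x = beta_integrand (t * x) (t / x) (z / t) (1 / (t * z)) w * weight z"
  unfolding Delta_def egammas_def beta_integrand_def weight_def
  by (simp add: divide_inverse mult_ac power_inverse)

lemma weight_inverse: "weight (1 / z) = weight z"
  by (simp add: weight_def power_one_over mult_ac)

lemma beta_integrand_inverse: "beta_integrand a b c d (1 / w) = beta_integrand a b c d w"
  by (simp add: beta_integrand_def power_one_over mult_ac)

text \<open>Bounds under which all gamma and theta functions involved are regular and nonzero at \<open>z\<close>. They are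
  symmetric under \<open>z \<mapsto> 1 / z\<close> and hold on circles whose radius is close to \<open>1\<close> but different from
  \<open>1\<close>, \<open>norm x\<close> and \<open>1 / norm x\<close>.\<close>

definition admissible :: "complex \<Rightarrow> bool" where
  "admissible z \<longleftrightarrow> norm t < norm z \<and> norm z * norm t < 1 \<and>
     norm p * norm z ^ 2 < norm t ^ 2 \<and> norm q * norm z ^ 2 < norm t ^ 2 \<and>
     norm p < norm t ^ 2 * norm z ^ 2 \<and> norm q < norm t ^ 2 * norm z ^ 2 \<and>
     norm z \<noteq> 1 \<and> norm z \<noteq> norm x \<and> norm z * norm x \<noteq> 1"

lemma admissible_inverse:
  assumes "admissible z"
  shows "admissible (1 / z)"
proof -
  have "z \<noteq> 0" using assms by (auto simp: admissible_def)
  then show ?thesis using assms nz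
    by (auto simp: admissible_def norm_divide power_divide divide_simps mult_ac split: if_splits)
qed

definition four_term_const :: "complex \<Rightarrow> complex" where
  "four_term_const z = - (theta p (t\<^sup>2) * theta p (z * x) * theta p (z / x)) / (t * z)"

lemma four_term_const_inverse:
  assumes "z \<noteq> 0"
  shows "four_term_const (1 / z) = four_term_const z"
proof -
  have 1: "theta p (1 / z * x) = - (x / z) * theta p (z / x)"
    using theta_inverse[OF norm_p, of "z / x"] assms nz by simp
  have 2: "theta p (1 / z / x) = - theta p (z * x) / (z * x)"
    using theta_inverse[OF norm_p, of "z * x"] assms nz by simp
  show ?thesis unfolding four_term_const_def 1 2 using assms nz by (simp add: field_simps)
qed

lemma norm_le_t: "e \<in> {p, q} \<Longrightarrow> norm e < norm t"
proof -
  assume "e \<in> {p, q}"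
  then have "norm e < norm t * norm t" using p_less q_less by (auto simp: power2_eq_square)
  also have "\<dots> \<le> norm t * 1" using t_norm by (intro mult_left_mono) auto
  finally show ?thesis by simp
qed

lemma norm_pq_less: "norm p * norm q < norm t ^ 4"
proof -
  have "norm p * norm q < norm t ^ 2 * norm t ^ 2"
    using p_less q_less by (intro mult_strict_mono') auto
  then show ?thesis by (simp add: power_add[symmetric])
qed

text \<open>The reflection \<open>\<Gamma>(u) \<Gamma>(1 / u) \<theta>(u; p) \<theta>(1 / u; q) = 1\<close> at \<open>u = 1 / (t z)\<^sup>2\<close> turns the factors
  that depend on \<open>d\<^sup>2\<close> into \<open>1 / \<Gamma>(t\<^sup>2 z\<^sup>2)\<close>; the theta functions left over by the shifted gamma
  functions form the constant in the four-parameter identity.\<close>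

lemma beta_residue_eq_kern:
  assumes "admissible z"
  shows "beta_residue (t * x) (t / x) (z / t) (1 / (t * z)) * weight z = - four_term_const z * kern z"
proof -
  have z: "norm t < norm z" "norm z * norm t < 1"
     "norm p * norm z ^ 2 < norm t ^ 2" "norm q * norm z ^ 2 < norm t ^ 2"
     "norm p < norm t ^ 2 * norm z ^ 2" "norm q < norm t ^ 2 * norm z ^ 2"
     "norm z \<noteq> 1" "norm z \<noteq> norm x" "norm z * norm x \<noteq> 1"
    using assms by (auto simp: admissible_def)
  have z0: "z \<noteq> 0" using z by auto
  define u where "u = 1 / (t * z)\<^sup>2"
  have u0: "u \<noteq> 0" using nz z0 by (simp add: u_def)
  have nu: "norm u = 1 / (norm t ^ 2 * norm z ^ 2)" by (simp add: u_def norm_divide norm_mult norm_power power_mult_distrib)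
  have pu: "norm p * norm u < 1" "norm q * norm u < 1" unfolding nu using z nz z0 by (auto simp: field_simps)
  have tz1: "norm t ^ 2 * norm z ^ 2 < 1"
    using z(2) power_less_one_iff[of "norm t * norm z" 2] by (simp add: power_mult_distrib mult.commute)
  have u1: "norm u > 1" unfolding nu using tz1 nz z0 by simp
  have neq: "x / z \<noteq> 1" "1 / (z * x) \<noteq> 1" "z\<^sup>2 \<noteq> 1" "u \<noteq> 1" "1 / t\<^sup>2 \<noteq> 1" "t\<^sup>2 \<noteq> 1"
  proof -
    show "x / z \<noteq> 1" using z z0 by (auto simp: field_simps)
    show "1 / (z * x) \<noteq> 1" using z z0 nz by (auto simp: field_simps simp flip: norm_mult)
    show "z\<^sup>2 \<noteq> 1" using z(7) power2_eq_1_iff[of z] by auto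
    show "u \<noteq> 1" using u1 by auto
    show "t\<^sup>2 \<noteq> 1" using t_norm power2_eq_1_iff[of t] by auto
    then show "1 / t\<^sup>2 \<noteq> 1" using nz by (auto simp: field_simps)
  qed
  \<comment> \<open>every argument \<open>u\<close> of a gamma function below satisfies \<open>\<bar>p u\<bar> < 1\<close> and \<open>\<bar>q u\<bar> < 1\<close>\<close>
  have sizes: "norm e * norm (x / z) < 1" "norm e * norm (1 / (z * x)) < 1" "norm e * norm (z\<^sup>2) < 1"
      "norm e * norm (1 / t\<^sup>2) < 1" if e: "e \<in> {p, q}" for e
  proof -
    have e2: "norm e < norm t ^ 2" using e p_less q_less by auto
    have ez: "norm e * norm z ^ 2 < norm t ^ 2" using e z by auto
    then show "norm e * norm (z\<^sup>2) < 1" using t_less by (simp add: norm_power)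
    show "norm e * norm (1 / t\<^sup>2) < 1" using e2 nz by (simp add: norm_divide norm_power)
    have "norm e * norm x * norm t \<le> norm e * 1"
      using x_lt by (subst mult.assoc, intro mult_left_mono) auto
    also have "\<dots> < norm t * norm t" using e2 by (simp add: power2_eq_square)
    finally have "norm e * norm x < norm t" using nz by simp
    then have "norm e * norm x < norm z" using z by simp
    then show "norm e * norm (x / z) < 1" using z0 by (simp add: norm_divide)
    have "norm t * norm t < norm z * norm x" using z x_gt by (intro mult_strict_mono') auto
    then have "norm e < norm z * norm x" using e2 by (simp add: power2_eq_square)
    then show "norm e * norm (1 / (z * x)) < 1" using z0 nz by (simp add: norm_divide norm_mult)
  qed
  have F: "F (x / z) \<noteq> 0" "F (1 / (z * x)) \<noteq> 0" "F (1 / t\<^sup>2) \<noteq> 0" "F u \<noteq> 0"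
    by (rule F_nonzero'[OF sizes(1) sizes(1) neq(1)] F_nonzero'[OF sizes(2) sizes(2) neq(2)]
          F_nonzero'[OF sizes(4) sizes(4) neq(5)] F_nonzero'[OF pu neq(4)]; simp)+
  have Gs: "Gs (x / z) = - (x / z) * theta p (z / x) * G (x / z)"
     "Gs (1 / (z * x)) = - theta p (z * x) / (z * x) * G (1 / (z * x))"
     "Gs (1 / t\<^sup>2) = - theta p (t\<^sup>2) / t\<^sup>2 * G (1 / t\<^sup>2)"
     "Gs u = theta p u * G u"
    using F z0 nz theta_inverse[OF norm_p, of "z / x"] theta_inverse[OF norm_p, of "z * x"]
       theta_inverse[OF norm_p, of "t\<^sup>2"]
    by (simp_all add: egamma_shift_eq_theta)
  have pq1: "norm p * norm q < 1" by (rule norm_pq)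
  have G_nz: "G (z\<^sup>2) \<noteq> 0" "G (1 / t\<^sup>2) \<noteq> 0" "G u \<noteq> 0"
  proof -
    have "norm t ^ 2 < norm z ^ 2" using z by (intro power_strict_mono) auto
    moreover have "norm p * norm q < norm t ^ 2"
      using mult_mono[of "norm p" "norm t ^ 2" "norm q" 1] p_less norm_q
        mult_strict_mono'[of "norm p" "norm t ^ 2" "norm q" 1] by auto
    ultimately show "G (z\<^sup>2) \<noteq> 0"
      by (intro egamma_nonzero[OF _ sizes(3) sizes(3) neq(3)]) (auto simp: norm_power)
    have "1 < norm (1 / t\<^sup>2)" using nz t_less by (simp add: norm_divide norm_power)
    then show "G (1 / t\<^sup>2) \<noteq> 0"
      using pq1 by (intro egamma_nonzero[OF _ sizes(4) sizes(4) neq(5)]) auto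
    show "G u \<noteq> 0" using pq1 u1 by (intro egamma_nonzero[OF _ pu neq(4)]) auto
  qed
  have pair: "theta q u * (theta p u * G u) = - u * inverse (G (1 / u))"
  proof -
    have pqu: "norm p * norm q * norm u < 1"
      using pu norm_q mult_left_mono[of "norm q" 1 "norm p * norm u"] by (simp add: mult_ac)
    have "inverse (G u * G (1 / u)) = theta p u * theta q (1 / u)"
      using u0 u1 pq1 pqu by (intro egamma_pair) auto
    also have "theta q (1 / u) = - theta q u / u" by (rule theta_inverse[OF norm_q u0])
    finally have e: "theta p u * (- theta q u / u) = inverse (G u) * inverse (G (1 / u))" by simp
    have "theta q u * (theta p u * G u) = - u * (theta p u * (- theta q u / u)) * G u"
      using u0 by simp
    also have "\<dots> = - u * inverse (G (1 / u))" unfolding e using G_nz(3) by simp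
    finally show ?thesis .
  qed
  define d where "d = 1 / (t * z)"
  have args: "(t * x) / d = t\<^sup>2 * z * x" "(t / x) / d = t\<^sup>2 * z / x" "(z / t) / d = z\<^sup>2"
     "(t * x) * d = x / z" "(t / x) * d = 1 / (z * x)" "(z / t) * d = 1 / t\<^sup>2" "d\<^sup>2 = u"
     "1 / u = t\<^sup>2 * z\<^sup>2"
    using nz z0 by (simp_all add: d_def u_def power2_eq_square)
  have d0: "d \<noteq> 0" using nz z0 by (simp add: d_def)
  define X where "X = G (t\<^sup>2 * z * x) * G (t\<^sup>2 * z / x) * G (x / z) * G (1 / (z * x))"
  have cancel: "G (z\<^sup>2) * G (1 / t\<^sup>2) * weight z = inverse (G (t\<^sup>2)) * inverse (G (1 / z\<^sup>2))"
    unfolding weight_def using G_nz(1,2) by (simp add: field_simps)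
  have "beta_residue (t * x) (t / x) (z / t) d * weight z =
      (theta q u * (theta p u * G u)) / d ^ 3 * Greg 1 * X *
      (x / z * theta p (z / x)) * (theta p (z * x) / (z * x)) * (- theta p (t\<^sup>2) / t\<^sup>2) *
      (G (z\<^sup>2) * G (1 / t\<^sup>2)) * weight z"
    unfolding beta_residue_def args Gs X_def by (simp add: mult_ac)
  also have "\<dots> = (- u * inverse (G (1 / u))) / d ^ 3 * Greg 1 * X *
      (x / z * theta p (z / x)) * (theta p (z * x) / (z * x)) * (- theta p (t\<^sup>2) / t\<^sup>2) *
      (inverse (G (t\<^sup>2)) * inverse (G (1 / z\<^sup>2)))"
    unfolding pair by (simp only: mult.assoc cancel[unfolded mult.assoc])
  also have "\<dots> = - four_term_const z * kern z"
    unfolding four_term_const_def kern_def args X_def using nz z0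
    by (simp add: u_def d_def field_simps power2_eq_square power3_eq_cube)
  finally show ?thesis by (simp add: d_def)
qed

text \<open>A beta integral whose parameters have product \<open>1\<close> vanishes over a contour that separates the
  poles. Here two parameters have modulus greater than \<open>1\<close>, so the unit circle is not such a contour
  and the integral equals the contribution of the two poles on the wrong side. These two are
  exchanged by \<open>z \<mapsto> 1 / z\<close>.\<close>

lemma Delta_circle_integral:
  assumes z: "admissible z" "1 < norm z"
  shows "contour_integral (circlepath 0 1) (\<lambda>w. Delta p q t z w x / w) =
    - (4 * pi * \<i>) * (kern z + kern (1 / z))"
proof -
  have z': "norm t < norm z" "norm z * norm t < 1"
     "norm p * norm z ^ 2 < norm t ^ 2" "norm q * norm z ^ 2 < norm t ^ 2"
     "norm z \<noteq> norm x" "norm z * norm x \<noteq> 1"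
    using z by (auto simp: admissible_def)
  have z0: "z \<noteq> 0" using z' by auto
  define a b c d where "a = t * x" and "b = t / x" and "c = z / t" and "d = 1 / (t * z)"
  have ab0: "a \<noteq> 0" "b \<noteq> 0" using nz by (auto simp: a_def b_def)
  have ab: "norm a < 1" "norm b < 1"
    using x_lt x_gt nz by (auto simp: a_def b_def norm_mult norm_divide mult.commute)
  have cd: "1 < norm c" "1 < norm d"
    using z' nz z0 by (auto simp: c_def d_def norm_mult norm_divide mult.commute)
  have cdn: "norm c \<noteq> norm d"
  proof
    assume "norm c = norm d"
    then have "norm z * norm z = 1" using nz z0 by (simp add: c_def d_def norm_mult norm_divide field_simps)
    then show False using less_1_mult[OF z(2) z(2)] by simp
  qed
  have norms: "norm c = norm z / norm t" "norm d = 1 / (norm t * norm z)" by (simp_all add: c_def d_def norm_divide norm_mult)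
  have c_le: "norm d \<le> norm c"
  proof -
    have "1 \<le> norm z * norm z" using less_1_mult[OF z(2) z(2)] by simp
    then show ?thesis unfolding norms using nz z0 by (simp add: field_simps)
  qed
  have ec2: "norm e * norm c ^ 2 < 1" "norm e * norm d ^ 2 < 1" "norm e * norm c < 1" "norm e * norm d < 1"
    if "e \<in> {p, q}" for e
  proof -
    show 1: "norm e * norm c ^ 2 < 1" unfolding norms using that z' nz by (auto simp: power_divide field_simps)
    have "norm e * norm d ^ 2 \<le> norm e * norm c ^ 2" using c_le by (intro mult_left_mono power_mono) auto
    then show "norm e * norm d ^ 2 < 1" using 1 by simp
    have "norm e * norm c \<le> norm e * norm c ^ 2" using cd by (intro mult_left_mono) (auto simp: self_le_power)
    then show 2: "norm e * norm c < 1" using 1 by simp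
    have "norm e * norm d \<le> norm e * norm c" using c_le by (intro mult_left_mono) auto
    then show "norm e * norm d < 1" using 2 by simp
  qed
  note prim = beta_primitive_circle_integral[OF ab0 ab cd cdn ec2(3)[of p] ec2(4)[of p] ec2(1)[of q] ec2(2)[of q], simplified]
  define C where "C = four_term_const z"
  have pz: "norm p * norm z ^ 2 < 1" using z' t_less by simp
  have "norm p * norm z * norm z < norm t * norm t" using z'(3) by (simp add: power2_eq_square mult.assoc)
  moreover have "norm t * norm t \<le> norm t * norm z" using z' by (intro mult_left_mono) auto
  ultimately have "norm p * norm z * norm z < norm t * norm z" by linarith
  then have pzt: "norm p * norm z < norm t" using z0 by simp
  have rel: "C * beta_integrand a b c d w = beta_primitive a b c d w + beta_primitive a b c d (1 / w)"
    if w: "norm w = 1" for w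
  proof (rule beta_integrand_eq[OF w])
    fix e assume e: "e \<in> {a, b, c, d}"
    have "norm (e * w) = norm e" "norm (e / w) = norm e" using w by (auto simp: norm_mult norm_divide)
    moreover have "norm p * norm e < 1" "norm q * norm e < 1" "norm e \<noteq> 1"
      using e ec2[of p] ec2[of q] ab cd norm_p norm_q
        mult_strict_mono'[of "norm p" 1 "norm a" 1] mult_strict_mono'[of "norm q" 1 "norm a" 1]
        mult_strict_mono'[of "norm p" 1 "norm b" 1] mult_strict_mono'[of "norm q" 1 "norm b" 1] by auto
    ultimately show "F (e * w) \<noteq> 0 \<and> F (e / w) \<noteq> 0"
      by (intro conjI F_nonzero') auto
  next
    show "theta p (a * w) * theta p (b * w) * theta p (c * w) * theta p (d * w) / w\<^sup>2 -
      theta p (a / w) * theta p (b / w) * theta p (c / w) * theta p (d / w) * w\<^sup>2 = C * (theta p (w\<^sup>2) / w)"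
      using theta_four_parameters[OF norm_p z(2) pz w pzt t_norm z'(2) x_gt x_lt]
      by (simp add: a_def b_def c_def d_def C_def four_term_const_def)
  qed
  have C0: "C \<noteq> 0"
  proof -
    have pt: "norm p < norm t" by (rule norm_le_t) simp
    have "theta p (t\<^sup>2) \<noteq> 0"
    proof (rule theta_nonzero[OF norm_p])
      show "norm p < norm (t\<^sup>2)" using p_less by (simp add: norm_power)
      have "norm p * norm (t\<^sup>2) \<le> 1 * norm (t\<^sup>2)" using norm_p by (intro mult_right_mono) auto
      then show "norm p * norm (t\<^sup>2) < 1" using t_less by (simp add: norm_power)
      show "t\<^sup>2 \<noteq> 1" using t_norm power2_eq_1_iff[of t] by auto
    qed
    moreover have "theta p (z * x) \<noteq> 0"
    proof (rule theta_nonzero[OF norm_p])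
      have "1 * norm x \<le> norm z * norm x" using z by (intro mult_right_mono) auto
      then show "norm p < norm (z * x)" using pt x_gt by (simp add: norm_mult)
      have "norm p * norm z * norm x \<le> norm t * norm x" using pzt by (intro mult_right_mono) auto
      then show "norm p * norm (z * x) < 1" using x_lt by (simp add: norm_mult mult_ac)
      show "z * x \<noteq> 1" using z' by (auto simp flip: norm_mult)
    qed
    moreover have "theta p (z / x) \<noteq> 0"
    proof (rule theta_nonzero[OF norm_p])
      have "norm t * norm x < norm z" using x_lt z(2) by (simp add: mult.commute)
      moreover have "norm p * norm x \<le> norm t * norm x" using pt by (intro mult_right_mono) auto
      ultimately have "norm p * norm x < norm z" by linarith
      then show "norm p < norm (z / x)" using nz by (simp add: norm_divide field_simps)
      show "norm p * norm (z / x) < 1" using pzt x_gt nz by (simp add: norm_divide field_simps)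
      show "z / x \<noteq> 1" using z' nz by auto
    qed
    ultimately show ?thesis using nz z0 by (simp add: C_def four_term_const_def)
  qed
  let ?T = "circlepath 0 1"
  have int: "(\<lambda>w. beta_primitive a b c d w / w) contour_integrable_on ?T"
       "(\<lambda>w. beta_primitive a b c d (inverse w) / w) contour_integrable_on ?T"
    by (intro contour_integrable_on_circlepath_continuous continuous_on_divide continuous_on_id
         continuous_on_compose2[OF prim(1)] prim(1) continuous_on_inverse; auto simp: norm_inverse)+
  have "contour_integral ?T (\<lambda>w. Delta p q t z w x / w) =
      contour_integral ?T (\<lambda>w. weight z / C * (beta_primitive a b c d w / w + beta_primitive a b c d (inverse w) / w))"
  proof (rule contour_integral_eq)
    fix w assume "w \<in> path_image ?T"
    then have "norm w = 1" by simp
    from rel[OF this] have "beta_integrand a b c d w = (beta_primitive a b c d w + beta_primitive a b c d (1 / w)) / C"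
      using C0 by (simp add: field_simps)
    then show "Delta p q t z w x / w =
        weight z / C * (beta_primitive a b c d w / w + beta_primitive a b c d (inverse w) / w)"
      unfolding Delta_eq a_def[symmetric] b_def[symmetric] c_def[symmetric] d_def[symmetric]
      by (simp add: inverse_eq_divide add_divide_distrib ring_distribs mult_ac)
  qed
  also have "\<dots> = weight z / C * (contour_integral ?T (\<lambda>w. beta_primitive a b c d w / w) +
       contour_integral ?T (\<lambda>w. beta_primitive a b c d (inverse w) / w))"
    using int by (subst contour_integral_lmul) (auto simp: contour_integral_add contour_integrable_add)
  also have "contour_integral ?T (\<lambda>w. beta_primitive a b c d (inverse w) / w) =
      contour_integral ?T (\<lambda>w. beta_primitive a b c d w / w)"
    using circle_integral_invert[of 1 "beta_primitive a b c d"] by simp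
  also have "contour_integral ?T (\<lambda>w. beta_primitive a b c d w / w) =
      2 * pi * \<i> * (beta_residue a b d c + beta_residue a b c d)"
    using prim(2) by simp
  also have "weight z / C * (2 * pi * \<i> * (beta_residue a b d c + beta_residue a b c d) +
       2 * pi * \<i> * (beta_residue a b d c + beta_residue a b c d)) =
       4 * pi * \<i> / C * (beta_residue a b c d * weight z + beta_residue a b d c * weight (1 / z))"
    by (simp add: weight_inverse algebra_simps)
  also have "beta_residue a b c d * weight z = - C * kern z"
    using beta_residue_eq_kern[OF z(1)] by (simp add: a_def b_def c_def d_def C_def)
  also have "beta_residue a b d c * weight (1 / z) = - C * kern (1 / z)"
    using beta_residue_eq_kern[OF admissible_inverse[OF z(1)]] z0 nz four_term_const_inverse[OF z0]
    by (simp add: a_def b_def c_def d_def C_def mult.commute)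
  also have "4 * pi * \<i> / C * (- C * kern z + - C * kern (1 / z)) = - (4 * pi * \<i>) * (kern z + kern (1 / z))"
    using C0 by (simp add: field_simps)
  finally show ?thesis .
qed

end

section \<open>Replacing the contours by circles\<close>

lemma annulus_eq: "annulus t \<epsilon> = open_annulus (norm t - \<epsilon>) (1 / norm t + \<epsilon>)"
  by (simp add: annulus_def open_annulus_def inverse_eq_divide)

locale elliptic_inversion_function = elliptic_inversion +
  fixes \<epsilon> :: real and f :: "complex \<Rightarrow> complex"
  assumes eps: "0 < \<epsilon>" "\<epsilon> < norm t"
    and eps_large: "\<And>e. e \<in> {p, q} \<Longrightarrow> norm e * (1 / norm t + \<epsilon>) < norm t"
    and eps_small: "\<And>e. e \<in> {p, q} \<Longrightarrow> norm e < norm t * (norm t - \<epsilon>)"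
    and f_holomorphic: "f holomorphic_on annulus t \<epsilon>"
    and f_symmetric: "\<And>z. z \<in> annulus t \<epsilon> \<Longrightarrow> inverse z \<in> annulus t \<epsilon> \<Longrightarrow> f z = f (inverse z)"
begin

abbreviation A :: "complex set" where "A \<equiv> annulus t \<epsilon>"

lemma A_bounds:
  assumes "z \<in> A"
  shows "z \<noteq> 0" "norm t - \<epsilon> < norm z" "norm z < 1 / norm t + \<epsilon>"
  using assms eps by (auto simp: annulus_eq open_annulus_def)

lemma A_sizes:
  assumes z: "z \<in> A" and e: "e \<in> {p, q}"
  shows "norm e * norm (z / t) < 1" "norm e * norm (1 / (t * z)) < 1"
proof -
  have "norm e * norm z \<le> norm e * (1 / norm t + \<epsilon>)"
    using A_bounds[OF z] by (intro mult_left_mono) auto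
  also have "\<dots> < norm t" by (rule eps_large[OF e])
  finally show "norm e * norm (z / t) < 1" using nz by (simp add: norm_divide)
  have "norm t * (norm t - \<epsilon>) \<le> norm t * norm z"
    using A_bounds[OF z] by (intro mult_left_mono) auto
  then have "norm e < norm t * norm z" using eps_small[OF e] by linarith
  then show "norm e * norm (1 / (t * z)) < 1" using nz A_bounds(1)[OF z] by (simp add: norm_divide norm_mult)
qed

lemma A_pq:
  assumes z: "z \<in> A"
  shows "norm p * norm q < norm (z\<^sup>2)" "norm p * norm q < norm (1 / z\<^sup>2)"
proof -
  have s: "norm e < norm z" "norm e * norm z < 1" if "e \<in> {p, q}" for e
  proof -
    have tz: "norm t * norm z > 0" using nz A_bounds(1)[OF z] by simp
    have "norm e < norm t * norm z"
      using A_sizes(2)[OF z that] tz by (simp add: norm_divide norm_mult)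
    also have "\<dots> \<le> 1 * norm z" using t_norm by (intro mult_right_mono) auto
    finally show "norm e < norm z" by simp
    have "norm e * norm z < norm t" using A_sizes(1)[OF z that] nz by (simp add: norm_divide)
    then show "norm e * norm z < 1" using t_norm by simp
  qed
  have "norm p * norm q < norm z * norm z" using s[of p] s[of q] by (intro mult_strict_mono') auto
  then show "norm p * norm q < norm (z\<^sup>2)" by (simp add: norm_power power2_eq_square norm_mult)
  have "(norm p * norm z) * (norm q * norm z) < 1 * 1" using s[of p] s[of q] by (intro mult_strict_mono') auto
  then show "norm p * norm q < norm (1 / z\<^sup>2)"
    using A_bounds(1)[OF z] by (simp add: norm_divide norm_power power2_eq_square norm_mult field_simps)
qed

text \<open>The kernel \<open>\<Delta>\<close> without the factor that has its pole at \<open>z = w / t\<close>.\<close>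

definition rest :: "complex \<Rightarrow> complex \<Rightarrow> complex" where
  "rest w z = G (t * x * w) * G (t / x * w) * G (t * x / w) * G (t / x / w) *
      (G (z / t * w) * G (z / t / w) * G (1 / (t * z) / w)) * inverse (G (w\<^sup>2) * G (1 / w\<^sup>2)) * weight z"

lemma Delta_rest: "Delta p q t z w x = rest w z * G (1 / (t * z) * w)"
  by (simp add: Delta_eq rest_def beta_integrand_def mult_ac)

lemma Delta_inverse_z: "Delta p q t (1 / z) w x = Delta p q t z w x"
  by (simp add: Delta_eq beta_integrand_def weight_inverse mult_ac)

lemma Delta_inverse_w: "Delta p q t z (1 / w) x = Delta p q t z w x"
  by (simp add: Delta_eq beta_integrand_inverse)

lemma weight_holomorphic: "weight holomorphic_on A"
  unfolding weight_def inverse_mult_distrib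
  by (intro holomorphic_on_mult inverse_egamma_holomorphic holomorphic_intros)
     (use A_bounds A_pq in auto)

lemma rest_holomorphic:
  assumes w: "norm w = 1"
  shows "rest w holomorphic_on A - {t / w, t * w, 1 / (t * w)}"
proof -
  have w0: "w \<noteq> 0" using w by auto
  have sz: "norm e * norm (z / t * w) < 1" "norm e * norm (z / t / w) < 1" "norm e * norm (1 / (t * z) / w) < 1"
    if "z \<in> A" "e \<in> {p, q}" for e z
    using A_sizes[OF that] w by (simp_all add: norm_mult norm_divide)
  have G1: "(\<lambda>z. G (z / t * w)) holomorphic_on A - {t / w, t * w, 1 / (t * w)}"
  proof (intro egamma_holomorphic holomorphic_intros)
    fix z assume z: "z \<in> A - {t / w, t * w, 1 / (t * w)}"
    then show "F (z / t * w) \<noteq> 0" using sz[of z p] sz[of z q] w0 nz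
      by (intro F_nonzero') (auto simp: field_simps)
  qed (use A_bounds nz w0 in auto)
  have G2: "(\<lambda>z. G (z / t / w)) holomorphic_on A - {t / w, t * w, 1 / (t * w)}"
  proof (intro egamma_holomorphic holomorphic_intros)
    fix z assume z: "z \<in> A - {t / w, t * w, 1 / (t * w)}"
    then show "F (z / t / w) \<noteq> 0" using sz[of z p] sz[of z q] w0 nz
      by (intro F_nonzero') (auto simp: field_simps)
  qed (use A_bounds nz w0 in auto)
  have G3: "(\<lambda>z. G (1 / (t * z) / w)) holomorphic_on A - {t / w, t * w, 1 / (t * w)}"
  proof (intro egamma_holomorphic holomorphic_intros)
    fix z assume z: "z \<in> A - {t / w, t * w, 1 / (t * w)}"
    then show "F (1 / (t * z) / w) \<noteq> 0" using sz[of z p] sz[of z q] w0 nz A_bounds(1)[of z]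
      by (intro F_nonzero') (auto simp: field_simps)
  qed (use A_bounds nz w0 in auto)
  show ?thesis unfolding rest_def
    by (intro holomorphic_on_mult holomorphic_on_const G1 G2 G3 holomorphic_on_subset[OF weight_holomorphic]) auto
qed

lemma rest_at_pole:
  assumes w: "norm w = 1" "w\<^sup>2 \<noteq> 1"
  shows "rest w (w / t) * Greg 1 = kern (w / t)"
proof -
  have w0: "w \<noteq> 0" using w by auto
  have pq2: "norm p * norm q < 1" by (rule norm_pq)
  have inv1: "1 / w\<^sup>2 \<noteq> 1" using w w0 by (auto simp: field_simps)
  have t2: "1 < norm (1 / t\<^sup>2)" using nz t_less by (simp add: norm_divide norm_power)
  have small: "norm e * norm (1 / t\<^sup>2) < 1" if "e \<in> {p, q}" for e
    using that p_less q_less nz by (auto simp: norm_divide norm_power)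
  have nwt: "norm ((w / t)\<^sup>2) = norm (1 / t\<^sup>2)" using w by (simp add: norm_divide norm_power power_divide)
  have ne: "(w / t)\<^sup>2 \<noteq> 1" "1 / t\<^sup>2 \<noteq> 1" using nwt t2 by auto
  have G_nz: "G ((w / t)\<^sup>2) \<noteq> 0" "G (1 / t\<^sup>2) \<noteq> 0" "G (1 / w\<^sup>2) \<noteq> 0"
  proof -
    show "G ((w / t)\<^sup>2) \<noteq> 0"
      using small[of p] small[of q] ne t2 pq2 unfolding nwt[symmetric] by (intro egamma_nonzero) auto
    show "G (1 / t\<^sup>2) \<noteq> 0"
      using small[of p] small[of q] ne t2 pq2 by (intro egamma_nonzero) auto
    show "G (1 / w\<^sup>2) \<noteq> 0"
      using w inv1 pq2 norm_p norm_q by (intro egamma_nonzero) (auto simp: norm_divide norm_power)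
  qed
  have args: "w / t / t * w = (w / t)\<^sup>2" "w / t / t / w = 1 / t\<^sup>2" "1 / (t * (w / t)) / w = 1 / w\<^sup>2"
     "t\<^sup>2 * (w / t) * x = t * x * w" "t\<^sup>2 * (w / t) / x = t / x * w" "x / (w / t) = t * x / w"
     "1 / (x * (w / t)) = t / x / w" "t\<^sup>2 * (w / t)\<^sup>2 = w\<^sup>2"
    using nz w0 by (simp_all add: power2_eq_square)
  show ?thesis unfolding rest_def kern_def weight_def args
    using G_nz by (simp add: field_simps)
qed

lemma pole_in_A:
  assumes w: "norm w = 1"
  shows "w / t \<in> A" "t / w \<in> A"
proof -
  have "norm t < 1 / norm t" using t_less nz by (simp add: field_simps power2_eq_square)
  then show "w / t \<in> A" "t / w \<in> A"
    using w eps by (auto simp: annulus_eq open_annulus_def norm_divide)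
qed

abbreviation integrand :: "complex \<Rightarrow> complex \<Rightarrow> complex" where
  "integrand w \<equiv> \<lambda>z. Delta p q t z w x * f z / z"

lemma residue_large_pole:
  assumes w: "norm w = 1" "w\<^sup>2 \<noteq> 1"
  shows "residue (integrand w) (w / t) = kern (w / t) * f (w / t)"
proof -
  have w0: "w \<noteq> 0" using w by auto
  define h where "h z = rest w z * Greg (1 / (t * z) * w) * f z" for z
  have op: "open (A - {t / w, t * w, 1 / (t * w)})" by (simp add: annulus_eq open_Diff)
  have n1: "norm (w / t) > 1" "norm t < 1" using w nz t_norm by (simp_all add: norm_divide)
  have mem: "w / t \<in> A - {t / w, t * w, 1 / (t * w)}"
  proof -
    have "norm (w / t) \<noteq> norm (t / w)" "norm (w / t) \<noteq> norm (t * w)"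
      using n1 w by (auto simp: norm_divide norm_mult)
    moreover have "w / t \<noteq> 1 / (t * w)" using w w0 nz by (auto simp: field_simps power2_eq_square)
    ultimately show ?thesis using pole_in_A(1)[OF w(1)] by auto
  qed
  have "(\<lambda>z. Greg (1 / (t * z) * w)) holomorphic_on A - {t / w, t * w, 1 / (t * w)}"
  proof (rule egamma_reg_holomorphic)
    fix z assume "z \<in> A - {t / w, t * w, 1 / (t * w)}"
    then show "norm p * norm (1 / (t * z) * w) < 1" "norm q * norm (1 / (t * z) * w) < 1" "1 / (t * z) * w \<noteq> 0"
      using A_sizes(2)[of z] A_bounds(1)[of z] w nz w0 by (simp_all add: norm_mult norm_divide)
  qed (intro holomorphic_intros, use A_bounds nz in auto)
  then have hol: "h holomorphic_on A - {t / w, t * w, 1 / (t * w)}"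
    unfolding h_def
    by (intro holomorphic_on_mult rest_holomorphic w holomorphic_on_subset[OF f_holomorphic]) auto
  have "\<forall>\<^sub>F z in at (w / t). z \<noteq> 0"
    using w0 nz by (intro tendsto_imp_eventually_ne[OF tendsto_ident_at]) auto
  then have "\<forall>\<^sub>F z in at (w / t). integrand w z = h z / (z - w / t)"
  proof eventually_elim
    case (elim z)
    have "1 - 1 / (t * z) * w = (z - w / t) / z" using elim nz by (simp add: field_simps)
    then show ?case unfolding Delta_rest egamma_eq_reg[of "1 / (t * z) * w"] h_def using elim by simp
  qed
  then have "residue (integrand w) (w / t) = residue (\<lambda>z. h z / (z - w / t)) (w / t)"
    by (rule residue_cong) simp
  also have "\<dots> = h (w / t)" by (rule residue_simple[OF op mem hol])
  also have "\<dots> = kern (w / t) * f (w / t)"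
    unfolding h_def rest_at_pole[OF w, symmetric] using nz w0 by simp
  finally show ?thesis .
qed

text \<open>Inversion in \<open>z\<close> preserves \<open>\<Delta>\<close> and changes the sign of \<open>dz / z\<close>, so this is the negative of the
  residue at \<open>w / t\<close>.\<close>

lemma residue_small_pole:
  assumes w: "norm w = 1" "w\<^sup>2 \<noteq> 1"
  shows "residue (integrand w) (t / w) = - (kern (w / t) * f (w / t))"
proof -
  have w0: "w \<noteq> 0" using w by auto
  define h where "h z = rest w (1 / z) * Greg (z / t * w) * (- t / w) * (f z / z)" for z
  define S where "S = open_annulus (max (norm t - \<epsilon>) (1 / (1 / norm t + \<epsilon>))) (min (1 / norm t + \<epsilon>) (1 / (norm t - \<epsilon>)))"
  have tpos: "norm t > 0" using nz by simp
  have S: "z \<in> A" "1 / z \<in> A" if "z \<in> S" for z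
  proof -
    have b: "norm t - \<epsilon> < norm z" "1 / (1 / norm t + \<epsilon>) < norm z" "norm z < 1 / norm t + \<epsilon>" "norm z < 1 / (norm t - \<epsilon>)"
      using that by (auto simp: S_def open_annulus_def)
    then show "z \<in> A" by (simp add: annulus_eq open_annulus_def)
    have hi: "1 / norm t + \<epsilon> > 0" using tpos eps by (intro add_pos_pos) auto
    have zp: "norm z > 0" using b(1) eps by linarith
    have "1 < norm z * (1 / norm t + \<epsilon>)" using b(2) hi by (simp only: pos_divide_less_eq)
    then have "1 / norm z < 1 / norm t + \<epsilon>" using zp by (simp add: pos_divide_less_eq mult.commute)
    moreover have "norm z * (norm t - \<epsilon>) < 1" using b(4) eps by (simp only: pos_less_divide_eq diff_gt_0_iff_gt)
    then have "norm t - \<epsilon> < 1 / norm z" using zp by (simp add: pos_less_divide_eq mult.commute)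
    ultimately show "1 / z \<in> A" by (simp add: annulus_eq open_annulus_def norm_divide)
  qed
  have op: "open (S - {w / t, 1 / (t * w), t * w})" by (simp add: S_def open_Diff)
  have mem: "t / w \<in> S - {w / t, 1 / (t * w), t * w}"
  proof -
    have nt: "norm (t / w) = norm t" using w by (simp add: norm_divide)
    have lt: "norm t < 1 / norm t" using t_less nz by (simp add: field_simps power2_eq_square)
    have "norm t < 1 / norm t + \<epsilon>" using lt eps by linarith
    moreover have "1 < norm t * (1 / norm t + \<epsilon>)" using tpos eps by (simp add: field_simps)
    then have "1 / (1 / norm t + \<epsilon>) < norm t" using tpos eps by (subst pos_divide_less_eq) (auto intro: add_pos_pos)
    moreover have "norm t * (norm t - \<epsilon>) < 1"
    proof -
      have "norm t * (norm t - \<epsilon>) \<le> norm t * norm t" using eps by (intro mult_left_mono) auto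
      then show ?thesis using t_less by (simp add: power2_eq_square)
    qed
    then have "norm t < 1 / (norm t - \<epsilon>)" using eps by (simp add: pos_less_divide_eq)
    ultimately have "t / w \<in> S" using nt eps by (simp add: S_def open_annulus_def)
    moreover have "norm (t / w) \<noteq> norm (w / t)" "norm (t / w) \<noteq> norm (1 / (t * w))"
      using lt w by (auto simp: norm_divide norm_mult)
    moreover have "t / w \<noteq> t * w" using w w0 nz by (auto simp: field_simps power2_eq_square)
    ultimately show ?thesis by auto
  qed
  have "(rest w \<circ> (\<lambda>z. 1 / z)) holomorphic_on S - {w / t, 1 / (t * w), t * w}"
  proof (rule holomorphic_on_compose_gen[OF _ rest_holomorphic[OF w(1)]])
    show "(\<lambda>z. 1 / z) holomorphic_on S - {w / t, 1 / (t * w), t * w}"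
      by (intro holomorphic_intros) (use S A_bounds in auto)
    show "(\<lambda>z. 1 / z) ` (S - {w / t, 1 / (t * w), t * w}) \<subseteq> A - {t / w, t * w, 1 / (t * w)}"
    proof (rule image_subsetI)
      fix z assume z: "z \<in> S - {w / t, 1 / (t * w), t * w}"
      have z0: "z \<noteq> 0" using A_bounds S z by auto
      have "z = w / t" if "1 / z = t / w" using that z0 nz w0 by (simp add: field_simps)
      moreover have "z = 1 / (t * w)" if "1 / z = t * w" using that z0 nz w0 by (simp add: field_simps)
      moreover have "z = t * w" if "1 / z = 1 / (t * w)" using that z0 nz w0 by (simp add: field_simps)
      ultimately show "1 / z \<in> A - {t / w, t * w, 1 / (t * w)}" using z S by blast
    qed
  qed
  then have rest_hol: "(\<lambda>z. rest w (1 / z)) holomorphic_on S - {w / t, 1 / (t * w), t * w}"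
    by (simp add: o_def)
  have hol: "h holomorphic_on S - {w / t, 1 / (t * w), t * w}"
    unfolding h_def
  proof (intro holomorphic_on_mult rest_hol holomorphic_on_divide holomorphic_on_const holomorphic_on_ident
      holomorphic_on_subset[OF f_holomorphic] egamma_reg_holomorphic)
    fix z assume "z \<in> S - {w / t, 1 / (t * w), t * w}"
    then have "z \<in> A" using S by auto
    then show "norm p * norm (z / t * w) < 1" "norm q * norm (z / t * w) < 1"
      using A_sizes(1)[of z] w by (simp_all add: norm_mult norm_divide)
  qed (use A_bounds S nz w0 in auto)
  have "integrand w = (\<lambda>z. h z / (z - t / w))"
  proof
    fix z
    have e: "1 / (1 - z / t * w) = (- t / w) / (z - t / w)"
      using nz w0 by (simp add: divide_simps) (simp add: algebra_simps)
    have "Delta p q t z w x = rest w (1 / z) * (Greg (z / t * w) * (1 / (1 - z / t * w)))"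
      using Delta_rest[of "1 / z" w] egamma_eq_reg[of "z / t * w"] Delta_inverse_z[of z w] by simp
    then show "integrand w z = h z / (z - t / w)"
      unfolding e h_def by (simp add: mult_ac)
  qed
  then have "residue (integrand w) (t / w) = h (t / w)"
    using residue_simple[OF op mem hol] by simp
  also have "\<dots> = - (kern (w / t) * f (t / w))"
    unfolding h_def rest_at_pole[OF w, symmetric] using nz w0 by simp
  also have "f (t / w) = f (w / t)"
    using f_symmetric[of "t / w"] pole_in_A[OF w(1)] by (simp add: inverse_eq_divide)
  finally show ?thesis .
qed

text \<open>The contour and the circle wind equally often around every point outside the annulus. The contour
  encloses the two poles of modulus \<open>1 / norm t\<close> but not those of modulus \<open>norm t\<close>; for the circle it
  is the other way round. The four residues are equal up to sign in pairs, whence the factor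
  \<open>4 \<pi> \<i>\<close> instead of \<open>2 \<pi> \<i>\<close>.\<close>

lemma contour_to_circle:
  assumes w: "norm w = 1"
    and C: "symmetric_contour C" "path_image C \<subseteq> A" "w / t \<in> inside (path_image C)" "1 / (t * w) \<in> inside (path_image C)"
    and s: "norm t < s" "s * norm t < 1"
  shows "integrand w contour_integrable_on C"
    and "contour_integral C (integrand w) = contour_integral (circlepath 0 s) (integrand w) +
      4 * pi * \<i> * (kern (w / t) * f (w / t) + kern (1 / w / t) * f (1 / w / t))"
proof -
  have w0: "w \<noteq> 0" using w by auto
  have G1: "G 1 = 0" by (simp add: egamma_eq_reg)
  have "integrand w contour_integrable_on C \<and> contour_integral C (integrand w) = contour_integral (circlepath 0 s) (integrand w) +
      4 * pi * \<i> * (kern (w / t) * f (w / t) + kern (1 / w / t) * f (1 / w / t))"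
  proof (cases "w\<^sup>2 = 1")
    case True
    \<comment> \<open>the poles merge, but \<open>\<Delta>\<close> contains the factor \<open>1 / \<Gamma>(w\<^sup>2) = 0\<close>\<close>
    then have "integrand w = (\<lambda>z. 0)" by (auto simp: Delta_rest rest_def G1)
    moreover have "kern (w / t) = 0" "kern (1 / w / t) = 0"
      using True nz by (auto simp: kern_def power_divide power_mult_distrib G1)
    moreover have "(\<lambda>z. 0) contour_integrable_on C"
      unfolding contour_integrable_on_def using has_contour_integral_0 by blast
    ultimately show ?thesis by simp
  next
    case False
    have w': "norm (1 / w) = 1" "(1 / w)\<^sup>2 \<noteq> 1" using w False w0 by (auto simp: norm_divide field_simps)
    define pts where "pts = {w / t, 1 / w / t, t / w, t / (1 / w)}"
    have C': "valid_path C" "pathfinish C = pathstart C" "path C"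
      using C(1) by (auto simp: symmetric_contour_def valid_path_imp_path)
    have ins: "w / t \<in> inside (path_image C)" "1 / w / t \<in> inside (path_image C)"
      using C by (auto simp: mult.commute)
    have outs: "t / w \<in> outside (path_image C)" "t / (1 / w) \<in> outside (path_image C)"
    proof -
      have o: "inverse z \<in> outside (path_image C)" if "z \<in> inside (path_image C)" "z \<noteq> 0" for z
        using C(1) that by (auto simp: symmetric_contour_def)
      show "t / w \<in> outside (path_image C)" "t / (1 / w) \<in> outside (path_image C)"
        using o[OF ins(1)] o[OF ins(2)] w0 nz by (auto simp: inverse_eq_divide mult.commute)
    qed
    have wn: "winding_number C (w / t) = 1" "winding_number C (1 / w / t) = 1"
       "winding_number C (t / w) = 0" "winding_number C (t / (1 / w)) = 0"
      using C(1) ins winding_number_zero_in_outside[OF C'(3) C'(2)] outs by (auto simp: symmetric_contour_def)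
    have avoid: "path_image C \<subseteq> A - pts"
      using C(2) ins outs inside_no_overlap[of "path_image C"] outside_no_overlap[of "path_image C"]
      unfolding pts_def by blast
    have lt: "norm t < 1 / norm t" using t_less nz by (simp add: field_simps power2_eq_square)
    have s': "s < 1 / norm t" "0 < s" using s nz by (auto simp: field_simps)
       (meson le_less_trans norm_ge_zero)
    have norms: "norm (w / t) = 1 / norm t" "norm (1 / w / t) = 1 / norm t" "norm (t / w) = norm t" "norm (t / (1 / w)) = norm t"
      using w by (auto simp: norm_divide norm_mult)
    have circ: "path_image (circlepath 0 s) \<subseteq> A - pts"
    proof
      fix z assume "z \<in> path_image (circlepath 0 s)"
      then have "norm z = s" using s' by simp
      then show "z \<in> A - pts" using s s' eps norms unfolding pts_def annulus_eq open_annulus_def by auto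
    qed
    have hol: "integrand w holomorphic_on A - pts"
    proof -
      have "(\<lambda>z. G (1 / (t * z) * w)) holomorphic_on A - {w / t}"
      proof (intro egamma_holomorphic holomorphic_intros)
        fix z assume z: "z \<in> A - {w / t}"
        then have "1 / (t * z) * w \<noteq> 1" using A_bounds(1)[of z] nz by (auto simp: field_simps)
        then show "F (1 / (t * z) * w) \<noteq> 0"
          using A_sizes(2)[of z p] A_sizes(2)[of z q] w z
          by (intro F_nonzero') (auto simp: norm_mult norm_divide)
      qed (use A_bounds nz w0 in auto)
      then have "(\<lambda>z. rest w z * G (1 / (t * z) * w) * f z / z) holomorphic_on A - pts"
        using rest_holomorphic[OF w] f_holomorphic A_bounds(1)
        by (intro holomorphic_on_mult holomorphic_on_divide holomorphic_on_ident)
           (auto simp: pts_def mult.commute elim!: holomorphic_on_subset)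
      then show ?thesis by (simp add: Delta_rest)
    qed
    have op: "open A" "connected A" by (simp_all add: annulus_eq)
    have hom: "winding_number C z = winding_number (circlepath 0 s) z" if z: "z \<notin> A" for z
    proof (cases "norm z \<le> norm t - \<epsilon>")
      case True
      have "winding_number C z = winding_number C 0"
      proof (rule winding_number_eq[OF C'(3) C'(2)])
        show "z \<in> cball 0 (norm t - \<epsilon>)" "0 \<in> cball (0::complex) (norm t - \<epsilon>)" using True eps by auto
        show "connected (cball (0::complex) (norm t - \<epsilon>))" by simp
        show "cball 0 (norm t - \<epsilon>) \<inter> path_image C = {}"
          using C(2) by (auto simp: annulus_eq open_annulus_def)
      qed
      also have "\<dots> = 1" using symmetric_contour_winding_number_0[OF C(1) ins(1)] w0 nz by simp
      finally show ?thesis using True s s' eps by (subst winding_number_circlepath_0) auto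
    next
      case False
      then have zn: "1 / norm t + \<epsilon> \<le> norm z" using z by (auto simp: annulus_eq open_annulus_def)
      have "winding_number C z = 0"
        by (rule winding_number_zero_outside[OF C'(3) _ C'(2), of "ball 0 (1 / norm t + \<epsilon>)"])
           (use zn C(2) in \<open>auto simp: annulus_eq open_annulus_def\<close>)
      then show ?thesis using zn s' eps by (subst winding_number_circlepath_0) auto
    qed
    have distinct: "w / t \<noteq> 1 / w / t" "t / w \<noteq> t / (1 / w)" "w / t \<noteq> t / w" "w / t \<noteq> t / (1 / w)"
       "1 / w / t \<noteq> t / w" "1 / w / t \<noteq> t / (1 / w)"
    proof -
      show "w / t \<noteq> 1 / w / t" "t / w \<noteq> t / (1 / w)"
        using False w0 nz by (auto simp: field_simps power2_eq_square)
      show "w / t \<noteq> t / w" "w / t \<noteq> t / (1 / w)" "1 / w / t \<noteq> t / w" "1 / w / t \<noteq> t / (1 / w)"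
        using norms lt by (metis less_irrefl)+
    qed
    have res: "residue (integrand w) (1 / w / t) = kern (1 / w / t) * f (1 / w / t)"
        "residue (integrand w) (t / (1 / w)) = - (kern (1 / w / t) * f (1 / w / t))"
      using residue_large_pole[OF w'] residue_small_pole[OF w'] by (simp_all only: Delta_inverse_w)
    have "contour_integral C (integrand w) - contour_integral (circlepath 0 s) (integrand w) =
      2 * pi * \<i> * (\<Sum>z\<in>pts. (winding_number C z - winding_number (circlepath 0 s) z) * residue (integrand w) z)"
      by (rule Residue_theorem_two_loops[OF op _ hol C'(1,2) avoid _ _ circ hom]) (auto simp: pts_def)
    also have "(\<Sum>z\<in>pts. (winding_number C z - winding_number (circlepath 0 s) z) * residue (integrand w) z) =
       (\<Sum>z\<in>pts. (if norm z = norm t then - 1 else 1) * residue (integrand w) z)"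
    proof (rule sum.cong)
      fix z assume z: "z \<in> pts"
      have "winding_number (circlepath 0 s) z = (if norm z < s then 1 else 0)"
        using z norms s s' by (intro winding_number_circlepath_0) (auto simp: pts_def)
      then show "(winding_number C z - winding_number (circlepath 0 s) z) * residue (integrand w) z =
          (if norm z = norm t then - 1 else 1) * residue (integrand w) z"
        using z norms wn s s' lt unfolding pts_def by auto
    qed simp
    also have "\<dots> = 2 * (kern (w / t) * f (w / t) + kern (1 / w / t) * f (1 / w / t))"
      unfolding pts_def using distinct norms lt residue_large_pole[OF w False] residue_small_pole[OF w False] res
      by simp
    finally have "contour_integral C (integrand w) = contour_integral (circlepath 0 s) (integrand w) +
      4 * pi * \<i> * (kern (w / t) * f (w / t) + kern (1 / w / t) * f (1 / w / t))"
      by (simp add: algebra_simps)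
    moreover have "integrand w contour_integrable_on C"
      by (rule contour_integrable_holomorphic_simple[OF hol _ C'(1) avoid]) (simp add: pts_def op open_Diff)
    ultimately show ?thesis by blast
  qed
  then show "integrand w contour_integrable_on C"
    "contour_integral C (integrand w) = contour_integral (circlepath 0 s) (integrand w) +
      4 * pi * \<i> * (kern (w / t) * f (w / t) + kern (1 / w / t) * f (1 / w / t))" by blast+
qed

end

section \<open>The outer integral\<close>

context elliptic_bases
begin

lemma F_continuous: "continuous_on S g \<Longrightarrow> continuous_on S (\<lambda>z. F (g z))"
  by (rule continuous_on_compose2[OF holomorphic_on_imp_continuous_on[OF F_holomorphic[OF holomorphic_on_ident]]])
     auto

lemma egamma_continuous:
  assumes "continuous_on S g" "\<And>z. z \<in> S \<Longrightarrow> g z \<noteq> 0" "\<And>z. z \<in> S \<Longrightarrow> F (g z) \<noteq> 0"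
  shows "continuous_on S (\<lambda>z. G (g z))"
  unfolding egamma_eq using assms by (intro continuous_intros F_continuous) auto

lemma inverse_egamma_continuous:
  assumes "continuous_on S g" "\<And>z. z \<in> S \<Longrightarrow> g z \<noteq> 0" "\<And>z. z \<in> S \<Longrightarrow> norm p * norm q < norm (g z)"
  shows "continuous_on S (\<lambda>z. inverse (G (g z)))"
  unfolding egamma_eq inverse_divide using assms
  by (intro continuous_intros F_continuous) (auto simp: F_reflected_nonzero)

end

context elliptic_inversion_function
begin

lemma exists_outer_radius:
  obtains outer_radius where "1 / norm t < outer_radius" "outer_radius < 1 / norm t + \<epsilon>" "outer_radius * norm t ^ 2 * norm x < 1" "outer_radius * norm t ^ 2 < norm x"
proof -
  have t0: "norm t > 0" and x0: "norm x > 0" using nz by auto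
  define hi where "hi = 1 / norm t + \<epsilon>"
  have hi: "hi > 1 / norm t" "hi > 0" using eps t0 by (auto simp: hi_def intro: add_pos_pos)
  define K where "K = max (norm t * norm x) (max (norm t / norm x) (1 / (norm t * hi)))"
  have "norm t / norm x < 1" using x_gt x0 by simp
  moreover have "1 / (norm t * hi) < 1" using hi t0 by (simp add: field_simps)
  ultimately have "K < 1" using x_lt by (simp add: K_def mult.commute)
  then obtain \<rho> where \<rho>: "\<rho> > 1" "K * \<rho> < 1" by (rule exists_radius_gt_1)
  have K: "norm t * norm x \<le> K" "norm t / norm x \<le> K" "1 / (norm t * hi) \<le> K" by (auto simp: K_def)
  have b: "k * \<rho> < 1" if "k \<le> K" for k
    using mult_right_mono[OF that, of \<rho>] \<rho> by linarith
  show ?thesis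
  proof (rule that[of "\<rho> / norm t"])
    show "1 / norm t < \<rho> / norm t" using \<rho> t0 by (simp add: divide_strict_right_mono)
    show "\<rho> / norm t < 1 / norm t + \<epsilon>" using b[OF K(3)] t0 hi unfolding hi_def[symmetric] by (simp add: field_simps)
    show "\<rho> / norm t * norm t ^ 2 * norm x < 1" using b[OF K(1)] t0 by (simp add: power2_eq_square mult_ac)
    show "\<rho> / norm t * norm t ^ 2 < norm x" using b[OF K(2)] t0 x0 by (simp add: power2_eq_square field_simps)
  qed
qed

text \<open>Up to this radius, which exceeds \<open>1 / norm t\<close>, the function \<open>kern\<close> has no poles other than
  \<open>x\<close> and \<open>1 / x\<close>.\<close>

definition outer_radius :: real where
  "outer_radius = (SOME outer_radius. 1 / norm t < outer_radius \<and> outer_radius < 1 / norm t + \<epsilon> \<and> outer_radius * norm t ^ 2 * norm x < 1 \<and> outer_radius * norm t ^ 2 < norm x)"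

lemma outer_radius: "1 / norm t < outer_radius" "outer_radius < 1 / norm t + \<epsilon>" "outer_radius * norm t ^ 2 * norm x < 1" "outer_radius * norm t ^ 2 < norm x"
proof -
  have "\<exists>outer_radius. 1 / norm t < outer_radius \<and> outer_radius < 1 / norm t + \<epsilon> \<and> outer_radius * norm t ^ 2 * norm x < 1 \<and> outer_radius * norm t ^ 2 < norm x"
    using exists_outer_radius by metis
  from someI_ex[OF this] show "1 / norm t < outer_radius" "outer_radius < 1 / norm t + \<epsilon>" "outer_radius * norm t ^ 2 * norm x < 1" "outer_radius * norm t ^ 2 < norm x"
    unfolding outer_radius_def[symmetric] by auto
qed

abbreviation D :: "complex set" where "D \<equiv> open_annulus (norm t) outer_radius"

lemma D_bounds:
  assumes "z \<in> D"
  shows "z \<in> A" "z \<noteq> 0" "norm t < norm z" "norm z < outer_radius"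
  using assms outer_radius eps nz by (auto simp: annulus_eq open_annulus_def)

text \<open>This is \<open>kern\<close> without its zeros \<open>z\<^sup>2 = 1\<close> and its poles \<open>x\<close> and \<open>1 / x\<close>. It stays regular
  when these poles merge at \<open>x = 1\<close> or \<open>x = - 1\<close>.\<close>

definition kern_reg :: "complex \<Rightarrow> complex" where
  "kern_reg z = Greg 1 * inverse (G (t\<^sup>2)) *
     (G (t\<^sup>2 * z * x) * G (t\<^sup>2 * z / x) * Greg (x / z) * Greg (1 / (x * z))) *
     inverse (Greg (1 / z\<^sup>2)) * inverse (G (t\<^sup>2 * z\<^sup>2))"

lemma kern_eq_kern_reg: "kern z = kern_reg z * (1 - 1 / z\<^sup>2) / ((1 - x / z) * (1 - 1 / (x * z)))"
  unfolding kern_def kern_reg_def egamma_eq_reg[of "x / z"] egamma_eq_reg[of "1 / (x * z)"] egamma_eq_reg[of "1 / z\<^sup>2"]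
  by (simp add: divide_inverse mult_ac)

lemma kern_reg_holomorphic: "kern_reg holomorphic_on D"
proof -
  have x_t: "norm e * norm x < norm t" if "e \<in> {p, q}" for e
  proof -
    have "norm e * norm x \<le> norm t ^ 2 * norm x" using that p_less q_less by (intro mult_right_mono) auto
    also have "\<dots> = norm t * (norm x * norm t)" by (simp add: power2_eq_square)
    also have "\<dots> < norm t * 1" using x_lt nz by (intro mult_strict_left_mono) auto
    finally show ?thesis by simp
  qed
  have s1: "norm e * norm (x / z) < 1" "norm e * norm (1 / (x * z)) < 1" "norm e * norm (1 / z\<^sup>2) < 1"
    if z: "z \<in> D" and e: "e \<in> {p, q}" for z e
  proof -
    show "norm e * norm (x / z) < 1" using x_t[OF e] D_bounds[OF z] by (simp add: norm_divide)
    have "norm t * norm t < norm x * norm z" using D_bounds[OF z] x_gt by (intro mult_strict_mono') auto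
    then have "norm e < norm x * norm z" using p_less q_less e by (auto simp: power2_eq_square)
    then show "norm e * norm (1 / (x * z)) < 1" using nz D_bounds[OF z] by (simp add: norm_divide norm_mult)
    have "norm t * norm t < norm z * norm z" using D_bounds[OF z] by (intro mult_strict_mono') auto
    then have "norm e < norm z * norm z" using p_less q_less e by (auto simp: power2_eq_square)
    then show "norm e * norm (1 / z\<^sup>2) < 1"
      using D_bounds[OF z] by (simp add: norm_divide norm_power power2_eq_square norm_mult)
  qed
  have s2: "norm (t\<^sup>2 * z * x) < 1" "norm (t\<^sup>2 * z / x) < 1" "norm p * norm q < norm (t\<^sup>2 * z\<^sup>2)"
    if z: "z \<in> D" for z
  proof -
    have "norm t ^ 2 * norm z * norm x \<le> norm t ^ 2 * outer_radius * norm x"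
      using D_bounds[OF z] by (intro mult_right_mono mult_left_mono) auto
    then show "norm (t\<^sup>2 * z * x) < 1" using outer_radius(3) by (simp add: norm_mult norm_power mult_ac)
    have "norm t ^ 2 * norm z \<le> norm t ^ 2 * outer_radius"
      using D_bounds[OF z] by (intro mult_left_mono) auto
    then have "norm t ^ 2 * norm z < norm x" using outer_radius(4) by (simp add: mult.commute)
    then show "norm (t\<^sup>2 * z / x) < 1" using nz by (simp add: norm_divide norm_mult norm_power)
    have "norm t ^ 2 * norm t ^ 2 \<le> norm t ^ 2 * norm z ^ 2"
      using D_bounds[OF z] by (intro mult_left_mono power_mono) auto
    then show "norm p * norm q < norm (t\<^sup>2 * z\<^sup>2)"
      using norm_pq_less by (simp add: norm_mult norm_power power_add[symmetric])
  qed
  have h1: "(\<lambda>z. G (t\<^sup>2 * z * x)) holomorphic_on D" "(\<lambda>z. G (t\<^sup>2 * z / x)) holomorphic_on D"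
    using D_bounds nz s2 by (auto intro!: egamma_holomorphic holomorphic_intros F_nonzero)
  have h2: "(\<lambda>z. Greg (x / z)) holomorphic_on D" "(\<lambda>z. Greg (1 / (x * z))) holomorphic_on D"
     "(\<lambda>z. Greg (1 / z\<^sup>2)) holomorphic_on D"
    by (rule egamma_reg_holomorphic; (intro holomorphic_intros)?; use D_bounds nz s1 in force)+
  have h3: "(\<lambda>z. inverse (G (t\<^sup>2 * z\<^sup>2))) holomorphic_on D"
    by (rule inverse_egamma_holomorphic) (use D_bounds nz s2 in \<open>auto intro!: holomorphic_intros\<close>)
  have "Greg (1 / z\<^sup>2) \<noteq> 0" if z: "z \<in> D" for z
    using s1(3)[OF z] A_pq(2) D_bounds(1)[OF z] by (intro egamma_reg_nonzero) auto
  then show ?thesis unfolding kern_reg_def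
    by (intro holomorphic_on_mult holomorphic_on_const h1 h2 h3 holomorphic_on_inverse)
qed

lemma kern_reg_at_poles: "kern_reg x = Greg 1 ^ 2" "kern_reg (1 / x) = Greg 1 ^ 2"
proof -
  have t4: "norm t ^ 4 < norm t ^ 2"
    using power_strict_decreasing[of 2 4 "norm t"] t_norm nz by simp
  have tx: "norm t ^ 2 * norm x ^ 2 < 1"
    using x_lt power_strict_mono[of "norm x * norm t" 1 2] by (simp add: power_mult_distrib mult.commute)
  have t2x: "norm t ^ 2 < norm x ^ 2" using x_gt by (intro power_strict_mono) auto
  have x0: "norm x > 0" using nz by simp
  have pq1: "norm p < 1" "norm q < 1" using norm_p norm_q by auto
  have less1: "norm e * norm u < 1" if "e \<in> {p, q}" "norm u < 1" for e u :: complex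
    using that pq1 mult_strict_mono'[of "norm e" 1 "norm u" 1] by auto
  have n: "norm (t\<^sup>2) = norm t ^ 2" "norm (t\<^sup>2 * x\<^sup>2) = norm t ^ 2 * norm x ^ 2" "norm (t\<^sup>2 / x\<^sup>2) = norm t ^ 2 / norm x ^ 2"
     by (auto simp: norm_mult norm_divide norm_power)
  have G1: "G (t\<^sup>2) \<noteq> 0"
  proof (rule egamma_nonzero)
    show "norm p * norm q < norm (t\<^sup>2)" using norm_pq_less t4 n by simp
    show "norm p * norm (t\<^sup>2) < 1" "norm q * norm (t\<^sup>2) < 1" "t\<^sup>2 \<noteq> 1"
      using less1[of _ "t\<^sup>2"] t_less n by auto
  qed
  have G2: "G (t\<^sup>2 * x\<^sup>2) \<noteq> 0"
  proof (rule egamma_nonzero)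
    have "norm t ^ 2 * norm t ^ 2 \<le> norm t ^ 2 * norm x ^ 2"
      using x_gt by (intro mult_left_mono power_mono) auto
    then show "norm p * norm q < norm (t\<^sup>2 * x\<^sup>2)" using norm_pq_less n by (simp add: power_add[symmetric])
    show "norm p * norm (t\<^sup>2 * x\<^sup>2) < 1" "norm q * norm (t\<^sup>2 * x\<^sup>2) < 1" "t\<^sup>2 * x\<^sup>2 \<noteq> 1"
      using less1[of _ "t\<^sup>2 * x\<^sup>2"] tx n by auto
  qed
  have G3: "G (t\<^sup>2 / x\<^sup>2) \<noteq> 0"
  proof (rule egamma_nonzero)
    have "norm t ^ 2 * (norm t ^ 2 * norm x ^ 2) < norm t ^ 2 * 1"
      using tx nz by (intro mult_strict_left_mono) auto
    then have "norm t ^ 4 < norm t ^ 2 / norm x ^ 2" using x0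
      by (simp add: pos_less_divide_eq mult.assoc[symmetric] power_add[symmetric])
    then show "norm p * norm q < norm (t\<^sup>2 / x\<^sup>2)" using norm_pq_less n by simp
    have "norm (t\<^sup>2 / x\<^sup>2) < 1" using t2x x0 n by simp
    then show "norm p * norm (t\<^sup>2 / x\<^sup>2) < 1" "norm q * norm (t\<^sup>2 / x\<^sup>2) < 1" "t\<^sup>2 / x\<^sup>2 \<noteq> 1"
      using less1[of _ "t\<^sup>2 / x\<^sup>2"] by auto
  qed
  have Greg1: "Greg (1 / x\<^sup>2) \<noteq> 0"
  proof (rule egamma_reg_nonzero)
    have "norm t ^ 2 < 1 / norm x ^ 2" using tx x0 by (simp add: pos_less_divide_eq)
    then show "norm p * norm q < norm (1 / x\<^sup>2)" using norm_pq_less t4 by (simp add: norm_divide norm_power)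
    show "norm p * norm (1 / x\<^sup>2) < 1" "norm q * norm (1 / x\<^sup>2) < 1"
      using p_less q_less t2x x0 by (simp_all add: norm_divide norm_power)
  qed
  have Greg2: "Greg (x\<^sup>2) \<noteq> 0"
  proof (rule egamma_reg_nonzero)
    show "norm p * norm q < norm (x\<^sup>2)" using norm_pq_less t4 t2x by (simp add: norm_power)
    have "norm e * norm x ^ 2 \<le> norm t ^ 2 * norm x ^ 2" if "e \<in> {p, q}" for e
      using that p_less q_less by (intro mult_right_mono) auto
    from this[of p] this[of q] show "norm p * norm (x\<^sup>2) < 1" "norm q * norm (x\<^sup>2) < 1"
      using tx by (simp_all add: norm_power)
  qed
  have a1: "t\<^sup>2 * x * x = t\<^sup>2 * x\<^sup>2" "t\<^sup>2 * x / x = t\<^sup>2" "x / x = 1" "1 / (x * x) = 1 / x\<^sup>2"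
    using nz by (simp_all add: power2_eq_square)
  show "kern_reg x = Greg 1 ^ 2"
    unfolding kern_reg_def a1 using G1 G2 Greg1 by (simp add: field_simps power2_eq_square)
  have a2: "t\<^sup>2 * (1 / x) * x = t\<^sup>2" "t\<^sup>2 * (1 / x) / x = t\<^sup>2 / x\<^sup>2" "x / (1 / x) = x\<^sup>2" "1 / (x * (1 / x)) = 1"
     "1 / (1 / x)\<^sup>2 = x\<^sup>2" "t\<^sup>2 * (1 / x)\<^sup>2 = t\<^sup>2 / x\<^sup>2"
    using nz by (simp_all add: power2_eq_square)
  show "kern_reg (1 / x) = Greg 1 ^ 2"
    unfolding kern_reg_def a2 using G1 G3 Greg2 by (simp add: field_simps power2_eq_square)
qed

lemma poles_in_D: "x \<in> D" "1 / x \<in> D"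
proof -
  have "norm x < 1 / norm t" "norm (1 / x) < 1 / norm t" "norm t < norm (1 / x)"
    using x_lt x_gt nz by (auto simp: norm_divide field_simps)
  then show "x \<in> D" "1 / x \<in> D" using x_gt outer_radius(1) by (auto simp: open_annulus_def)
qed

abbreviation kern_f :: "complex \<Rightarrow> complex" where "kern_f \<equiv> \<lambda>z. kern z * f z / z"

lemma f_at_inverse: "f (1 / x) = f x"
  using f_symmetric[of x] D_bounds(1)[OF poles_in_D(1)] D_bounds(1)[OF poles_in_D(2)] by (simp add: inverse_eq_divide)

lemma f_hol_D: "f holomorphic_on D"
  using f_holomorphic D_bounds(1) by (meson holomorphic_on_subset subsetI)

lemma kern_holomorphic: "kern holomorphic_on D - {x, 1 / x}"
proof -
  have "(\<lambda>z. kern_reg z * (1 - 1 / z\<^sup>2) / ((1 - x / z) * (1 - 1 / (x * z)))) holomorphic_on D - {x, 1 / x}"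
    by (intro holomorphic_intros holomorphic_on_subset[OF kern_reg_holomorphic])
       (use D_bounds nz in \<open>auto simp: eq_divide_eq mult.commute\<close>)
  then show ?thesis by (simp flip: kern_eq_kern_reg)
qed

lemma kern_f_holomorphic: "kern_f holomorphic_on D - {x, 1 / x}"
  by (intro holomorphic_intros kern_holomorphic holomorphic_on_subset[OF f_hol_D]) (use D_bounds in auto)

lemma residue_kern_f_by_factor:
  assumes h: "h holomorphic_on D - S" "finite S" and y: "y \<in> D - S"
    and eq: "\<And>z. z \<noteq> 0 \<Longrightarrow> z \<noteq> y \<Longrightarrow> kern_f z = h z / (z - y)"
  shows "residue kern_f y = h y"
proof -
  have "\<forall>\<^sub>F z in at y. z \<noteq> 0"
    using D_bounds(2)[of y] y by (intro tendsto_imp_eventually_ne[OF tendsto_ident_at]) auto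
  moreover have "\<forall>\<^sub>F z in at y. z \<noteq> y" by (simp add: eventually_at_filter)
  ultimately have "\<forall>\<^sub>F z in at y. kern_f z = h z / (z - y)"
    by eventually_elim (rule eq)
  then have "residue kern_f y = residue (\<lambda>z. h z / (z - y)) y"
    by (rule residue_cong) simp
  also have "\<dots> = h y"
    using h y by (intro residue_simple[of "D - S"]) (auto simp: finite_imp_closed open_Diff)
  finally show ?thesis .
qed

text \<open>If \<open>x = 1 / x\<close>, then one of the two merging poles is cancelled by a zero of \<open>1 - 1 / z\<^sup>2\<close>, and the
  remaining simple pole carries the sum of the two residues.\<close>

lemma sum_residues_kern_f:
  "(\<Sum>z\<in>{x, 1 / x}. n z * residue kern_f z) = (n x + n (1 / x)) * (Greg 1 ^ 2 * f x)"
proof (cases "x = 1 / x")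
  case False
  then have x2: "x\<^sup>2 \<noteq> 1" using nz by (auto simp: field_simps power2_eq_square)
  have "residue kern_f x = kern_reg x * f x * (1 - 1 / x\<^sup>2) / (1 - 1 / (x * x))"
  proof (rule residue_kern_f_by_factor[of "\<lambda>z. kern_reg z * f z * (1 - 1 / z\<^sup>2) / (1 - 1 / (x * z))" "{1 / x}" x])
    show "(\<lambda>z. kern_reg z * f z * (1 - 1 / z\<^sup>2) / (1 - 1 / (x * z))) holomorphic_on D - {1 / x}"
      by (intro holomorphic_intros holomorphic_on_subset[OF kern_reg_holomorphic] holomorphic_on_subset[OF f_hol_D])
         (use D_bounds nz in \<open>auto simp: eq_divide_eq mult.commute\<close>)
    fix z :: complex assume z: "z \<noteq> 0" "z \<noteq> x"
    have "(1 - x / z) = (z - x) / z" using z by (simp add: field_simps)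
    then show "kern_f z = kern_reg z * f z * (1 - 1 / z\<^sup>2) / (1 - 1 / (x * z)) / (z - x)"
      unfolding kern_eq_kern_reg using z by (simp add: mult_ac)
  qed (use False poles_in_D in auto)
  then have r1: "residue kern_f x = Greg 1 ^ 2 * f x"
    using x2 nz by (simp add: kern_reg_at_poles power2_eq_square)
  have "residue kern_f (1 / x) = kern_reg (1 / x) * f (1 / x) * (1 - 1 / (1 / x)\<^sup>2) / (1 - x / (1 / x))"
  proof (rule residue_kern_f_by_factor[of "\<lambda>z. kern_reg z * f z * (1 - 1 / z\<^sup>2) / (1 - x / z)" "{x}" "1 / x"])
    show "(\<lambda>z. kern_reg z * f z * (1 - 1 / z\<^sup>2) / (1 - x / z)) holomorphic_on D - {x}"
      by (intro holomorphic_intros holomorphic_on_subset[OF kern_reg_holomorphic] holomorphic_on_subset[OF f_hol_D])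
         (use D_bounds nz in \<open>auto simp: eq_divide_eq mult.commute\<close>)
    fix z :: complex assume z: "z \<noteq> 0" "z \<noteq> 1 / x"
    have "(1 - 1 / (x * z)) = (z - 1 / x) / z" using z nz by (simp add: field_simps)
    then show "kern_f z = kern_reg z * f z * (1 - 1 / z\<^sup>2) / (1 - x / z) / (z - 1 / x)"
      unfolding kern_eq_kern_reg using z by (simp add: mult_ac)
  qed (use False poles_in_D in auto)
  moreover have "1 - 1 / (1 / x)\<^sup>2 = 1 - x\<^sup>2" "1 - x / (1 / x) = 1 - x\<^sup>2" by (simp_all add: power2_eq_square)
  ultimately have r2: "residue kern_f (1 / x) = Greg 1 ^ 2 * f x"
    using x2 by (simp add: kern_reg_at_poles f_at_inverse)
  show ?thesis using False r1 r2 by (simp add: ring_distribs)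
next
  case True
  then have x2: "x * x = 1" using nz by (simp add: field_simps)
  have "residue kern_f x = kern_reg x * f x * (1 + x / x)"
  proof (rule residue_kern_f_by_factor[of "\<lambda>z. kern_reg z * f z * (1 + x / z)" "{}" x])
    show "(\<lambda>z. kern_reg z * f z * (1 + x / z)) holomorphic_on D - {}"
      by (intro holomorphic_intros holomorphic_on_subset[OF kern_reg_holomorphic] holomorphic_on_subset[OF f_hol_D])
         (use D_bounds in auto)
    fix z :: complex assume z: "z \<noteq> 0" "z \<noteq> x"
    have 1: "1 / (x * z) = x / z" using True by (metis divide_divide_eq_left)
    have 2: "1 - 1 / z\<^sup>2 = (1 - x / z) * (1 + x / z)" using x2 z by (simp add: field_simps power2_eq_square)
    have 3: "1 - x / z = (z - x) / z" using z by (simp add: field_simps)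
    show "kern_f z = kern_reg z * f z * (1 + x / z) / (z - x)"
      unfolding kern_eq_kern_reg 1 2 3 using z by simp
  qed (use poles_in_D in auto)
  then have "residue kern_f x = 2 * (Greg 1 ^ 2 * f x)" using nz by (simp add: kern_reg_at_poles)
  then show ?thesis using True[symmetric] by (simp add: algebra_simps)
qed

definition kern_integral :: "real \<Rightarrow> complex" where
  "kern_integral r = contour_integral (circlepath 0 r) kern_f"

lemma circle_radii:
  assumes s: "1 < s" "s * norm t < 1" "s \<noteq> norm x" "s * norm x \<noteq> 1"
    and r: "r \<in> {s, 1 / s, 1 / norm t}"
  shows "norm t < r" "r < outer_radius" "r \<noteq> norm x" "r \<noteq> norm (1 / x)"
proof -
  have t0: "norm t > 0" and x0: "norm x > 0" using nz by auto
  have "norm t < s" "s < 1 / norm t" "norm t < 1 / s" "1 / s < 1 / norm t"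
    using s t_norm t0 by (auto simp: field_simps intro: less_trans[OF t_norm])
  moreover from this have "norm t < 1 / norm t" by linarith
  ultimately show "norm t < r" "r < outer_radius" using r outer_radius(1) by auto
  have "norm x < 1 / norm t" using x_lt t0 by (simp add: pos_less_divide_eq)
  then show "r \<noteq> norm x" using r s s x0 by (auto simp: field_simps)
  have "1 / norm x < 1 / norm t" using x_gt t0 x0 by (simp add: frac_less2)
  moreover have "s \<noteq> 1 / norm x" using s(4) x0 by auto
  ultimately show "r \<noteq> norm (1 / x)" using r s by (auto simp: norm_divide)
qed

text \<open>Each of \<open>x\<close> and \<open>1 / x\<close> lies inside the circle of radius \<open>1 / norm t\<close>, and exactly one of the
  statements "\<open>x\<close> lies inside the circle of radius \<open>s\<close>" and "\<open>1 / x\<close> lies inside the circle of radius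
  \<open>1 / s\<close>" is true, and similarly with \<open>x\<close> and \<open>1 / x\<close> exchanged. So wherever \<open>x\<close> lies, two of the
  four residues survive.\<close>

lemma kern_integral_difference:
  assumes s: "1 < s" "s * norm t < 1" "s \<noteq> norm x" "s * norm x \<noteq> 1"
  shows "2 * kern_integral (1 / norm t) - kern_integral s - kern_integral (1 / s) = 4 * pi * \<i> * (Greg 1 ^ 2 * f x)"
proof -
  have t0: "norm t > 0" using nz by simp
  have xb: "norm x < 1 / norm t" "norm (1 / x) < 1 / norm t" using x_lt x_gt nz by (auto simp: norm_divide field_simps)
  note radii = circle_radii[OF s]
  have diff: "kern_integral (1 / norm t) - kern_integral r = 2 * pi * \<i> *
      (((1 - (if norm x < r then 1 else 0)) + (1 - (if norm (1 / x) < r then 1 else 0))) * (Greg 1 ^ 2 * f x))"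
    if r: "r \<in> {s, 1 / s}" for r
  proof -
    have "kern_integral (1 / norm t) - kern_integral r = 2 * pi * \<i> * (\<Sum>z\<in>{x, 1 / x}.
        ((if norm z < 1 / norm t then 1 else 0) - (if norm z < r then 1 else 0)) * residue kern_f z)"
      unfolding kern_integral_def
    proof (rule circle_integral_residues[OF _ _ _ _ _ _ kern_f_holomorphic])
      show "norm z \<noteq> 1 / norm t \<and> norm z \<noteq> r" if "z \<in> {x, 1 / x}" for z
        using that radii(3,4)[of r] radii(3,4)[of "1 / norm t"] r by auto
    qed (use radii(1,2)[of r] radii(1,2)[of "1 / norm t"] r in auto)
    also have "\<dots> = 2 * pi * \<i> * (((if norm x < 1 / norm t then 1 else 0) - (if norm x < r then 1 else 0) +
        ((if norm (1 / x) < 1 / norm t then 1 else 0) - (if norm (1 / x) < r then 1 else 0))) * (Greg 1 ^ 2 * f x))"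
      unfolding sum_residues_kern_f by (rule refl)
    finally show ?thesis using xb by simp
  qed
  have iff: "norm (1 / x) < s \<longleftrightarrow> \<not> norm x < 1 / s" "norm (1 / x) < 1 / s \<longleftrightarrow> \<not> norm x < s"
    using s nz by (auto simp: norm_divide field_simps)
  have "2 * kern_integral (1 / norm t) - kern_integral s - kern_integral (1 / s) = (kern_integral (1 / norm t) - kern_integral s) + (kern_integral (1 / norm t) - kern_integral (1 / s))" by simp
  also have "\<dots> = 4 * pi * \<i> * (Greg 1 ^ 2 * f x)"
    unfolding diff[of s, simplified] diff[of "1 / s", simplified] using iff by (simp add: algebra_simps)
  finally show ?thesis .
qed

lemma Delta_continuous:
  assumes s: "norm t < s" "s * norm t < 1"
  shows "continuous_on (sphere 0 1 \<times> sphere 0 s) (\<lambda>(w, z). Delta p q t z w x)"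
proof -
  let ?S = "sphere 0 1 \<times> sphere 0 s :: (complex \<times> complex) set"
  have t0: "norm t > 0" and s0: "s > 0" using nz s by (auto intro: less_trans[of 0 "norm t" s])
  have sA: "z \<in> A" if "norm z = s" for z
  proof -
    have "s < 1 / norm t" using s t0 by (simp add: pos_less_divide_eq)
    then show ?thesis using that s eps by (simp add: annulus_eq open_annulus_def)
  qed
  have w0: "fst u \<noteq> 0" "snd u \<noteq> 0" "norm (fst u) = 1" "norm (snd u) = s" if "u \<in> ?S" for u
    using that s0 by auto
  have Fnz: "F e \<noteq> 0" if "norm e < 1 \<or> (1 < norm e \<and> norm p * norm e < 1 \<and> norm q * norm e < 1)" for e
    using that
  proof
    assume e: "1 < norm e \<and> norm p * norm e < 1 \<and> norm q * norm e < 1"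
    then have "e \<noteq> 1" by auto
    then show ?thesis using e by (intro F_nonzero') auto
  qed (rule F_nonzero)
  have ab: "norm (t * x) < 1" "norm (t / x) < 1"
    using x_lt x_gt nz by (auto simp: norm_mult norm_divide mult.commute)
  have zt: "1 < norm (z / t)" "1 < norm (1 / (t * z))" if "norm z = s" for z
    using that s t0 s0 by (auto simp: norm_mult norm_divide field_simps)
  have cont: "continuous_on ?S (\<lambda>u. G (g u))"
    if "continuous_on ?S g" "\<And>u. u \<in> ?S \<Longrightarrow> g u \<noteq> 0"
      "\<And>u. u \<in> ?S \<Longrightarrow> norm (g u) \<in> {norm (t * x), norm (t / x), norm (snd u / t), norm (1 / (t * snd u))}" for g
  proof (rule egamma_continuous[OF that(1,2)])
    fix u assume u: "u \<in> ?S"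
    note z = w0(4)[OF u]
    show "F (g u) \<noteq> 0"
      using that(3)[OF u] ab zt[OF z] A_sizes(1)[OF sA[OF z], of p] A_sizes(1)[OF sA[OF z], of q]
        A_sizes(2)[OF sA[OF z], of p] A_sizes(2)[OF sA[OF z], of q]
      by (intro Fnz) auto
  qed
  have weight_cont: "continuous_on ?S (\<lambda>u. weight (snd u))"
    by (rule continuous_on_compose2[OF holomorphic_on_imp_continuous_on[OF weight_holomorphic]])
       (auto intro!: continuous_intros sA)
  have inv_cont: "continuous_on ?S (\<lambda>u. inverse (G ((fst u)\<^sup>2) * G (1 / (fst u)\<^sup>2)))"
    unfolding inverse_mult_distrib
    by (intro continuous_on_mult inverse_egamma_continuous continuous_intros)
       (use w0 norm_pq in \<open>auto simp: norm_power norm_divide\<close>)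
  have "continuous_on ?S (\<lambda>u. beta_integrand (t * x) (t / x) (snd u / t) (1 / (t * snd u)) (fst u) * weight (snd u))"
    unfolding beta_integrand_def
    by (intro continuous_on_mult weight_cont inv_cont cont continuous_intros)
       (use w0 nz in \<open>auto simp: norm_mult norm_divide\<close>)
  then show ?thesis by (simp add: Delta_eq case_prod_unfold)
qed

text \<open>With all contours replaced by circles, the integral is \<open>4 \<pi> \<i>\<close> times the combination of
  integrals of \<open>kern z * f z / z\<close> over the circles of radius \<open>1 / norm t\<close>, \<open>s\<close> and \<open>1 / s\<close> that was
  evaluated above: the first radius comes from the residues after the substitution \<open>w = t z\<close>, the
  other two from the double integral, where \<open>f z = f (1 / z)\<close> has been used.\<close>

theorem inversion:
  assumes C: "\<And>w. w \<in> sphere 0 1 \<Longrightarrow> symmetric_contour (C w) \<and> path_image (C w) \<subseteq> A \<and>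
         inverse t * w \<in> inside (path_image (C w)) \<and>
         inverse t * inverse w \<in> inside (path_image (C w))"
  shows "\<And>w. w \<in> sphere 0 1 \<Longrightarrow> integrand w contour_integrable_on C w"
    and "(\<lambda>w. contour_integral (C w) (integrand w) / w) contour_integrable_on circlepath 0 1"
    and "(kappa p q)\<^sup>2 * contour_integral (circlepath 0 1) (\<lambda>w. contour_integral (C w) (integrand w) / w) = f x"
proof -
  have t0: "norm t > 0" using nz by simp
  have T: "norm w = 1" "w \<noteq> 0" if "w \<in> sphere 0 1" for w :: complex using that by auto
  \<comment> \<open>\<open>s > 1\<close> keeps the theta functions in the beta integral nonzero, \<open>s\<close> close to \<open>1\<close> lets the circle of radius
    \<open>sqrt (norm q)\<close> separate its poles, and the circle of radius \<open>s\<close> has to avoid \<open>x\<close> and \<open>1 / x\<close>\<close>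
  obtain s where s: "1 < s" "s * norm t < 1" "s \<noteq> norm x" "s * norm x \<noteq> 1"
    "norm p * s ^ 2 < norm t ^ 2" "norm q * s ^ 2 < norm t ^ 2"
  proof -
    define K where "K = max (norm t) (max (sqrt (norm p) / norm t) (sqrt (norm q) / norm t))"
    have "sqrt (norm e) / norm t < 1" if "e \<in> {p, q}" for e
      using that p_less q_less t0 real_less_lsqrt[of "norm t" "norm e"] by auto
    from this[of p] this[of q] have "K < 1" using t_norm by (simp add: K_def)
    then obtain s1 where s1: "s1 > 1" "K * s1 < 1" by (rule exists_radius_gt_1)
    have "infinite ({1<..<s1} - {norm x, 1 / norm x})" using s1 by (simp add: infinite_Ioo)
    then obtain s where "s \<in> {1<..<s1} - {norm x, 1 / norm x}"
      using infinite_imp_nonempty by blast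
    then have s: "1 < s" "s < s1" "s \<noteq> norm x" "s \<noteq> 1 / norm x" by auto
    have b: "l * s < 1" if "l \<le> K" "0 \<le> l" for l
    proof -
      have "l * s \<le> K * s1" using that s by (intro mult_mono) auto
      then show ?thesis using s1 by simp
    qed
    have K: "norm t \<le> K" "sqrt (norm p) / norm t \<le> K" "sqrt (norm q) / norm t \<le> K" by (auto simp: K_def)
    have sq: "norm e * s ^ 2 < norm t ^ 2" if "sqrt (norm e) / norm t \<le> K" for e
    proof -
      have "sqrt (norm e) * s < norm t" using b[OF that] t0 by (simp add: pos_divide_less_eq)
      then have "(sqrt (norm e) * s) ^ 2 < norm t ^ 2" using s by (intro power_strict_mono) auto
      then show ?thesis by (simp add: power_mult_distrib)
    qed
    show ?thesis
      using s b[OF K(1)] sq[OF K(2)] sq[OF K(3)] nz by (intro that[of s]) (auto simp: field_simps)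
  qed
  have ts: "norm t < s" using s t_norm by linarith
  have s0: "s > 0" using s by simp
  have s_lt: "s < 1 / norm t" using s t0 by (simp add: pos_less_divide_eq)
  have adm: "admissible z" if "norm z = s" for z
  proof -
    have "norm t ^ 2 * 1 \<le> norm t ^ 2 * s ^ 2" using s by (intro mult_left_mono) auto
    then show ?thesis using that s ts p_less q_less by (auto simp: admissible_def)
  qed
  have C': "symmetric_contour (C w)" "path_image (C w) \<subseteq> A" "w / t \<in> inside (path_image (C w))"
     "1 / (t * w) \<in> inside (path_image (C w))" if "w \<in> sphere 0 1" for w
    using C[OF that] by (auto simp: divide_inverse mult.commute)
  define k where "k w = kern (w / t) * f (w / t)" for w
  define cs where "cs w = contour_integral (circlepath 0 s) (integrand w)" for w
  show "integrand w contour_integrable_on C w" if "w \<in> sphere 0 1" for w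
    using contour_to_circle(1)[OF T(1)[OF that] C'[OF that] ts s(2)] .
  have inner: "contour_integral (C w) (integrand w) / w = cs w / w + 4 * pi * \<i> * (k w / w + k (inverse w) / w)"
    if "w \<in> sphere 0 1" for w
    using contour_to_circle(2)[OF T(1)[OF that] C'[OF that] ts s(2)]
    by (simp add: k_def cs_def inverse_eq_divide add_divide_distrib ring_distribs)
  have D_sphere: "sphere 0 r \<subseteq> D - {x, 1 / x}" if "r \<in> {s, 1 / s, 1 / norm t}" for r
    using circle_radii[OF s(1-4) that] by (auto simp: open_annulus_def)
  have kern_f_cont: "continuous_on (sphere 0 r) (\<lambda>z. kern z * f z)" if "r \<in> {s, 1 / s, 1 / norm t}" for r
    using holomorphic_on_imp_continuous_on[OF holomorphic_on_subset[OF kern_holomorphic D_sphere[OF that]]]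
      holomorphic_on_imp_continuous_on[OF holomorphic_on_subset[OF f_hol_D, of "sphere 0 r"]] D_sphere[OF that]
    by (intro continuous_on_mult) auto
  have k_cont: "continuous_on (sphere 0 1) k"
    unfolding k_def
    by (rule continuous_on_compose2[OF kern_f_cont[of "1 / norm t"]])
       (use nz in \<open>auto intro!: continuous_intros simp: norm_divide\<close>)
  have f_cont: "continuous_on (sphere 0 s) f"
    using holomorphic_on_imp_continuous_on[OF holomorphic_on_subset[OF f_hol_D, of "sphere 0 s"]] D_sphere[of s] by auto
  have Delta_cont: "continuous_on (sphere 0 1 \<times> sphere 0 s) (\<lambda>(w, z). Delta p q t z w x)"
    by (rule Delta_continuous[OF ts s(2)])
  have integrand_cont: "continuous_on (sphere 0 1 \<times> sphere 0 s) (\<lambda>(w, z). integrand w z)"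
  proof -
    have "continuous_on (sphere 0 1 \<times> sphere 0 s) (\<lambda>u. (case u of (w, z) \<Rightarrow> Delta p q t z w x) * f (snd u) / snd u)"
      using s0 by (intro continuous_on_divide continuous_on_mult Delta_cont continuous_on_snd continuous_on_id
          continuous_on_compose2[OF f_cont]) auto
    then show ?thesis by (simp add: case_prod_unfold)
  qed
  have integrand_w_cont: "continuous_on (sphere 0 1 \<times> sphere 0 s) (\<lambda>(w, z). integrand w z / w)"
  proof -
    have "continuous_on (sphere 0 1 \<times> sphere 0 s) (\<lambda>u. (case u of (w, z) \<Rightarrow> integrand w z) / fst u)"
      by (intro continuous_on_divide integrand_cont continuous_on_fst continuous_on_id) auto
    then show ?thesis by (simp add: case_prod_unfold)
  qed
  have cs_cont: "continuous_on (sphere 0 1) cs"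
    unfolding cs_def using s0 by (intro continuous_on_circle_integral integrand_cont) auto
  let ?T = "circlepath 0 1"
  have int_T: "(\<lambda>w. g w / w) contour_integrable_on circlepath 0 r"
    if "continuous_on (sphere 0 r) g" "r > 0" for g :: "complex \<Rightarrow> complex" and r
    using that by (intro contour_integrable_on_circlepath_continuous continuous_on_divide continuous_on_id) auto
  have ki_cont: "continuous_on (sphere 0 1) (\<lambda>w. k (inverse w))"
    by (rule continuous_on_compose2[OF k_cont]) (auto intro!: continuous_intros simp: norm_inverse)
  have ints: "(\<lambda>w. cs w / w) contour_integrable_on ?T" "(\<lambda>w. k w / w) contour_integrable_on ?T"
     "(\<lambda>w. k (inverse w) / w) contour_integrable_on ?T"
    using int_T[OF cs_cont] int_T[OF k_cont] int_T[OF ki_cont] by auto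
  have "(\<lambda>w. cs w / w + 4 * pi * \<i> * (k w / w + k (inverse w) / w)) contour_integrable_on ?T"
    using ints by (intro contour_integrable_add contour_integrable_lmul)
  then show "(\<lambda>w. contour_integral (C w) (integrand w) / w) contour_integrable_on ?T"
    by (rule contour_integrable_eq) (use inner in auto)
  have "contour_integral ?T (\<lambda>w. contour_integral (C w) (integrand w) / w) =
      contour_integral ?T (\<lambda>w. cs w / w + 4 * pi * \<i> * (k w / w + k (inverse w) / w))"
    by (rule contour_integral_eq) (use inner in auto)
  also have "\<dots> = contour_integral ?T (\<lambda>w. cs w / w) + 4 * pi * \<i> *
      (contour_integral ?T (\<lambda>w. k w / w) + contour_integral ?T (\<lambda>w. k (inverse w) / w))"
    using ints by (simp add: contour_integral_add contour_integral_lmul contour_integrable_add contour_integrable_lmul)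
  also have "contour_integral ?T (\<lambda>w. k (inverse w) / w) = contour_integral ?T (\<lambda>w. k w / w)"
    using circle_integral_invert[of 1 k] by simp
  also have "contour_integral ?T (\<lambda>w. k w / w) = kern_integral (1 / norm t)"
    using circle_integral_scale[of "1 / t" 1 "\<lambda>z. kern z * f z"] nz by (simp add: k_def kern_integral_def norm_divide)
  also have "contour_integral ?T (\<lambda>w. cs w / w) = - (4 * pi * \<i>) * (kern_integral s + kern_integral (1 / s))"
  proof -
    have slice1: "continuous_on (sphere 0 s) (integrand w)" if "w \<in> sphere 0 1" for w
    proof -
      have "continuous_on (sphere 0 s) (\<lambda>z. (\<lambda>(w, z). integrand w z) (w, z))"
        by (rule continuous_on_compose2[OF integrand_cont]) (use that in \<open>auto intro!: continuous_intros\<close>)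
      then show ?thesis by simp
    qed
    have slice2: "continuous_on (sphere 0 1) (\<lambda>w. Delta p q t z w x)" if "z \<in> sphere 0 s" for z
    proof -
      have "continuous_on (sphere 0 1) (\<lambda>w. (\<lambda>(w, z). Delta p q t z w x) (w, z))"
        by (rule continuous_on_compose2[OF Delta_cont]) (use that in \<open>auto intro!: continuous_intros\<close>)
      then show ?thesis by simp
    qed
    have "contour_integral ?T (\<lambda>w. cs w / w) =
        contour_integral ?T (\<lambda>w. contour_integral (circlepath 0 s) (\<lambda>z. integrand w z / w))"
    proof (rule contour_integral_eq)
      fix w assume "w \<in> path_image ?T"
      then show "cs w / w = contour_integral (circlepath 0 s) (\<lambda>z. integrand w z / w)"
        unfolding cs_def using slice1[of w] s0
        by (subst contour_integral_div) (auto intro!: contour_integrable_on_circlepath_continuous)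
    qed
    also have "\<dots> = contour_integral (circlepath 0 s) (\<lambda>z. contour_integral ?T (\<lambda>w. integrand w z / w))"
      using integrand_w_cont s0 by (intro circle_integral_swap) auto
    also have "\<dots> = contour_integral (circlepath 0 s)
        (\<lambda>z. - (4 * pi * \<i>) * (kern z * f z / z + kern (inverse z) * f (inverse z) / z))"
    proof (rule contour_integral_eq)
      fix z assume "z \<in> path_image (circlepath 0 s)"
      then have z: "norm z = s" "z \<in> sphere 0 s" using s0 by auto
      have zA: "z \<in> A" "inverse z \<in> A"
      proof -
        have "norm (inverse z) = 1 / s" by (simp add: norm_inverse divide_inverse z)
        then have "inverse z \<in> sphere 0 (1 / s)" by simp
        then show "z \<in> A" "inverse z \<in> A"
          using D_sphere[of s] D_sphere[of "1 / s"] z(2) D_bounds(1) by blast+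
      qed
      have "contour_integral ?T (\<lambda>w. integrand w z / w) = contour_integral ?T (\<lambda>w. f z / z * (Delta p q t z w x / w))"
        by (simp add: mult_ac)
      also have "\<dots> = f z / z * contour_integral ?T (\<lambda>w. Delta p q t z w x / w)"
        using int_T[OF slice2[OF z(2)]] by (intro contour_integral_lmul) auto
      also have "contour_integral ?T (\<lambda>w. Delta p q t z w x / w) = - (4 * pi * \<i>) * (kern z + kern (1 / z))"
        using Delta_circle_integral[OF adm[OF z(1)]] s z by simp
      finally show "contour_integral ?T (\<lambda>w. integrand w z / w) =
          - (4 * pi * \<i>) * (kern z * f z / z + kern (inverse z) * f (inverse z) / z)"
        using f_symmetric[OF zA] by (simp add: inverse_eq_divide add_divide_distrib ring_distribs mult_ac)
    qed
    also have "\<dots> = - (4 * pi * \<i>) * (kern_integral s + contour_integral (circlepath 0 s) (\<lambda>z. kern (inverse z) * f (inverse z) / z))"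
    proof -
      have c: "continuous_on (sphere 0 s) (\<lambda>z. kern (inverse z) * f (inverse z))"
        by (rule continuous_on_compose2[OF kern_f_cont[of "1 / s"]])
           (use s0 in \<open>auto intro!: continuous_intros simp: norm_inverse divide_inverse\<close>)
      show ?thesis
        unfolding kern_integral_def using int_T[OF c s0] int_T[OF kern_f_cont[of s] s0]
        by (simp only: contour_integral_lmul contour_integral_add contour_integrable_add insert_iff simp_thms)
    qed
    also have "contour_integral (circlepath 0 s) (\<lambda>z. kern (inverse z) * f (inverse z) / z) = kern_integral (1 / s)"
      unfolding kern_integral_def using circle_integral_invert[OF s0, of "\<lambda>z. kern z * f z"] by simp
    finally show ?thesis .
  qed
  also have "- (4 * pi * \<i>) * (kern_integral s + kern_integral (1 / s)) + 4 * pi * \<i> * (kern_integral (1 / norm t) + kern_integral (1 / norm t)) =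
      4 * pi * \<i> * (2 * kern_integral (1 / norm t) - kern_integral s - kern_integral (1 / s))"
    by (simp add: algebra_simps)
  also have "\<dots> = 4 * pi * \<i> * (4 * pi * \<i> * (Greg 1 ^ 2 * f x))"
    by (simp only: kern_integral_difference[OF s(1-4)])
  finally have "(kappa p q)\<^sup>2 * contour_integral ?T (\<lambda>w. contour_integral (C w) (integrand w) / w) =
      (kappa p q * (4 * pi * \<i>) * Greg 1) ^ 2 * f x"
    by (simp add: power2_eq_square mult_ac)
  also have "kappa p q * (4 * pi * \<i>) * Greg 1 = 1"
    using poch_nonzero(1)[OF norm_p] poch_nonzero(2)[OF norm_q] by (simp add: kappa_def egamma_reg_1)
  finally show "(kappa p q)\<^sup>2 * contour_integral ?T (\<lambda>w. contour_integral (C w) (integrand w) / w) = f x"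
    by simp
qed

end

theorem theorem4p1:
  fixes p q t :: complex
  assumes "max (norm p) (norm q) < (norm t)\<^sup>2" and "(norm t)\<^sup>2 < 1"
  shows "\<forall>\<^sub>F \<epsilon> in at_right (0::real).
    \<forall>(f :: complex \<Rightarrow> complex) (C :: complex \<Rightarrow> real \<Rightarrow> complex).
      f holomorphic_on annulus t \<epsilon> \<longrightarrow>
      (\<forall>z. z \<in> annulus t \<epsilon> \<and> inverse z \<in> annulus t \<epsilon> \<longrightarrow> f z = f (inverse z)) \<longrightarrow>
      (\<forall>w \<in> sphere 0 1. symmetric_contour (C w) \<and> path_image (C w) \<subseteq> annulus t \<epsilon> \<and>
         inverse t * w \<in> inside (path_image (C w)) \<and>
         inverse t * inverse w \<in> inside (path_image (C w))) \<longrightarrow>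
      (\<forall>x. norm t < norm x \<and> norm x < inverse (norm t) \<longrightarrow>
         (\<forall>w \<in> sphere 0 1. (\<lambda>z. Delta p q t z w x * f z / z) contour_integrable_on C w) \<and>
         (\<lambda>w. contour_integral (C w) (\<lambda>z. Delta p q t z w x * f z / z) / w)
           contour_integrable_on circlepath 0 1 \<and>
         (kappa p q)\<^sup>2 * contour_integral (circlepath 0 1)
           (\<lambda>w. contour_integral (C w) (\<lambda>z. Delta p q t z w x * f z / z) / w) = f x)"
proof -
  define M where "M = max (norm p) (norm q)"
  have M: "norm p \<le> M" "norm q \<le> M" "M < norm t ^ 2" "0 \<le> M" using assms by (auto simp: M_def le_max_iff_disj)
  then have t0: "norm t > 0" by (cases "t = 0") auto
  have "\<forall>\<^sub>F \<epsilon> in at_right (0::real). 0 < \<epsilon>" by (rule eventually_at_right_less)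
  moreover have "\<forall>\<^sub>F \<epsilon> in at_right (0::real). \<epsilon> < norm t"
    by (rule order_tendstoD(2)[OF tendsto_ident_at t0])
  moreover have "\<forall>\<^sub>F \<epsilon> in at_right (0::real). M * (1 / norm t + \<epsilon>) < norm t"
  proof (rule order_tendstoD(2))
    show "((\<lambda>\<epsilon>. M * (1 / norm t + \<epsilon>)) \<longlongrightarrow> M * (1 / norm t + 0)) (at_right 0)"
      by (intro tendsto_intros)
    show "M * (1 / norm t + 0) < norm t" using M t0 by (simp add: pos_divide_less_eq power2_eq_square)
  qed
  moreover have "\<forall>\<^sub>F \<epsilon> in at_right (0::real). M < norm t * (norm t - \<epsilon>)"
  proof (rule order_tendstoD(1))
    show "((\<lambda>\<epsilon>. norm t * (norm t - \<epsilon>)) \<longlongrightarrow> norm t * (norm t - 0)) (at_right 0)"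
      by (intro tendsto_intros)
    show "M < norm t * (norm t - 0)" using M by (simp add: power2_eq_square)
  qed
  ultimately show ?thesis
  proof eventually_elim
    case (elim \<epsilon>)
    show ?case
    proof (intro allI impI)
      fix f :: "complex \<Rightarrow> complex" and C :: "complex \<Rightarrow> real \<Rightarrow> complex" and x :: complex
      assume f: "f holomorphic_on annulus t \<epsilon>" "\<forall>z. z \<in> annulus t \<epsilon> \<and> inverse z \<in> annulus t \<epsilon> \<longrightarrow> f z = f (inverse z)"
        and C: "\<forall>w \<in> sphere 0 1. symmetric_contour (C w) \<and> path_image (C w) \<subseteq> annulus t \<epsilon> \<and>
         inverse t * w \<in> inside (path_image (C w)) \<and>
         inverse t * inverse w \<in> inside (path_image (C w))"
        and x: "norm t < norm x \<and> norm x < inverse (norm t)"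
      have e: "norm e * (1 / norm t + \<epsilon>) < norm t" "norm e < norm t * (norm t - \<epsilon>)" if "e \<in> {p, q}" for e
      proof -
        have "norm e \<le> M" using that M by auto
        moreover from this have "norm e * (1 / norm t + \<epsilon>) \<le> M * (1 / norm t + \<epsilon>)"
          using elim t0 by (intro mult_right_mono add_nonneg_nonneg) auto
        ultimately show "norm e * (1 / norm t + \<epsilon>) < norm t" "norm e < norm t * (norm t - \<epsilon>)"
          using elim by linarith+
      qed
      interpret elliptic_inversion_function p q t x \<epsilon> f
      proof
        show "norm p < (norm t)\<^sup>2" "norm q < (norm t)\<^sup>2" using M by linarith+
        show "(norm t)\<^sup>2 < 1" by (rule assms(2))
        show "norm t < norm x" using x by simp
        show "norm x * norm t < 1" using x t0 by (simp add: inverse_eq_divide pos_less_divide_eq)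
        show "0 < \<epsilon>" "\<epsilon> < norm t" by (fact elim)+
        show "f holomorphic_on annulus t \<epsilon>" by (fact f(1))
        show "f z = f (inverse z)" if "z \<in> annulus t \<epsilon>" "inverse z \<in> annulus t \<epsilon>" for z
          using f(2) that by blast
      qed (fact e)+
      show "(\<forall>w \<in> sphere 0 1. (\<lambda>z. Delta p q t z w x * f z / z) contour_integrable_on C w) \<and>
         (\<lambda>w. contour_integral (C w) (\<lambda>z. Delta p q t z w x * f z / z) / w)
           contour_integrable_on circlepath 0 1 \<and>
         (kappa p q)\<^sup>2 * contour_integral (circlepath 0 1)
           (\<lambda>w. contour_integral (C w) (\<lambda>z. Delta p q t z w x * f z / z) / w) = f x"
        by (intro conjI ballI inversion) (use C in blast)+
    qed
  qed
qed

end
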